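(* Assume there are constants $M\ge m>0$ with $m\|\varrho(G)x\|\le\|Ax\|\le M\|\varrho(G)x\|$ for all $x\in X$, and that $x^\dagger-x_0=G^pv$ with $v\in X$, $\|v\|\le E$, for some positive constants $p,E$. Let $\sigma_n$ be chosen by the discrepancy principle, i.e. such that $C_1\delta\le\|Ax_n^\delta-y^\delta\|\le C_2\delta$ with constants $1<C_1\le C_2$. Assume moreover: (i) in the case of high order regularization ($s\ge p$), that $w^2=1/h^2$ is operator monotone; (ii) in the case of low order regularization ($s\le p$), that $h^2$ is operator monotone and $h(t)/\sqrt t$ is decreasing. Assume in addition that $\xi_p(t):=\psi_p^2(t^{1/(2p)})$ is convex. Then $$\|x_n^\delta-x^\dagger\|\le c_1\big[\psi_p^{-1}(c_2\delta)\big]^p$$ with some constants $c_1,c_2$ (which can be extracted from the proof).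
   Context: Setting. $X,Y$ are Hilbert spaces; $A\in\mathcal L(X,Y)$ is linear, injective and bounded with non-closed range; $y\in\mathcal R(A)$, $x^\dagger\in X$ is the unique solution of $Ax=y$, and $y^\delta\in Y$ satisfies $\|y-y^\delta\|\le\delta$; $x_0\in X$ is a starting value. $B:\mathcal D(B)\subset X\to X$ is an unbounded densely defined self-adjoint strictly positive definite operator, $G:=B^{-1}$ (bounded, linear, injective, self-adjoint, with non-closed range), $a:=\|G\|$. Method. $s$ is a (generally nonnegative) real number, $T:=AG^s$, $\alpha_1,\dots,\alpha_n>0$, $\sigma_n:=\sum_{k=1}^n1/\alpha_k$ (the regularization parameter), and $$x_n^\delta:=x_0+G^sg_n(T^*T)T^*(y^\delta-Ax_0),\qquad g_n(\lambda)=\frac1\lambda\Big(1-\prod_{k=1}^n\frac{\alpha_k}{\lambda+\alpha_k}\Big).$$ Functions. An index function is a continuous, strictly increasing function $(0,a]\to(0,b]$ with limit $0$ at $0+$. $\varrho:(0,a]\to(0,b]$ is an index function with $a=\|G\|$, $b=\varrho(a)$. $\psi_r(\lambda):=\lambda^r\varrho(\lambda)$, $\psi_r:(0,a]\to(0,a^r\varrho(a)]$, for constants $r$ for which $\lambda^r\varrho(\lambda)$ is monotonically increasing. $h(t):=[\psi_s^{-1}(\sqrt t)]^{p-s}$ and $w(t):=1/h(t)$. An index function $f$ on an interval $(0,c]$ is operator monotone if for any pair of self-adjoint linear operators $S_1,S_2$ with spectra in $(0,c]$, $S_1\le S_2$ implies $f(S_1)\le f(S_2)$; here $S_1\le S_2$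 means $(S_1x,x)\le(S_2x,x)$ for all $x\in X$. *)

theory Defs
  imports "HOL-Analysis.Analysis" "HOL-Computational_Algebra.Polynomial"
begin

text \<open>Hilbert spaces are rendered as types of sort \<open>{real_inner, banach}\<close>, bounded linear
  operators as \<open>blinfun\<close>s.\<close>

section \<open>Bounded operators: adjoint, spectrum, functional calculus\<close>

definition adj_op :: "('x::real_inner \<Rightarrow>\<^sub>L 'y::real_inner) \<Rightarrow> ('y \<Rightarrow>\<^sub>L 'x)" where
  "adj_op T = Blinfun (adjoint (blinfun_apply T))"

definition selfadjoint_op :: "('x::real_inner \<Rightarrow>\<^sub>L 'x) \<Rightarrow> bool" where
  "selfadjoint_op S \<longleftrightarrow> (\<forall>x y. S x \<bullet> y = x \<bullet> S y)"

text \<open>Only the real part of the spectrum is recorded; it is used for self-adjoint operators only,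
  where this is the whole spectrum.\<close>

definition spectrum :: "('x::real_normed_vector \<Rightarrow>\<^sub>L 'x) \<Rightarrow> real set" where
  "spectrum S = {l. \<not> (\<exists>R. R o\<^sub>L (S - l *\<^sub>R id_blinfun) = id_blinfun
                        \<and> (S - l *\<^sub>R id_blinfun) o\<^sub>L R = id_blinfun)}"

definition poly_op :: "real poly \<Rightarrow> ('x::real_normed_vector \<Rightarrow>\<^sub>L 'x) \<Rightarrow> ('x \<Rightarrow>\<^sub>L 'x)" where
  "poly_op P S = (\<Sum>i\<le>degree P. coeff P i *\<^sub>R (((o\<^sub>L) S) ^^ i) id_blinfun)"

text \<open>Continuous functional calculus of a bounded self-adjoint operator: \<open>f(S)\<close> is the norm limit
  of \<open>P\<^sub>k(S)\<close> for all polynomials \<open>P\<^sub>k\<close> tending to \<open>f\<close> uniformly on the spectrum.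
  The point \<open>0\<close> is left out because the functions of interest (index functions, powers, \<open>g\<^sub>n\<close>)
  are given on \<open>(0,c]\<close> and have a finite limit at \<open>0+\<close>. For an injective self-adjoint \<open>S\<close>
  the point \<open>0\<close> is not isolated in the spectrum, so that uniform convergence off \<open>0\<close> amounts
  to uniform convergence on the whole spectrum to the continuous extension of \<open>f\<close>; the value
  of the HOL function \<open>f\<close> at \<open>0\<close> is irrelevant. The calculus is only used for
  injective operators.\<close>

definition fun_op :: "(real \<Rightarrow> real) \<Rightarrow> ('x::real_normed_vector \<Rightarrow>\<^sub>L 'x) \<Rightarrow> ('x \<Rightarrow>\<^sub>L 'x)" where
  "fun_op f S = (THE F. \<forall>P. uniform_limit (spectrum S - {0}) (\<lambda>k. poly (P k)) f sequentially
                            \<longrightarrow> (\<lambda>k. poly_op (P k) S) \<longlonglongrightarrow> F)"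

definition le_op :: "('x::real_inner \<Rightarrow>\<^sub>L 'x) \<Rightarrow> ('x \<Rightarrow>\<^sub>L 'x) \<Rightarrow> bool" where
  "le_op S1 S2 \<longleftrightarrow> (\<forall>x. S1 x \<bullet> x \<le> S2 x \<bullet> x)"

text \<open>Operator monotonicity on \<open>(0,c]\<close>, tested on the space \<open>'x\<close>. A self-adjoint operator whose
  spectrum lies in \<open>(0,c]\<close> is bounded, so the quantification over \<open>blinfun\<close>s is no restriction.
  That \<open>f\<close> is an index function is not part of the definition, so that constant functions
  (which arise below if \<open>s = p\<close>) are admitted.\<close>

definition operator_monotone :: "'x::real_inner itself \<Rightarrow> real \<Rightarrow> (real \<Rightarrow> real) \<Rightarrow> bool" where
  "operator_monotone _ c f \<longleftrightarrow>
     (\<forall>S1 S2 :: 'x \<Rightarrow>\<^sub>L 'x. selfadjoint_op S1 \<and> selfadjoint_op S2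
        \<and> spectrum S1 \<subseteq> {0<..c} \<and> spectrum S2 \<subseteq> {0<..c} \<and> le_op S1 S2
        \<longrightarrow> le_op (fun_op f S1) (fun_op f S2))"


section \<open>The unbounded operator generating the Hilbert scale\<close>

text \<open>A partial operator is given by its domain \<open>D\<close> and a total function, of which only the values
  on \<open>D\<close> matter. The last clause says that the graphs of \<open>B\<close> and of its adjoint agree.\<close>

definition densely_defined_selfadjoint :: "'x::real_inner set \<Rightarrow> ('x \<Rightarrow> 'x) \<Rightarrow> bool" where
  "densely_defined_selfadjoint D B \<longleftrightarrow>
     subspace D \<and> closure D = UNIV
     \<and> (\<forall>x\<in>D. \<forall>y\<in>D. B (x + y) = B x + B y) \<and> (\<forall>r. \<forall>x\<in>D. B (r *\<^sub>R x) = r *\<^sub>R B x)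
     \<and> (\<forall>y z. (\<forall>x\<in>D. B x \<bullet> y = x \<bullet> z) \<longleftrightarrow> (y \<in> D \<and> z = B y))"

definition strictly_positive_on :: "'x::real_inner set \<Rightarrow> ('x \<Rightarrow> 'x) \<Rightarrow> bool" where
  "strictly_positive_on D B \<longleftrightarrow> (\<exists>c>0. \<forall>x\<in>D. c * (norm x)\<^sup>2 \<le> B x \<bullet> x)"

definition unbounded_on :: "'x::real_normed_vector set \<Rightarrow> ('x \<Rightarrow> 'x) \<Rightarrow> bool" where
  "unbounded_on D B \<longleftrightarrow> \<not> (\<exists>K. \<forall>x\<in>D. norm (B x) \<le> K * norm x)"

definition inverse_of_on :: "('x::real_normed_vector \<Rightarrow>\<^sub>L 'x) \<Rightarrow> 'x set \<Rightarrow> ('x \<Rightarrow> 'x) \<Rightarrow> bool" where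
  "inverse_of_on G D B \<longleftrightarrow> (\<forall>x\<in>D. G (B x) = x) \<and> (\<forall>x. G x \<in> D \<and> B (G x) = x)"


section \<open>Powers of \<open>G\<close> and the regularization method\<close>

text \<open>For negative \<open>r\<close> the power \<open>G\<^sup>r\<close> is the (in general unbounded) inverse of \<open>G\<^sup>-\<^sup>r\<close>;
  \<open>power_op G r u\<close> is then meaningful for \<open>u\<close> in \<open>power_dom G r\<close> only.\<close>

definition power_dom :: "('x::real_normed_vector \<Rightarrow>\<^sub>L 'x) \<Rightarrow> real \<Rightarrow> 'x set" where
  "power_dom G r = (if 0 \<le> r then UNIV else range (fun_op (\<lambda>l. l powr (- r)) G))"

definition power_op :: "('x::real_normed_vector \<Rightarrow>\<^sub>L 'x) \<Rightarrow> real \<Rightarrow> 'x \<Rightarrow> 'x" where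
  "power_op G r u = (if 0 \<le> r then fun_op (\<lambda>l. l powr r) G u
                     else the_inv (fun_op (\<lambda>l. l powr (- r)) G) u)"

text \<open>\<open>T = A G\<^sup>s\<close>; for negative \<open>s\<close> the product is densely defined, and \<open>T\<close> is its bounded
  linear extension to the whole space.\<close>

definition scale_T :: "('x::real_normed_vector \<Rightarrow>\<^sub>L 'y::real_normed_vector) \<Rightarrow> ('x \<Rightarrow>\<^sub>L 'x)
    \<Rightarrow> real \<Rightarrow> ('x \<Rightarrow>\<^sub>L 'y)" where
  "scale_T A G s = (THE T :: 'x \<Rightarrow>\<^sub>L 'y. \<forall>u\<in>power_dom G s. T u = A (power_op G s u))"

definition g_filter :: "(nat \<Rightarrow> real) \<Rightarrow> nat \<Rightarrow> real \<Rightarrow> real" where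
  "g_filter \<alpha> n l = 1 / l * (1 - (\<Prod>k=1..n. \<alpha> k / (l + \<alpha> k)))"

definition x_iter :: "('x::real_inner \<Rightarrow>\<^sub>L 'y::real_inner) \<Rightarrow> ('x \<Rightarrow>\<^sub>L 'x) \<Rightarrow> real
    \<Rightarrow> (nat \<Rightarrow> real) \<Rightarrow> nat \<Rightarrow> 'x \<Rightarrow> 'y \<Rightarrow> 'x" where
  "x_iter A G s \<alpha> n x0 yd =
     (let T = scale_T A G s
      in x0 + power_op G s (fun_op (g_filter \<alpha> n) (adj_op T o\<^sub>L T) (adj_op T (yd - A x0))))"


section \<open>Index functions and derived functions\<close>

definition index_function :: "real \<Rightarrow> real \<Rightarrow> (real \<Rightarrow> real) \<Rightarrow> bool" where
  "index_function c d f \<longleftrightarrow>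
     f ` {0<..c} \<subseteq> {0<..d} \<and> continuous_on {0<..c} f \<and> strict_mono_on {0<..c} f
     \<and> (f \<longlongrightarrow> 0) (at_right 0)"

definition psi :: "(real \<Rightarrow> real) \<Rightarrow> real \<Rightarrow> real \<Rightarrow> real" where
  "psi \<rho> r l = l powr r * \<rho> l"

text \<open>Inverse of \<open>\<psi>\<^sub>r\<close> as a function on \<open>(0,a]\<close>; meaningful on \<open>psi \<rho> r ` {0<..a}\<close>, which is
  \<open>(0, a\<^sup>r \<rho>(a)]\<close> if \<open>\<psi>\<^sub>r\<close> is an index function.\<close>

definition psi_inv :: "real \<Rightarrow> (real \<Rightarrow> real) \<Rightarrow> real \<Rightarrow> real \<Rightarrow> real" where
  "psi_inv a \<rho> r = the_inv_into {0<..a} (psi \<rho> r)"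

definition h_fun :: "real \<Rightarrow> (real \<Rightarrow> real) \<Rightarrow> real \<Rightarrow> real \<Rightarrow> real \<Rightarrow> real" where
  "h_fun a \<rho> p s t = (psi_inv a \<rho> s (sqrt t)) powr (p - s)"

definition w_fun :: "real \<Rightarrow> (real \<Rightarrow> real) \<Rightarrow> real \<Rightarrow> real \<Rightarrow> real \<Rightarrow> real" where
  "w_fun a \<rho> p s t = 1 / h_fun a \<rho> p s t"

definition xi_fun :: "(real \<Rightarrow> real) \<Rightarrow> real \<Rightarrow> real \<Rightarrow> real" where
  "xi_fun \<rho> p t = (psi \<rho> p (t powr (1 / (2 * p))))\<^sup>2"

end

(*
  Put S = T*T / M^2, H = psi_s(G)^2 and R = G^|p-s|, and let k be h for s <= p and w for p <= s, so
  that k(psi_s(l)^2) = l^|p-s| and k(H) = R. The link condition reads (m/M)^2 H <= S <= H. Since k^2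
  is operator monotone, k^2(S) lies between k^2((m/M)^2 H) and k^2(H) = R^2, and the lower bound is a
  constant multiple of R^2. So k(S) may be exchanged for R everywhere.

  The error is then G^p w. The filter estimates together with the lower bound in the discrepancy
  principle bound |w| independently of delta: delta is dominated by the approximation error, which
  is controlled by N = sqrt(mu) h(mu) at the cut-off mu of the filter, while the propagated noise is
  at most delta / N. The upper bound in the discrepancy principle gives |psi_p(G) w| = O(delta).

  These two bounds are combined through l^(2p) <= l0^(2p) + psi_p(l)^2 / rho(l0)^2, which holds
  because rho is increasing, at l0 = psi_p^-1(c2 delta).
*)
theory Submission
  imports Defs "HOL-Computational_Algebra.Fundamental_Theorem_Algebra"
begin

section \<open>Hilbert space\<close>

text \<open>\<open>S\<close> and \<open>G\<close> need not commute, so a function of one cannot be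
  compared pointwise with a function of the other. They meet only through quadratic forms: filter
  factors are estimated in the calculus of \<open>S\<close>, powers in that of \<open>G\<close>, and
  one passes between \<open>k(S)\<close> and \<open>R\<close> at the cost of a factor
  \<open>K = 1 / \<kappa>\<close>. Ranges are exchanged by duality, with Riesz representation on the
  dense range of \<open>R\<close>.

  The two orders differ in where \<open>R\<close> stands. For s \<le> p the iterate has to be pulled
  back through \<open>R\<close>. For p \<le> s the operator \<open>T\<close> factors through
  \<open>R\<close>, but \<open>v\<close> need not lie in the range of \<open>R\<close> and is
  approximated from there.

  The calculus is given by a description over all approximating polynomials. What it rests on is
  that \<open>P(S)\<close> is nonnegative if the polynomial \<open>P\<close> is nonnegative on the
  spectrum off 0; this comes from factoring real polynomials into linear factors and quadratic ones
  without real roots.\<close>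

lemma closure_subspace_orthogonal:
  fixes V :: "'a::{real_inner,banach} set"
  assumes V: "subspace V"
  obtains z where "z \<in> closure V" "\<And>v. v \<in> V \<Longrightarrow> (y - z) \<bullet> v = 0"
proof -
  define d where "d = Inf ((\<lambda>v. (norm (y - v))\<^sup>2) ` V)"
  have ne: "(\<lambda>v. (norm (y - v))\<^sup>2) ` V \<noteq> {}"
    using subspace_0[OF V] by blast
  have bdd: "bdd_below ((\<lambda>v. (norm (y - v))\<^sup>2) ` V)"
    by (rule bdd_belowI[of _ 0]) auto
  have d_le: "d \<le> (norm (y - v))\<^sup>2" if "v \<in> V" for v
    unfolding d_def by (rule cInf_lower[OF _ bdd]) (use that in auto)
  have "\<exists>v\<in>V. (norm (y - v))\<^sup>2 < d + 1 / Suc n" for n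
    using cInf_lessD[OF ne, of "d + 1 / Suc n"] by (auto simp: d_def)
  then obtain v where vV: "\<And>n. v n \<in> V" and vd: "\<And>n. (norm (y - v n))\<^sup>2 < d + 1 / Suc n"
    by metis
  \<comment> \<open>Parallelogram law: the midpoint of \<open>v i\<close> and \<open>v j\<close>
    lies in \<open>V\<close>, so its squared distance to \<open>y\<close> is at least
    \<open>d\<close>, which forces the two points together.\<close>
  have dist_v: "(norm (v i - v j))\<^sup>2 \<le> 2 / Suc i + 2 / Suc j" for i j
  proof -
    have "(1/2) *\<^sub>R (v i + v j) \<in> V"
      by (intro subspace_scale subspace_add V vV)
    from d_le[OF this] have "4 * d \<le> (norm (2 *\<^sub>R (y - (1/2) *\<^sub>R (v i + v j))))\<^sup>2"
      by (simp add: power_mult_distrib)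
    also have "2 *\<^sub>R (y - (1/2) *\<^sub>R (v i + v j)) = (y - v i) + (y - v j)"
      by (simp add: algebra_simps scaleR_2)
    finally have "4 * d \<le> (norm ((y - v i) + (y - v j)))\<^sup>2" .
    moreover have "(norm (v i - v j))\<^sup>2 = 2 * (norm (y - v i))\<^sup>2 + 2 * (norm (y - v j))\<^sup>2
        - (norm ((y - v i) + (y - v j)))\<^sup>2"
      by (simp add: power2_norm_eq_inner inner_diff_left inner_diff_right inner_add_left
          inner_add_right inner_commute)
    ultimately show ?thesis using vd[of i] vd[of j] by simp
  qed
  have "Cauchy v"
  proof (rule CauchyI)
    fix e :: real assume e: "0 < e"
    obtain k :: nat where k: "4 / e\<^sup>2 < real k" using reals_Archimedean2 by blast
    have "norm (v i - v j) < e" if "k \<le> i" "k \<le> j" for i j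
    proof -
      have k1: "4 / Suc k < e\<^sup>2"
        using k e by (simp add: field_simps) (smt (verit) zero_less_power)
      have "2 / real (Suc i) \<le> 2 / real (Suc k)" "2 / real (Suc j) \<le> 2 / real (Suc k)"
        using that by (auto simp: field_simps)
      with dist_v[of i j] k1 have "(norm (v i - v j))\<^sup>2 < e\<^sup>2" by simp
      then show ?thesis using e by (simp add: power_less_imp_less_base)
    qed
    then show "\<exists>k. \<forall>i\<ge>k. \<forall>j\<ge>k. norm (v i - v j) < e" by blast
  qed
  then obtain z where z: "v \<longlonglongrightarrow> z" by (auto simp: Cauchy_convergent_iff convergent_def)
  have zd: "(norm (y - z))\<^sup>2 \<le> d"
  proof (rule LIMSEQ_le)
    show "(\<lambda>n. (norm (y - v n))\<^sup>2) \<longlonglongrightarrow> (norm (y - z))\<^sup>2" by (intro tendsto_intros z)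
    show "(\<lambda>n. d + 1 / Suc n) \<longlonglongrightarrow> d"
      using tendsto_add[OF tendsto_const[of d] LIMSEQ_inverse_real_of_nat] by (simp add: field_simps)
    show "\<exists>k. \<forall>n\<ge>k. (norm (y - v n))\<^sup>2 \<le> d + 1 / Suc n" using vd less_imp_le by blast
  qed
  show ?thesis
  proof
    show "z \<in> closure V" using z vV closure_sequential by blast
    fix u assume u: "u \<in> V"
    have ge: "d \<le> (norm (y - z - t *\<^sub>R u))\<^sup>2" for t
    proof (rule LIMSEQ_le_const)
      show "(\<lambda>n. (norm (y - v n - t *\<^sub>R u))\<^sup>2) \<longlonglongrightarrow> (norm (y - z - t *\<^sub>R u))\<^sup>2"
        by (intro tendsto_intros z)
      have "d \<le> (norm (y - (v n + t *\<^sub>R u)))\<^sup>2" for n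
        by (intro d_le subspace_add subspace_scale V vV u)
      then show "\<exists>k. \<forall>n\<ge>k. d \<le> (norm (y - v n - t *\<^sub>R u))\<^sup>2" by (simp add: algebra_simps)
    qed
    show "(y - z) \<bullet> u = 0"
    proof (cases "u = 0")
      case False
      \<comment> \<open>The minimizer of the squared norm of \<open>y - z - t u\<close> in
        \<open>t\<close>; there the value would drop below the infimum unless \<open>u\<close> is
        orthogonal to \<open>y - z\<close>.\<close>
      define t where "t = ((y - z) \<bullet> u) / (u \<bullet> u)"
      have uu: "0 < u \<bullet> u" using False by simp
      have "(norm (y - z))\<^sup>2 \<le> (norm (y - z - t *\<^sub>R u))\<^sup>2" using ge zd by (meson order_trans)
      also have "\<dots> = (norm (y - z))\<^sup>2 - 2 * t * ((y - z) \<bullet> u) + t * t * (u \<bullet> u)"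
        by (simp add: power2_norm_eq_inner inner_diff_left inner_diff_right inner_commute algebra_simps)
      also have "\<dots> = (norm (y - z))\<^sup>2 - ((y - z) \<bullet> u)\<^sup>2 / (u \<bullet> u)"
        using uu by (simp add: t_def power2_eq_square)
      finally have "((y - z) \<bullet> u)\<^sup>2 / (u \<bullet> u) \<le> 0" by simp
      then show ?thesis using uu by (simp add: divide_le_0_iff)
    qed simp
  qed
qed

lemma Riesz_representation:
  fixes f :: "'a::{real_inner,banach} \<Rightarrow> real"
  assumes "bounded_linear f"
  obtains z where "\<And>x. f x = x \<bullet> z"
proof (cases "\<forall>x. f x = 0")
  case True
  then show ?thesis using that[of 0] by simp
next
  case False
  then obtain y where y: "f y \<noteq> 0" by blast
  interpret f: bounded_linear f by fact
  have sub: "subspace {x. f x = 0}"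
    by (auto simp: subspace_def f.add f.scaleR f.zero)
  obtain z where z: "z \<in> closure {x. f x = 0}" "\<And>v. v \<in> {x. f x = 0} \<Longrightarrow> (y - z) \<bullet> v = 0"
    using closure_subspace_orthogonal[OF sub, of y] by blast
  have "closed {x. f x = 0}"
    using f.continuous_on[OF continuous_on_id] by (intro closed_Collect_eq) (auto intro: continuous_on_const)
  then have "f z = 0" using z(1) by simp
  define u where "u = y - z"
  have fu: "f u \<noteq> 0" using y \<open>f z = 0\<close> by (simp add: u_def f.diff)
  then have uu: "u \<bullet> u \<noteq> 0" using f.zero by auto
  have "f x = x \<bullet> ((f u / (u \<bullet> u)) *\<^sub>R u)" for x
  proof -
    have "u \<bullet> (f x *\<^sub>R u - f u *\<^sub>R x) = 0"
      unfolding u_def by (rule z(2)) (simp add: f.diff f.scaleR)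
    then show ?thesis using uu by (simp add: inner_diff_right inner_commute field_simps)
  qed
  then show ?thesis using that by blast
qed

text \<open>\<open>adjoint\<close> is a choice, and \<open>Blinfun\<close> is meaningful only for
  bounded linear maps. Riesz representation supplies an adjoint to choose; boundedness follows by
  testing \<open>T\<close> at \<open>adjoint T a\<close>.\<close>

lemma adj_op_works:
  fixes T :: "'x::{real_inner,banach} \<Rightarrow>\<^sub>L 'y::real_inner"
  shows "T x \<bullet> y = x \<bullet> adj_op T y"
proof -
  have "\<exists>z. \<forall>x. T x \<bullet> y = x \<bullet> z" for y
  proof -
    have "bounded_linear (\<lambda>x. T x \<bullet> y)"
      by (rule bounded_linear_compose[OF bounded_linear_inner_left blinfun.bounded_linear_right])
    then show ?thesis using Riesz_representation by metis
  qed
  then have "\<exists>f'. \<forall>x y. T x \<bullet> y = x \<bullet> f' y" by metis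
  then have adj: "T x \<bullet> y = x \<bullet> adjoint T y" for x y
    unfolding adjoint_def by (rule someI2_ex) blast
  have "bounded_linear (adjoint T)"
  proof (rule bounded_linear_intro[of _ "norm T"])
    show "adjoint T (a + b) = adjoint T a + adjoint T b" for a b
      by (rule vector_eq_ldot[THEN iffD1]) (simp add: inner_add_right adj[symmetric])
    show "adjoint T (r *\<^sub>R a) = r *\<^sub>R adjoint T a" for r a
      by (rule vector_eq_ldot[THEN iffD1]) (simp add: adj[symmetric])
    fix a
    have "norm (adjoint T a) * norm (adjoint T a) = T (adjoint T a) \<bullet> a"
      by (simp add: adj power2_norm_eq_inner flip: power2_eq_square)
    also have "\<dots> \<le> norm (T (adjoint T a)) * norm a" by (rule norm_cauchy_schwarz)
    also have "\<dots> \<le> norm T * norm (adjoint T a) * norm a"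
      by (intro mult_right_mono norm_blinfun) auto
    finally have "norm (adjoint T a) * norm (adjoint T a) \<le> norm (adjoint T a) * (norm a * norm T)"
      by (simp add: mult_ac)
    then show "norm (adjoint T a) \<le> norm a * norm T"
      by (cases "norm (adjoint T a) = 0") auto
  qed
  then show ?thesis by (simp add: adj_op_def bounded_linear_Blinfun_apply adj)
qed

text \<open>The component of \<open>y\<close> orthogonal to the range is annihilated by
  \<open>S\<close>, as testing it against \<open>S (S (y - z))\<close> shows; injectivity makes it
  vanish.\<close>

lemma dense_range_selfadjoint:
  fixes S :: "'x::{real_inner,banach} \<Rightarrow>\<^sub>L 'x"
  assumes S: "selfadjoint_op S" and inj: "inj S"
  shows "closure (range S) = UNIV"
proof -
  have sub: "subspace (range S)"
    by (intro linear_subspace_image bounded_linear.linear blinfun.bounded_linear_right subspace_UNIV)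
  have "y \<in> closure (range S)" for y
  proof -
    obtain z where z: "z \<in> closure (range S)" "\<And>v. v \<in> range S \<Longrightarrow> (y - z) \<bullet> v = 0"
      using closure_subspace_orthogonal[OF sub] by blast
    have "S (y - z) \<bullet> S (y - z) = 0"
      using z(2)[of "S (S (y - z))"] S by (metis rangeI selfadjoint_op_def)
    then have "S (y - z) = S 0" by (simp add: blinfun.zero_right)
    then have "y - z = 0" using inj by (meson injD)
    then show ?thesis using z(1) by simp
  qed
  then show ?thesis by blast
qed

text \<open>The lower bound makes the range complete, hence closed, and injectivity makes it
  dense.\<close>

lemma selfadjoint_bounded_below_invertible:
  fixes S :: "'x::{real_inner,banach} \<Rightarrow>\<^sub>L 'x"
  assumes S: "selfadjoint_op S" and c: "0 < c" "\<And>x. c * norm x \<le> norm (S x)"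
  shows "\<exists>R. R o\<^sub>L S = id_blinfun \<and> S o\<^sub>L R = id_blinfun"
proof -
  have inj: "inj S"
  proof (rule injI)
    fix x y assume "S x = S y"
    then have "c * norm (x - y) \<le> 0" using c(2)[of "x - y"] by (simp add: blinfun.diff_right)
    then show "x = y" using c(1) by (simp add: mult_le_0_iff)
  qed
  have "complete (S ` UNIV)"
    by (rule complete_isometric_image[OF c(1) subspace_UNIV blinfun.bounded_linear_right])
       (use c(2) complete_UNIV in auto)
  then have "range S = UNIV"
    using dense_range_selfadjoint[OF S inj] by (simp add: complete_imp_closed)
  then have SI: "S (inv S x) = x" for x by (simp add: surj_f_inv_f)
  have IS: "inv S (S x) = x" for x by (simp add: inj)
  have "bounded_linear (inv S)"
  proof (rule bounded_linear_intro[of _ "1 / c"])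
    show "inv S (a + b) = inv S a + inv S b" for a b
      by (rule injD[OF inj]) (simp add: SI blinfun.add_right)
    show "inv S (r *\<^sub>R a) = r *\<^sub>R inv S a" for r a
      by (rule injD[OF inj]) (simp add: SI blinfun.scaleR_right)
    show "norm (inv S a) \<le> norm a * (1 / c)" for a
      using c(2)[of "inv S a"] c(1) by (simp add: SI field_simps)
  qed
  then have "blinfun_apply (Blinfun (inv S)) = inv S" by (rule bounded_linear_Blinfun_apply)
  then have "Blinfun (inv S) o\<^sub>L S = id_blinfun \<and> S o\<^sub>L Blinfun (inv S) = id_blinfun"
    by (auto intro!: blinfun_eqI simp: SI IS)
  then show ?thesis by blast
qed

text \<open>The map sending \<open>J x\<close> to \<open>F x\<close> is well defined and bounded on
  the range of \<open>J\<close>. It serves twice: to define \<open>T\<close> for negative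
  \<open>s\<close> and, with a functional as \<open>F\<close>, to prove a range inclusion.\<close>

lemma extend_along_dense:
  fixes J :: "'x::real_normed_vector \<Rightarrow>\<^sub>L 'z::real_normed_vector" and F :: "'x \<Rightarrow>\<^sub>L 'y::banach"
  assumes dense: "closure (range J) = UNIV" and K: "\<And>x. norm (F x) \<le> K * norm (J x)"
  obtains T :: "'z \<Rightarrow>\<^sub>L 'y" where "\<And>x. T (J x) = F x"
proof -
  have ex: "\<exists>x. \<forall>n. norm (J (x n) - z) < 1 / real (Suc n)" for z
  proof -
    have "\<exists>u. norm (J u - z) < 1 / real (Suc n)" for n
      using dense closure_approachable[of z "range J"] by (auto simp: dist_norm elim!: allE[of _ "1 / real (Suc n)"])
    then show ?thesis by metis
  qed
  have conv: "convergent (\<lambda>n. F (x n))" if "(\<lambda>n. J (x n)) \<longlonglongrightarrow> z" for x z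
  proof -
    have "Cauchy (\<lambda>n. J (x n))" using that by (rule LIMSEQ_imp_Cauchy)
    then have CJ: "\<exists>M. \<forall>m\<ge>M. \<forall>n\<ge>M. norm (J (x m) - J (x n)) < e" if "e > 0" for e
      using that by (metis CauchyD)
    have "Cauchy (\<lambda>n. F (x n))"
    proof (rule CauchyI)
      fix e :: real assume "0 < e"
      then obtain N where N: "\<And>m n. m \<ge> N \<Longrightarrow> n \<ge> N \<Longrightarrow> norm (J (x m) - J (x n)) < e / (\<bar>K\<bar> + 1)"
        using CJ[of "e / (\<bar>K\<bar> + 1)"] by (auto simp: field_simps)
      have "norm (F (x m) - F (x n)) < e" if "m \<ge> N" "n \<ge> N" for m n
      proof -
        have "norm (F (x m) - F (x n)) \<le> K * norm (J (x m) - J (x n))"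
          using K[of "x m - x n"] by (simp add: blinfun.diff_right)
        also have "\<dots> \<le> (\<bar>K\<bar> + 1) * norm (J (x m) - J (x n))" by (intro mult_right_mono) auto
        also have "\<dots> < e" using N[OF that] by (simp add: field_simps)
        finally show ?thesis .
      qed
      then show "\<exists>M. \<forall>m\<ge>M. \<forall>n\<ge>M. norm (F (x m) - F (x n)) < e" by blast
    qed
    then show ?thesis by (simp add: Cauchy_convergent_iff)
  qed
  obtain X where X: "\<And>z n. norm (J (X z n) - z) < 1 / real (Suc n)" using ex by metis
  have Xlim: "(\<lambda>n. J (X z n)) \<longlonglongrightarrow> z" for z
  proof (rule LIMSEQ_I)
    fix e :: real assume "0 < e"
    then obtain N where N: "1 / Suc N < e" using nat_approx_posE by blast
    have "norm (J (X z n) - z) < e" if "n \<ge> N" for n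
    proof -
      have "1 / Suc n \<le> 1 / Suc N" using that by (auto simp: field_simps)
      then show ?thesis using X[of z n] N by linarith
    qed
    then show "\<exists>N. \<forall>n\<ge>N. norm (J (X z n) - z) < e" by blast
  qed
  define t where "t z = lim (\<lambda>n. F (X z n))" for z
  have tX: "(\<lambda>n. F (X z n)) \<longlonglongrightarrow> t z" for z
    unfolding t_def using conv[OF Xlim] convergent_LIMSEQ_iff by blast
  \<comment> \<open>The limit does not depend on the approximating sequence, so linearity may be
    tested on sums and multiples of the chosen sequences.\<close>
  have key: "(\<lambda>n. F (x n)) \<longlonglongrightarrow> t z" if x: "(\<lambda>n. J (x n)) \<longlonglongrightarrow> z" for x z
  proof -
    have "(\<lambda>n. F (x n) - F (X z n)) \<longlonglongrightarrow> 0"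
    proof (rule Lim_null_comparison)
      show "\<forall>\<^sub>F n in sequentially. norm (F (x n) - F (X z n)) \<le> K * norm (J (x n) - J (X z n))"
        using K by (auto simp flip: blinfun.diff_right)
      have "(\<lambda>n. K * norm (J (x n) - J (X z n))) \<longlonglongrightarrow> K * norm (z - z)"
        by (intro tendsto_intros x Xlim)
      then show "(\<lambda>n. K * norm (J (x n) - J (X z n))) \<longlonglongrightarrow> 0" by simp
    qed
    from tendsto_add[OF this tX[of z]] show ?thesis by simp
  qed
  have "bounded_linear t"
  proof (rule bounded_linear_intro[of _ K])
    fix a b
    have "(\<lambda>n. J (X a n + X b n)) \<longlonglongrightarrow> a + b"
      unfolding blinfun.add_right by (intro tendsto_intros Xlim)
    from key[OF this] have "(\<lambda>n. F (X a n) + F (X b n)) \<longlonglongrightarrow> t (a + b)" by (simp add: blinfun.add_right)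
    then show "t (a + b) = t a + t b"
      using tendsto_add[OF tX tX] LIMSEQ_unique by blast
  next
    fix r a
    have "(\<lambda>n. J (r *\<^sub>R X a n)) \<longlonglongrightarrow> r *\<^sub>R a"
      unfolding blinfun.scaleR_right by (intro tendsto_intros Xlim)
    from key[OF this] have "(\<lambda>n. r *\<^sub>R F (X a n)) \<longlonglongrightarrow> t (r *\<^sub>R a)" by (simp add: blinfun.scaleR_right)
    then show "t (r *\<^sub>R a) = r *\<^sub>R t a"
      using tendsto_scaleR[OF tendsto_const tX] LIMSEQ_unique by blast
  next
    fix a
    have "norm (t a) \<le> K * norm a"
    proof (rule LIMSEQ_le)
      show "(\<lambda>n. norm (F (X a n))) \<longlonglongrightarrow> norm (t a)" by (intro tendsto_intros tX)
      show "(\<lambda>n. K * norm (J (X a n))) \<longlonglongrightarrow> K * norm a" by (intro tendsto_intros Xlim)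
    qed (use K in auto)
    then show "norm (t a) \<le> norm a * K" by (simp add: mult.commute)
  qed
  then have app: "blinfun_apply (Blinfun t) = t" by (rule bounded_linear_Blinfun_apply)
  show ?thesis
  proof (rule that[of "Blinfun t"])
    fix x
    have "(\<lambda>n. F x) \<longlonglongrightarrow> t (J x)" by (rule key) simp
    then show "Blinfun t (J x) = F x" unfolding app using LIMSEQ_unique tendsto_const by blast
  qed
qed

text \<open>A special case of Douglas' range inclusion theorem.\<close>

lemma in_range_selfadjoint:
  fixes R :: "'x::{real_inner,banach} \<Rightarrow>\<^sub>L 'x"
  assumes R: "selfadjoint_op R" "inj R" and W: "0 \<le> W" "\<And>x. \<bar>e \<bullet> x\<bar> \<le> W * norm (R x)"
  obtains w where "e = R w" "norm w \<le> W"
proof -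
  have dense: "closure (range R) = UNIV" using R by (rule dense_range_selfadjoint)
  have app: "blinfun_apply (Blinfun (\<lambda>x. e \<bullet> x)) = (\<lambda>x. e \<bullet> x)"
    by (rule bounded_linear_Blinfun_apply[OF bounded_linear_inner_right])
  obtain f :: "'x \<Rightarrow>\<^sub>L real" where f: "\<And>x. f (R x) = e \<bullet> x"
    using extend_along_dense[OF dense, of "Blinfun (\<lambda>x. e \<bullet> x)" W] W(2) by (auto simp: app)
  obtain w where w: "\<And>x. f x = x \<bullet> w"
    using Riesz_representation[OF blinfun.bounded_linear_right] by metis
  have eRw: "e = R w"
    by (rule vector_eq_rdot[THEN iffD1])
       (metis R(1) f inner_commute selfadjoint_op_def w)
  have le: "\<bar>z \<bullet> w\<bar> \<le> W * norm z" for z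
  proof -
    obtain u where "\<forall>n. u n \<in> range R" and u: "u \<longlonglongrightarrow> z"
      using dense closure_sequential by (metis UNIV_I)
    then have "\<bar>u n \<bullet> w\<bar> \<le> W * norm (u n)" for n using W(2) f w by (metis imageE)
    then show ?thesis
      by (intro LIMSEQ_le[of "\<lambda>n. \<bar>u n \<bullet> w\<bar>" _ "\<lambda>n. W * norm (u n)"] tendsto_intros u) auto
  qed
  have "norm w * norm w \<le> W * norm w" using le[of w] by (simp flip: power2_norm_eq_inner power2_eq_square)
  then have "norm w \<le> W" using W(1) by (cases "norm w = 0") auto
  then show ?thesis using eRw that by blast
qed

section \<open>Quadratic forms and the spectrum\<close>

lemma selfadjoint_op_scaleR: "selfadjoint_op F \<Longrightarrow> selfadjoint_op (r *\<^sub>R F)"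
  by (simp add: selfadjoint_op_def blinfun.scaleR_left)

lemma selfadjoint_op_diff: "selfadjoint_op F \<Longrightarrow> selfadjoint_op F' \<Longrightarrow> selfadjoint_op (F - F')"
  by (simp add: selfadjoint_op_def blinfun.diff_left inner_diff_left inner_diff_right)

lemma selfadjoint_op_id: "selfadjoint_op id_blinfun"
  by (simp add: selfadjoint_op_def)

lemma norm_le_form:
  fixes F :: "'x::real_inner \<Rightarrow>\<^sub>L 'x"
  assumes F: "selfadjoint_op F" and pos: "\<And>x. 0 \<le> F x \<bullet> x"
  shows "(norm (F x))\<^sup>2 \<le> (norm F + 1) * (F x \<bullet> x)"
proof -
  define K where "K = norm F + 1"
  have K: "0 < K" by (simp add: K_def add_nonneg_pos)
  define t where "t = 1 / K"
  have sa: "F (F x) \<bullet> x = F x \<bullet> F x" using F by (simp add: selfadjoint_op_def)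
  have "F (F x) \<bullet> F x \<le> norm (F (F x)) * norm (F x)" by (rule norm_cauchy_schwarz)
  also have "\<dots> \<le> (norm F * norm (F x)) * norm (F x)" by (intro mult_right_mono norm_blinfun) auto
  also have "\<dots> \<le> K * (norm (F x))\<^sup>2"
    by (auto simp: K_def power2_eq_square mult.assoc intro!: mult_right_mono)
  finally have le: "F (F x) \<bullet> F x \<le> K * (norm (F x))\<^sup>2" .
  have "0 \<le> F (x - t *\<^sub>R F x) \<bullet> (x - t *\<^sub>R F x)" by (rule pos)
  also have "\<dots> = F x \<bullet> x - 2 * t * (norm (F x))\<^sup>2 + t * t * (F (F x) \<bullet> F x)"
    by (simp add: blinfun.diff_right blinfun.scaleR_right inner_diff_left inner_diff_right sa
        power2_norm_eq_inner algebra_simps)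
  also have "\<dots> \<le> F x \<bullet> x - 2 * t * (norm (F x))\<^sup>2 + t * t * (K * (norm (F x))\<^sup>2)"
    using le by (intro add_left_mono mult_left_mono) auto
  also have "\<dots> = F x \<bullet> x - (norm (F x))\<^sup>2 / K"
    using K by (simp add: t_def field_simps)
  finally have "(norm (F x))\<^sup>2 \<le> K * (F x \<bullet> x)" using K by (simp add: field_simps)
  then show ?thesis by (simp only: K_def)
qed

text \<open>\<open>\<mu>\<close> is the infimum of the Rayleigh quotient. If
  \<open>F - \<mu>\<close> were bounded below by \<open>c\<close>, the preceding inequality would
  lift the quotient to at least \<open>\<mu> + c^2 / K\<close>. So the edge is an approximate
  eigenvalue.\<close>

lemma form_lower_edge:
  fixes F :: "'x::real_inner \<Rightarrow>\<^sub>L 'x"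
  assumes F: "selfadjoint_op F" and nontriv: "\<exists>x::'x. x \<noteq> 0"
  obtains \<mu> where "\<And>x. \<mu> * (norm x)\<^sup>2 \<le> F x \<bullet> x"
    "\<And>c. 0 < c \<Longrightarrow> \<exists>x. norm ((F - \<mu> *\<^sub>R id_blinfun) x) < c * norm x"
proof -
  define V where "V = (\<lambda>x. (F x \<bullet> x) / (norm x)\<^sup>2) ` (- {0})"
  define \<mu> where "\<mu> = Inf V"
  have ne: "V \<noteq> {}" using nontriv by (auto simp: V_def)
  have "- norm F \<le> (F x \<bullet> x) / (norm x)\<^sup>2" if "x \<noteq> 0" for x
  proof -
    have "\<bar>F x \<bullet> x\<bar> \<le> norm (F x) * norm x" by (rule Cauchy_Schwarz_ineq2)
    also have "\<dots> \<le> (norm F * norm x) * norm x" by (intro mult_right_mono norm_blinfun) auto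
    finally have "- norm F * (norm x)\<^sup>2 \<le> F x \<bullet> x" by (simp add: power2_eq_square)
    then show ?thesis using that by (simp add: field_simps)
  qed
  then have bdd: "bdd_below V" by (intro bdd_belowI[of _ "- norm F"]) (auto simp: V_def)
  have lower: "\<mu> * (norm x)\<^sup>2 \<le> F x \<bullet> x" for x
  proof (cases "x = 0")
    case False
    then have "\<mu> \<le> (F x \<bullet> x) / (norm x)\<^sup>2"
      unfolding \<mu>_def by (intro cInf_lower[OF _ bdd]) (auto simp: V_def)
    then show ?thesis using False by (simp add: field_simps)
  qed simp
  let ?H = "F - \<mu> *\<^sub>R id_blinfun"
  have H: "selfadjoint_op ?H"
    by (intro selfadjoint_op_diff selfadjoint_op_scaleR selfadjoint_op_id F)
  have Hx: "?H x \<bullet> x = F x \<bullet> x - \<mu> * (norm x)\<^sup>2" for x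
    by (simp add: blinfun.diff_left blinfun.scaleR_left inner_diff_left power2_norm_eq_inner)
  have pos: "0 \<le> ?H x \<bullet> x" for x using lower[of x] by (simp add: Hx)
  have "\<exists>x. norm (?H x) < c * norm x" if c: "0 < c" for c
  proof (rule ccontr)
    assume "\<not> ?thesis"
    then have bb: "c * norm x \<le> norm (?H x)" for x by (meson not_less)
    define K where "K = norm ?H + 1"
    have K: "0 < K" by (simp add: K_def add_nonneg_pos)
    have "(c * norm x)\<^sup>2 \<le> K * (F x \<bullet> x - \<mu> * (norm x)\<^sup>2)" for x
    proof -
      have "(c * norm x)\<^sup>2 \<le> (norm (?H x))\<^sup>2" using bb c by (intro power_mono) auto
      also have "\<dots> \<le> K * (?H x \<bullet> x)" unfolding K_def by (rule norm_le_form[OF H pos])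
      finally show ?thesis by (simp add: Hx)
    qed
    then have form: "(\<mu> + c\<^sup>2 / K) * (norm x)\<^sup>2 \<le> F x \<bullet> x" for x
      using K by (simp add: field_simps power_mult_distrib)
    have le: "\<mu> + c\<^sup>2 / K \<le> v" if "v \<in> V" for v
    proof -
      from that obtain x where "x \<noteq> 0" "v = (F x \<bullet> x) / (norm x)\<^sup>2" by (auto simp: V_def)
      then show ?thesis using form[of x] by (simp add: pos_le_divide_eq)
    qed
    have "\<mu> + c\<^sup>2 / K \<le> \<mu>" unfolding \<mu>_def using ne le[unfolded \<mu>_def] by (rule cInf_greatest)
    then show False using K c by (simp add: divide_le_0_iff)
  qed
  then show ?thesis using that lower by blast
qed

lemma not_in_spectrum_bounded_below:
  fixes S :: "'x::real_normed_vector \<Rightarrow>\<^sub>L 'x"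
  assumes "l \<notin> spectrum S"
  obtains c where "0 < c" "\<And>x. c * norm x \<le> norm ((S - l *\<^sub>R id_blinfun) x)"
proof -
  obtain R where "R o\<^sub>L (S - l *\<^sub>R id_blinfun) = id_blinfun"
    using assms by (auto simp: spectrum_def)
  then have R: "R ((S - l *\<^sub>R id_blinfun) x) = x" for x
    by (metis blinfun_apply_blinfun_compose blinfun_apply_id_blinfun id_apply)
  have "norm x \<le> (norm R + 1) * norm ((S - l *\<^sub>R id_blinfun) x)" for x
  proof -
    have "norm x = norm (R ((S - l *\<^sub>R id_blinfun) x))" by (simp only: R)
    also have "\<dots> \<le> norm R * norm ((S - l *\<^sub>R id_blinfun) x)" by (rule norm_blinfun)
    also have "\<dots> \<le> (norm R + 1) * norm ((S - l *\<^sub>R id_blinfun) x)" by (intro mult_right_mono) auto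
    finally show ?thesis .
  qed
  moreover have "0 < norm R + 1" by (simp add: add_nonneg_pos)
  ultimately show ?thesis
    by (intro that[of "1 / (norm R + 1)"]) (simp_all add: pos_divide_le_eq mult.commute)
qed

text \<open>With \<open>c\<close> the amount by which \<open>l\<close> misses the interval, the form
  of \<open>S - l\<close> has modulus at least \<open>c * (norm x)^2\<close>, so
  \<open>S - l\<close> is bounded below and therefore invertible.\<close>

lemma spectrum_interval:
  fixes S :: "'x::{real_inner,banach} \<Rightarrow>\<^sub>L 'x"
  assumes S: "selfadjoint_op S"
    and lo: "\<And>x. lo * (norm x)\<^sup>2 \<le> S x \<bullet> x" and hi: "\<And>x. S x \<bullet> x \<le> hi * (norm x)\<^sup>2"
  shows "spectrum S \<subseteq> {lo..hi}"
proof (rule subsetI, rule ccontr)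
  fix l assume l: "l \<in> spectrum S" "l \<notin> {lo..hi}"
  define c where "c = (if l < lo then lo - l else l - hi)"
  have c: "0 < c" using l(2) by (auto simp: c_def)
  let ?H = "S - l *\<^sub>R id_blinfun"
  have H: "selfadjoint_op ?H"
    by (intro selfadjoint_op_diff selfadjoint_op_scaleR selfadjoint_op_id S)
  have "c * norm x \<le> norm (?H x)" for x
  proof -
    have "?H x \<bullet> x = S x \<bullet> x - l * (norm x)\<^sup>2"
      by (simp add: blinfun.diff_left blinfun.scaleR_left inner_diff_left power2_norm_eq_inner)
    then have "c * (norm x)\<^sup>2 \<le> \<bar>?H x \<bullet> x\<bar>"
      using lo[of x] hi[of x] l(2) by (auto simp: c_def algebra_simps)
    also have "\<dots> \<le> norm (?H x) * norm x" by (rule Cauchy_Schwarz_ineq2)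
    finally have "(c * norm x) * norm x \<le> norm (?H x) * norm x" by (simp add: power2_eq_square mult_ac)
    then show ?thesis by (cases "norm x = 0") (auto simp: mult_le_cancel_right)
  qed
  then have "l \<notin> spectrum S"
    using selfadjoint_bounded_below_invertible[OF H c] by (auto simp: spectrum_def)
  then show False using l by blast
qed

section \<open>Polynomials of an operator\<close>

lemma poly_op_0 [simp]: "poly_op 0 S = 0"
  by (simp add: poly_op_def)

lemma poly_op_eq_sum:
  assumes "degree P \<le> n"
  shows "poly_op P S = (\<Sum>i\<le>n. coeff P i *\<^sub>R (((o\<^sub>L) S) ^^ i) id_blinfun)"
  unfolding poly_op_def
  by (rule sum.mono_neutral_left) (use assms in \<open>auto simp: coeff_eq_0\<close>)

text \<open>Horner's scheme; it lets the algebraic rules be proved by induction on the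
  coefficients.\<close>

lemma poly_op_pCons: "poly_op (pCons a P) S = a *\<^sub>R id_blinfun + (S o\<^sub>L poly_op P S)"
proof -
  have "poly_op (pCons a P) S
      = (\<Sum>i\<le>Suc (degree P). coeff (pCons a P) i *\<^sub>R (((o\<^sub>L) S) ^^ i) id_blinfun)"
    by (rule poly_op_eq_sum) (rule degree_pCons_le)
  also have "\<dots> = a *\<^sub>R id_blinfun + (\<Sum>i\<le>degree P. coeff P i *\<^sub>R (S o\<^sub>L (((o\<^sub>L) S) ^^ i) id_blinfun))"
    by (simp add: sum.atMost_Suc_shift del: sum.atMost_Suc)
  also have "(\<Sum>i\<le>degree P. coeff P i *\<^sub>R (S o\<^sub>L (((o\<^sub>L) S) ^^ i) id_blinfun)) = S o\<^sub>L poly_op P S"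
    by (rule blinfun_eqI)
       (simp add: poly_op_def blinfun.sum_left blinfun.sum_right blinfun.scaleR_left blinfun.scaleR_right)
  finally show ?thesis .
qed

lemma poly_op_add: "poly_op (P + Q) S = poly_op P S + poly_op Q S"
proof (induction P Q rule: poly_induct2)
  case (pCons a p b q)
  then show ?case
    by (intro blinfun_eqI)
       (simp add: poly_op_pCons blinfun.add_left blinfun.add_right blinfun.scaleR_left algebra_simps)
qed simp

lemma poly_op_smult: "poly_op (smult c P) S = c *\<^sub>R poly_op P S"
proof (induction P)
  case (pCons a P)
  then show ?case
    by (intro blinfun_eqI)
       (simp add: poly_op_pCons blinfun.add_left blinfun.scaleR_left blinfun.scaleR_right algebra_simps)
qed simp

lemma poly_op_diff: "poly_op (P - Q) S = poly_op P S - poly_op Q S"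
proof -
  have "P - Q = P + smult (- 1) Q" by simp
  then show ?thesis by (simp only: poly_op_add poly_op_smult) simp
qed

lemma poly_op_mult: "poly_op (P * Q) S = poly_op P S o\<^sub>L poly_op Q S"
proof (induction P)
  case (pCons a P)
  then show ?case
    by (intro blinfun_eqI)
       (simp add: poly_op_pCons poly_op_add poly_op_smult blinfun.add_left blinfun.scaleR_left)
qed (auto intro: blinfun_eqI)

lemma poly_op_const: "poly_op [:a:] S = a *\<^sub>R id_blinfun"
  by (auto simp: poly_op_pCons intro: blinfun_eqI)

lemma poly_op_X: "poly_op [:0, 1:] S = S"
  by (auto simp: poly_op_pCons intro!: blinfun_eqI)

lemma poly_op_linear: "poly_op [:- l, 1:] S = S - l *\<^sub>R id_blinfun"
  by (auto simp: poly_op_pCons blinfun.add_left blinfun.diff_left blinfun.scaleR_left blinfun.minus_left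
      blinfun.scaleR_right intro!: blinfun_eqI)

lemma poly_op_commute: "S (poly_op P S x) = poly_op P S (S x)"
proof -
  have "S o\<^sub>L poly_op P S = poly_op P S o\<^sub>L S"
    using poly_op_mult[of "[:0, 1:]" P S] poly_op_mult[of P "[:0, 1:]" S]
    by (simp only: poly_op_X mult.commute)
  then show ?thesis by (metis blinfun_apply_blinfun_compose)
qed

lemma selfadjoint_poly_op: "selfadjoint_op S \<Longrightarrow> selfadjoint_op (poly_op P S)"
proof (induction P)
  case (pCons a P)
  then show ?case
    by (auto simp: poly_op_pCons selfadjoint_op_def blinfun.add_left blinfun.scaleR_left
        inner_add_left inner_add_right poly_op_commute)
qed (simp add: selfadjoint_op_def)

section \<open>The spectral bound\<close>

text \<open>The polynomial is \<open>(X - a)^2 + b^2\<close>, and self-adjointness makes the form of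
  the square nonnegative. This handles the factors with a pair of non-real roots.\<close>

lemma poly_op_real_quadratic:
  fixes S :: "'x::{real_inner,banach} \<Rightarrow>\<^sub>L 'x"
  assumes S: "selfadjoint_op S"
  shows "b\<^sup>2 * norm x \<le> norm (poly_op [:a\<^sup>2 + b\<^sup>2, - (2 * a), 1:] S x)"
proof -
  let ?L = "S - a *\<^sub>R id_blinfun"
  have L: "selfadjoint_op ?L"
    by (intro selfadjoint_op_diff selfadjoint_op_scaleR selfadjoint_op_id S)
  have "[:a\<^sup>2 + b\<^sup>2, - (2 * a), 1:] = [:- a, 1:] * [:- a, 1:] + [:b\<^sup>2:]"
    by (simp add: power2_eq_square)
  then have eq: "poly_op [:a\<^sup>2 + b\<^sup>2, - (2 * a), 1:] S x = ?L (?L x) + b\<^sup>2 *\<^sub>R x"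
    by (simp only: poly_op_add poly_op_mult poly_op_linear poly_op_const)
       (simp add: blinfun.add_left blinfun.scaleR_left)
  have "b\<^sup>2 * (norm x)\<^sup>2 \<le> norm (?L x) ^ 2 + b\<^sup>2 * (norm x)\<^sup>2" by simp
  also have "\<dots> = (?L (?L x) + b\<^sup>2 *\<^sub>R x) \<bullet> x"
    using L by (simp add: selfadjoint_op_def inner_add_left power2_norm_eq_inner)
  also have "\<dots> \<le> norm (?L (?L x) + b\<^sup>2 *\<^sub>R x) * norm x" by (rule norm_cauchy_schwarz)
  finally have "(b\<^sup>2 * norm x) * norm x \<le> norm (?L (?L x) + b\<^sup>2 *\<^sub>R x) * norm x"
    by (simp add: power2_eq_square mult_ac)
  then show ?thesis unfolding eq by (cases "norm x = 0") (auto simp: mult_le_cancel_right)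
qed

lemma real_poly_factor:
  fixes P :: "real poly"
  assumes "degree P \<noteq> 0"
  obtains (real_root) r Q where "P = [:- r, 1:] * Q" "degree Q < degree P"
  | (complex_pair) a b Q where "b \<noteq> 0" "P = [:a\<^sup>2 + b\<^sup>2, - (2 * a), 1:] * Q" "degree Q < degree P"
proof -
  have P0: "P \<noteq> 0" using assms by auto
  define ev where "ev P = poly (map_poly complex_of_real P)" for P
  have ev_pCons: "ev (pCons a p) z = of_real a + z * ev p z" for a p z
    by (simp add: ev_def map_poly_pCons)
  have ev_0: "ev 0 z = 0" for z by (simp add: ev_def)
  have ev_add: "ev (p + q) z = ev p z + ev q z" for p q z
    by (induction p q rule: poly_induct2) (auto simp: ev_pCons ev_0 algebra_simps)
  have ev_smult: "ev (smult c p) z = of_real c * ev p z" for c p z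
    by (induction p) (auto simp: ev_pCons ev_0 algebra_simps)
  have ev_mult: "ev (p * q) z = ev p z * ev q z" for p q z
    by (induction p) (auto simp: ev_pCons ev_0 ev_add ev_smult algebra_simps)
  have ev_real: "ev p (of_real x) = of_real (poly p x)" for p x
    by (induction p) (auto simp: ev_pCons ev_0)
  have "degree (map_poly complex_of_real P) \<noteq> 0" using assms by (simp add: degree_map_poly)
  then have "\<not> constant (ev P)" unfolding ev_def by (simp add: constant_degree)
  then obtain z where z: "ev P z = 0" using fundamental_theorem_of_algebra ev_def by metis
  show thesis
  proof (cases "Im z = 0")
    case True
    then have "z = of_real (Re z)" by (simp add: complex_eq_iff)
    then have "poly P (Re z) = 0" using z ev_real[of P "Re z"] by simp
    then obtain Q where Q: "P = [:- Re z, 1:] * Q" by (metis poly_eq_0_iff_dvd dvd_def)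
    then have "Q \<noteq> 0" using P0 by auto
    then have "degree ([:- Re z, 1:] * Q) = Suc (degree Q)" by (subst degree_mult_eq) auto
    then have "degree Q < degree P" using Q by (metis lessI)
    then show ?thesis using real_root Q by blast
  next
    case False
    define a b where "a = Re z" and "b = Im z"
    have b: "b \<noteq> 0" using False by (simp add: b_def)
    define q where "q = [:a\<^sup>2 + b\<^sup>2, - (2 * a), 1:]"
    have q: "q \<noteq> 0" "degree q = 2" by (simp_all add: q_def)
    define D R where "D = P div q" and "R = P mod q"
    have PD: "P = q * D + R" by (simp add: D_def R_def)
    have "degree R < 2" using degree_mod_less'[OF q(1), of P] q(2) R_def by (cases "R = 0") auto
    obtain u R' where R': "R = pCons u R'" by (rule pCons_cases)
    obtain v R'' where R'': "R' = pCons v R''" by (rule pCons_cases)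
    have "R'' = 0" using \<open>degree R < 2\<close> by (auto simp: R' R'' split: if_splits)
    then have R: "R = [:u, v:]" by (simp add: R' R'')
    have "ev q z = 0"
      by (simp add: q_def ev_pCons ev_0 a_def b_def complex_eq_iff power2_eq_square algebra_simps)
    then have "ev R z = 0" using z PD ev_add ev_mult by (metis add_0 mult_zero_left)
    then have "v = 0" "u = 0" using b by (auto simp: R ev_pCons ev_0 complex_eq_iff b_def)
    then have Pq: "P = q * D" using PD R by simp
    have "D \<noteq> 0" using Pq P0 by auto
    then have "degree (q * D) = 2 + degree D" using q degree_mult_eq[of q D] by simp
    then have "degree D < degree P" using Pq by (metis less_add_same_cancel2 zero_less_numeral)
    then show ?thesis using complex_pair[OF b, of a D] Pq q_def by metis
  qed
qed

text \<open>One half of the spectral mapping theorem: \<open>P(S)\<close> is a product of linear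
  factors, bounded below because their roots avoid the spectrum, and of quadratic factors without
  real roots.\<close>

lemma poly_op_bounded_below:
  fixes S :: "'x::{real_inner,banach} \<Rightarrow>\<^sub>L 'x"
  assumes S: "selfadjoint_op S" and "P \<noteq> 0" "\<And>l. poly P l = 0 \<Longrightarrow> l \<notin> spectrum S"
  shows "\<exists>c>0. \<forall>x. c * norm x \<le> norm (poly_op P S x)"
  using assms(2,3)
proof (induction "degree P" arbitrary: P rule: less_induct)
  case less
  show ?case
  proof (cases "degree P = 0")
    case True
    then obtain a where a: "P = [:a:]" "a \<noteq> 0" using less.prems(1) degree_eq_zeroE by (metis pCons_0_0)
    then show ?thesis
      by (intro exI[of _ "\<bar>a\<bar>"]) (auto simp: poly_op_const blinfun.scaleR_left)
  next
    case False
    have comp: ?thesis if P: "P = L * Q" "degree Q < degree P" and d: "0 < d"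
      "\<And>x. d * norm x \<le> norm (poly_op L S x)" for L Q d
    proof -
      have "Q \<noteq> 0" "\<And>l. poly Q l = 0 \<Longrightarrow> l \<notin> spectrum S" using less.prems P(1) by auto
      from less.hyps[OF P(2) this] obtain c where c: "0 < c" "\<And>x. c * norm x \<le> norm (poly_op Q S x)"
        by blast
      have "d * c * norm x \<le> norm (poly_op P S x)" for x
      proof -
        have "d * c * norm x \<le> d * norm (poly_op Q S x)" using c(2)[of x] d(1) by simp
        also have "\<dots> \<le> norm (poly_op P S x)" using d(2) by (simp add: P(1) poly_op_mult)
        finally show ?thesis .
      qed
      then show ?thesis using mult_pos_pos[OF d(1) c(1)] by blast
    qed
    from False show ?thesis
    proof (cases rule: real_poly_factor)
      case (real_root r Q)
      then have "r \<notin> spectrum S" using less.prems(2)[of r] by simp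
      then obtain d where "0 < d" "\<And>x. d * norm x \<le> norm ((S - r *\<^sub>R id_blinfun) x)"
        by (metis not_in_spectrum_bounded_below)
      then show ?thesis using comp[OF real_root, of d] by (simp add: poly_op_linear)
    next
      case (complex_pair a b Q)
      then show ?thesis using comp[OF complex_pair(2,3), of "b\<^sup>2"] poly_op_real_quadratic[OF S] by simp
    qed
  qed
qed

text \<open>At the lower edge \<open>\<mu>\<close> of the form of \<open>P(S)\<close> the operator
  \<open>P(S) - \<mu>\<close> is not bounded below. Hence \<open>P - \<mu>\<close> has a root
  \<open>l\<close> in the spectrum, and \<open>\<mu> = P(l) \<ge> b\<close>.\<close>

lemma poly_op_form_ge:
  fixes S :: "'x::{real_inner,banach} \<Rightarrow>\<^sub>L 'x"
  assumes S: "selfadjoint_op S" and P: "\<And>l. l \<in> spectrum S \<Longrightarrow> b \<le> poly P l"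
  shows "b * (norm x)\<^sup>2 \<le> poly_op P S x \<bullet> x"
proof (cases "\<exists>x::'x. x \<noteq> 0")
  case nontriv: True
  have edge: "\<exists>l\<in>spectrum S. (\<forall>x. poly Q l * (norm x)\<^sup>2 \<le> poly_op Q S x \<bullet> x)"
    if Q: "degree Q \<noteq> 0" for Q
  proof -
    obtain \<mu> where \<mu>: "\<And>x. \<mu> * (norm x)\<^sup>2 \<le> poly_op Q S x \<bullet> x"
      and below: "\<And>c. 0 < c \<Longrightarrow> \<exists>x. norm ((poly_op Q S - \<mu> *\<^sub>R id_blinfun) x) < c * norm x"
      using form_lower_edge[OF selfadjoint_poly_op[OF S] nontriv] by blast
    have "Q - [:\<mu>:] \<noteq> 0" using Q by auto
    moreover have "\<not> (\<exists>c>0. \<forall>x. c * norm x \<le> norm (poly_op (Q - [:\<mu>:]) S x))"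
      using below by (auto simp: poly_op_diff poly_op_const not_le)
    ultimately obtain l where "poly (Q - [:\<mu>:]) l = 0" "l \<in> spectrum S"
      using poly_op_bounded_below[OF S] by blast
    then show ?thesis using \<mu> by auto
  qed
  show ?thesis
  proof (cases "degree P = 0")
    case False
    then obtain l where "l \<in> spectrum S" "poly P l * (norm x)\<^sup>2 \<le> poly_op P S x \<bullet> x"
      using edge by blast
    then show ?thesis using P[of l] by (meson mult_right_mono order_trans zero_le_power2)
  next
    case True
    then obtain a where a: "P = [:a:]" using degree_eq_zeroE by blast
    \<comment> \<open>For constant \<open>P\<close> the difference \<open>P - \<mu>\<close> may
      vanish identically. What is missing is a point of the spectrum at which to read off the
      constant; the edge of \<open>S\<close> itself provides one.\<close>
    obtain l where "l \<in> spectrum S" using edge[of "[:0, 1:]"] by auto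
    then have "b \<le> a" using P[of l] a by simp
    then show ?thesis
      by (simp add: a poly_op_const blinfun.scaleR_left power2_norm_eq_inner mult_right_mono)
  qed
next
  case False
  then have "x = 0" by blast
  then show ?thesis by simp
qed

text \<open>How the point 0 is left out: \<open>X P X\<close> vanishes there and has the sign of
  \<open>P\<close> elsewhere, so the form of \<open>P(S)\<close> is nonnegative on the range of
  \<open>S\<close>, which is dense.\<close>

lemma poly_op_form_nonneg:
  fixes S :: "'x::{real_inner,banach} \<Rightarrow>\<^sub>L 'x"
  assumes S: "selfadjoint_op S" "inj S" and P: "\<And>l. l \<in> spectrum S - {0} \<Longrightarrow> 0 \<le> poly P l"
  shows "0 \<le> poly_op P S x \<bullet> x"
proof -
  have range: "0 \<le> poly_op P S (S u) \<bullet> S u" for u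
  proof -
    have "0 * (norm u)\<^sup>2 \<le> poly_op ([:0, 1:] * P * [:0, 1:]) S u \<bullet> u"
    proof (rule poly_op_form_ge[OF S(1)])
      fix l assume "l \<in> spectrum S"
      then have "0 \<le> l * l * poly P l" using P by (cases "l = 0") auto
      then show "0 \<le> poly ([:0, 1:] * P * [:0, 1:]) l" by (simp add: mult_ac)
    qed
    then have "0 \<le> S (poly_op P S (S u)) \<bullet> u"
      by (simp only: poly_op_mult poly_op_X blinfun_apply_blinfun_compose mult_zero_left)
    then show ?thesis using S(1) by (simp add: selfadjoint_op_def)
  qed
  obtain z where z: "\<forall>n. z n \<in> range S" "z \<longlonglongrightarrow> x"
    using dense_range_selfadjoint[OF S] closure_sequential by (metis UNIV_I)
  have "(\<lambda>n. poly_op P S (z n) \<bullet> z n) \<longlonglongrightarrow> poly_op P S x \<bullet> x"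
    by (intro tendsto_intros z(2))
  moreover have "0 \<le> poly_op P S (z n) \<bullet> z n" for n
    using z(1) range by (metis imageE)
  ultimately show ?thesis by (intro LIMSEQ_le_const[where a = 0]) auto
qed

text \<open>Positivity is applied to \<open>b^2 - P^2\<close>.\<close>

lemma poly_op_norm_le:
  fixes S :: "'x::{real_inner,banach} \<Rightarrow>\<^sub>L 'x"
  assumes S: "selfadjoint_op S" "inj S" and P: "\<And>l. l \<in> spectrum S - {0} \<Longrightarrow> \<bar>poly P l\<bar> \<le> b" and b: "0 \<le> b"
  shows "norm (poly_op P S) \<le> b"
proof (rule norm_blinfun_bound[OF b])
  fix x
  have "0 \<le> poly_op ([:b\<^sup>2:] - P * P) S x \<bullet> x"
  proof (rule poly_op_form_nonneg[OF S])
    fix l assume "l \<in> spectrum S - {0}"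
    then have "\<bar>poly P l\<bar>\<^sup>2 \<le> b\<^sup>2" using P by (intro power_mono) auto
    then show "0 \<le> poly ([:b\<^sup>2:] - P * P) l" by (simp add: power2_eq_square)
  qed
  then have "poly_op P S (poly_op P S x) \<bullet> x \<le> b\<^sup>2 * (x \<bullet> x)"
    by (simp add: poly_op_diff poly_op_mult poly_op_const blinfun.diff_left blinfun.scaleR_left inner_diff_left)
  then have "(norm (poly_op P S x))\<^sup>2 \<le> (b * norm x)\<^sup>2"
    using selfadjoint_poly_op[OF S(1), of P]
    by (simp add: selfadjoint_op_def power2_norm_eq_inner power_mult_distrib)
  then show "norm (poly_op P S x) \<le> b * norm x" by (rule power2_le_imp_le) (use b in auto)
qed

section \<open>Functions on \<open>(0,c]\<close> extending continuously to \<open>0\<close>\<close>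

definition extends_continuously :: "real \<Rightarrow> (real \<Rightarrow> real) \<Rightarrow> bool" where
  "extends_continuously c f \<longleftrightarrow> (\<exists>F. continuous_on {0..c} F \<and> (\<forall>t\<in>{0<..c}. f t = F t))"

lemma extends_continuouslyI:
  "continuous_on {0..c} F \<Longrightarrow> (\<And>t. 0 < t \<Longrightarrow> t \<le> c \<Longrightarrow> f t = F t) \<Longrightarrow> extends_continuously c f"
  by (auto simp: extends_continuously_def)

lemma extends_continuously_cong:
  assumes "extends_continuously c f" "\<And>t. 0 < t \<Longrightarrow> t \<le> c \<Longrightarrow> g t = f t"
  shows "extends_continuously c g"
  using assms by (auto simp: extends_continuously_def)

lemma extends_continuously_const: "extends_continuously c (\<lambda>t. r)"
  by (rule extends_continuouslyI[of _ "\<lambda>t. r"]) auto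

lemma extends_continuously_id: "extends_continuously c (\<lambda>t. t)"
  by (rule extends_continuouslyI[of _ "\<lambda>t. t"]) auto

lemma extends_continuously_add:
  assumes "extends_continuously c f" "extends_continuously c g"
  shows "extends_continuously c (\<lambda>t. f t + g t)"
proof -
  from assms obtain F G where "continuous_on {0..c} F" "continuous_on {0..c} G"
    "\<forall>t\<in>{0<..c}. f t = F t" "\<forall>t\<in>{0<..c}. g t = G t"
    by (auto simp: extends_continuously_def)
  then show ?thesis by (intro extends_continuouslyI[of _ "\<lambda>t. F t + G t"] continuous_intros) auto
qed

lemma extends_continuously_mult:
  assumes "extends_continuously c f" "extends_continuously c g"
  shows "extends_continuously c (\<lambda>t. f t * g t)"
proof -
  from assms obtain F G where "continuous_on {0..c} F" "continuous_on {0..c} G"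
    "\<forall>t\<in>{0<..c}. f t = F t" "\<forall>t\<in>{0<..c}. g t = G t"
    by (auto simp: extends_continuously_def)
  then show ?thesis by (intro extends_continuouslyI[of _ "\<lambda>t. F t * G t"] continuous_intros) auto
qed

lemma extends_continuously_cmult: "extends_continuously c f \<Longrightarrow> extends_continuously c (\<lambda>t. r * f t)"
  by (intro extends_continuously_mult extends_continuously_const)

lemma extends_continuously_diff:
  assumes "extends_continuously c f" "extends_continuously c g"
  shows "extends_continuously c (\<lambda>t. f t - g t)"
  using extends_continuously_add[OF assms(1) extends_continuously_cmult[OF assms(2), of "- 1"]] by simp

lemma extends_continuously_power:
  assumes "extends_continuously c f"
  shows "extends_continuously c (\<lambda>t. (f t)\<^sup>2)"
  using extends_continuously_mult[OF assms assms] by (simp add: power2_eq_square)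

text \<open>The value at 0 is a limit and may fall on the boundary. Composition and powers need the
  extension itself, not only the function on \<open>(0,c]\<close>, to stay in the domain of the
  outer function.\<close>

lemma extension_in_interval:
  fixes F :: "real \<Rightarrow> real"
  assumes F: "continuous_on {0..c} F" and c: "0 < c" and I: "\<And>t. t \<in> {0<..c} \<Longrightarrow> F t \<in> {a..b}"
  shows "t \<in> {0..c} \<Longrightarrow> F t \<in> {a..b}"
proof -
  have "closure {0<..c} = {0..c}" using c by (rule closure_greaterThanAtMost)
  moreover have "F ` closure {0<..c} \<subseteq> {a..b}"
    by (rule image_closure_subset) (use F I calculation in auto)
  ultimately show "t \<in> {0..c} \<Longrightarrow> F t \<in> {a..b}" by (metis image_subset_iff)
qed

lemma extends_continuously_compose:
  assumes f: "extends_continuously d f" and g: "extends_continuously c g" and c: "0 < c"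
    and gd: "\<And>t. 0 < t \<Longrightarrow> t \<le> c \<Longrightarrow> 0 < g t \<and> g t \<le> d"
  shows "extends_continuously c (\<lambda>t. f (g t))"
proof -
  from f obtain F where F: "continuous_on {0..d} F" "\<forall>t\<in>{0<..d}. f t = F t"
    by (auto simp: extends_continuously_def)
  from g obtain G where G: "continuous_on {0..c} G" "\<forall>t\<in>{0<..c}. g t = G t"
    by (auto simp: extends_continuously_def)
  have "G t \<in> {0..d}" if "t \<in> {0..c}" for t
  proof (rule extension_in_interval[OF G(1) c _ that])
    fix u assume "u \<in> {0<..c}"
    then show "G u \<in> {0..d}" using G(2) gd[of u] by auto
  qed
  then have "continuous_on {0..c} (\<lambda>t. F (G t))"
    by (intro continuous_on_compose2[OF F(1) G(1)]) auto
  then show ?thesis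
    by (rule extends_continuouslyI) (use F(2) G(2) gd in auto)
qed

lemma extends_continuously_powr:
  assumes f: "extends_continuously c f" and c: "0 < c" and r: "0 \<le> r"
    and pos: "\<And>t. 0 < t \<Longrightarrow> t \<le> c \<Longrightarrow> 0 < f t"
  shows "extends_continuously c (\<lambda>t. f t powr r)"
proof (cases "r = 0")
  case True
  \<comment> \<open>Since \<open>0 powr 0 = 0\<close>, the function \<open>F t powr 0\<close> would
    jump where \<open>F\<close> reaches 0; the constant 1 is the right extension.\<close>
  show ?thesis
    by (rule extends_continuously_cong[OF extends_continuously_const[of c 1]])
       (use pos True in \<open>auto simp: less_imp_neq[symmetric]\<close>)
next
  case False
  from f obtain F where F: "continuous_on {0..c} F" "\<forall>t\<in>{0<..c}. f t = F t"
    by (auto simp: extends_continuously_def)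
  obtain b where b: "\<And>t. t \<in> {0..c} \<Longrightarrow> F t \<le> b"
    using compact_continuous_image[OF F(1) compact_Icc] compact_imp_bounded bounded_imp_bdd_above
    by (metis bdd_above.E imageI)
  have "F t \<in> {0..b}" if "t \<in> {0..c}" for t
  proof (rule extension_in_interval[OF F(1) c _ that])
    fix u assume "u \<in> {0<..c}"
    then show "F u \<in> {0..b}" using F(2) pos[of u] b[of u] by auto
  qed
  then have "continuous_on {0..c} (\<lambda>t. F t powr r)"
    using False r F(1) by (intro continuous_on_powr' continuous_intros) auto
  then show ?thesis by (rule extends_continuouslyI) (use F(2) in auto)
qed

lemma extends_continuously_bounded:
  assumes "extends_continuously c f"
  obtains b where "0 \<le> b" "\<And>t. 0 < t \<Longrightarrow> t \<le> c \<Longrightarrow> \<bar>f t\<bar> \<le> b"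
proof -
  from assms obtain F where F: "continuous_on {0..c} F" "\<forall>t\<in>{0<..c}. f t = F t"
    by (auto simp: extends_continuously_def)
  have "bounded (F ` {0..c})"
    using compact_continuous_image[OF F(1) compact_Icc] by (rule compact_imp_bounded)
  then obtain b where "\<forall>x\<in>F ` {0..c}. norm x \<le> b" by (auto simp: bounded_iff)
  then have "\<bar>f t\<bar> \<le> \<bar>b\<bar>" if "0 < t" "t \<le> c" for t
    using that F(2) by (auto simp: abs_le_iff intro: order_trans[OF _ abs_ge_self])
  then show ?thesis by (intro that[of "\<bar>b\<bar>"]) auto
qed

lemma extends_continuously_poly_approx:
  assumes "extends_continuously c f"
  obtains P where "uniform_limit {0<..c} (\<lambda>k. poly (P k)) f sequentially"
proof -
  from assms obtain F where F: "continuous_on {0..c} F" "\<forall>t\<in>{0<..c}. f t = F t"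
    by (auto simp: extends_continuously_def)
  have "\<exists>p. \<forall>t\<in>{0..c}. \<bar>F t - poly p t\<bar> < 1 / real (Suc k)" for k
  proof -
    obtain g where g: "real_polynomial_function g" "\<And>x. x \<in> {0..c} \<Longrightarrow> \<bar>F x - g x\<bar> < 1 / real (Suc k)"
      using Stone_Weierstrass_real_polynomial_function[OF compact_Icc F(1), of "1 / real (Suc k)"] by auto
    from g(1) obtain a n where "g = (\<lambda>x. \<Sum>i\<le>n. a i * x ^ i)"
      by (auto simp: real_polynomial_function_iff_sum)
    then have "g x = poly (\<Sum>i\<le>n. monom (a i) i) x" for x by (simp add: poly_sum poly_monom)
    then show ?thesis using g(2) by metis
  qed
  then obtain P where P: "\<And>k t. t \<in> {0..c} \<Longrightarrow> \<bar>F t - poly (P k) t\<bar> < 1 / real (Suc k)" by metis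
  have "uniform_limit {0<..c} (\<lambda>k. poly (P k)) f sequentially"
    unfolding uniform_limit_sequentially_iff
  proof (intro allI impI)
    fix e :: real assume "0 < e"
    then obtain N where N: "1 / real (Suc N) < e" using nat_approx_posE by blast
    have "dist (poly (P n) x) (f x) < e" if "n \<ge> N" "x \<in> {0<..c}" for n x
    proof -
      have "1 / real (Suc n) \<le> 1 / real (Suc N)" using that(1) by (auto simp: field_simps)
      then show ?thesis using P[of x n] N F(2) that(2) by (auto simp: dist_real_def abs_minus_commute)
    qed
    then show "\<exists>N. \<forall>n\<ge>N. \<forall>x\<in>{0<..c}. dist (poly (P n) x) (f x) < e" by blast
  qed
  then show ?thesis by (rule that)
qed

lemma real_le_if_le_add_mult:
  fixes a b :: real
  assumes "\<And>e. 0 < e \<Longrightarrow> a \<le> b + e * r" and r: "0 \<le> r"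
  shows "a \<le> b"
proof (rule field_le_epsilon)
  fix e :: real assume e: "0 < e"
  have "a \<le> b + e / (r + 1) * r" using e r by (intro assms) simp
  also have "e / (r + 1) * r \<le> e / (r + 1) * (r + 1)" using e r by (intro mult_left_mono) auto
  also have "\<dots> = e" using r by simp
  finally show "a \<le> b + e" by simp
qed

section \<open>The functional calculus of an injective positive operator\<close>

text \<open>\<open>c\<close> only has to bound the form. Functions are approximated and compared on
  all of \<open>(0,c]\<close>, so the spectrum itself never has to be determined.\<close>

locale positive_op =
  fixes S :: "'x::{real_inner,banach} \<Rightarrow>\<^sub>L 'x" and c :: real
  assumes selfadjoint: "selfadjoint_op S" and inj: "inj S" and c_pos: "0 < c"
    and form_nonneg: "\<And>x. 0 \<le> S x \<bullet> x" and form_le: "\<And>x. S x \<bullet> x \<le> c * (norm x)\<^sup>2"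
begin

lemma spectrum_subset: "spectrum S - {0} \<subseteq> {0<..c}"
  using spectrum_interval[OF selfadjoint, of 0 c] form_nonneg form_le by auto

text \<open>With \<open>P = Q\<close> this is the Cauchy property; with different \<open>P\<close>
  and \<open>Q\<close> it makes the limit independent of the approximating sequence.\<close>

lemma poly_op_limits_close:
  assumes P: "uniform_limit (spectrum S - {0}) (\<lambda>k. poly (P k)) f sequentially"
    and Q: "uniform_limit (spectrum S - {0}) (\<lambda>k. poly (Q k)) f sequentially" and e: "0 < e"
  obtains N where "\<And>i j. i \<ge> N \<Longrightarrow> j \<ge> N \<Longrightarrow> norm (poly_op (P i) S - poly_op (Q j) S) \<le> e"
proof -
  obtain N1 where N1: "\<And>i x. i \<ge> N1 \<Longrightarrow> x \<in> spectrum S - {0} \<Longrightarrow> dist (poly (P i) x) (f x) < e / 2"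
    using P e unfolding uniform_limit_sequentially_iff by (metis half_gt_zero)
  obtain N2 where N2: "\<And>i x. i \<ge> N2 \<Longrightarrow> x \<in> spectrum S - {0} \<Longrightarrow> dist (poly (Q i) x) (f x) < e / 2"
    using Q e unfolding uniform_limit_sequentially_iff by (metis half_gt_zero)
  have "norm (poly_op (P i) S - poly_op (Q j) S) \<le> e" if "i \<ge> max N1 N2" "j \<ge> max N1 N2" for i j
    unfolding poly_op_diff[symmetric]
  proof (rule poly_op_norm_le[OF selfadjoint inj])
    fix l assume l: "l \<in> spectrum S - {0}"
    show "\<bar>poly (P i - Q j) l\<bar> \<le> e"
      using N1[OF _ l, of i] N2[OF _ l, of j] that
      by (simp add: dist_real_def) (smt (verit) field_sum_of_halves)
  qed (use e in simp)
  then show ?thesis by (rule that)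
qed

text \<open>The description in \<open>fun_op\<close> is resolved here. The given sequence makes it
  determinate: without any approximating sequence every \<open>F\<close> would satisfy it.\<close>

lemma fun_op_limit:
  assumes P: "uniform_limit (spectrum S - {0}) (\<lambda>k. poly (P k)) f sequentially"
  shows "(\<lambda>k. poly_op (P k) S) \<longlonglongrightarrow> fun_op f S"
proof -
  have "Cauchy (\<lambda>k. poly_op (P k) S)"
  proof (rule CauchyI)
    fix e :: real assume e: "0 < e"
    obtain N where "\<And>i j. i \<ge> N \<Longrightarrow> j \<ge> N \<Longrightarrow> norm (poly_op (P i) S - poly_op (P j) S) \<le> e / 2"
      using poly_op_limits_close[OF P P, of "e / 2"] e by auto
    then show "\<exists>M. \<forall>m\<ge>M. \<forall>n\<ge>M. norm (poly_op (P m) S - poly_op (P n) S) < e"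
      using e by (intro exI[of _ N]) (smt (verit) field_sum_of_halves)
  qed
  then obtain F where F: "(\<lambda>k. poly_op (P k) S) \<longlonglongrightarrow> F"
    by (auto simp: Cauchy_convergent_iff convergent_def)
  have other: "(\<lambda>k. poly_op (Q k) S) \<longlonglongrightarrow> F"
    if Q: "uniform_limit (spectrum S - {0}) (\<lambda>k. poly (Q k)) f sequentially" for Q
  proof -
    have "(\<lambda>k. poly_op (P k) S - poly_op (Q k) S) \<longlonglongrightarrow> 0"
    proof (rule LIMSEQ_I)
      fix e :: real assume e: "0 < e"
      obtain N where "\<And>i j. i \<ge> N \<Longrightarrow> j \<ge> N \<Longrightarrow> norm (poly_op (P i) S - poly_op (Q j) S) \<le> e / 2"
        using poly_op_limits_close[OF P Q, of "e / 2"] e by auto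
      then show "\<exists>N. \<forall>n\<ge>N. norm (poly_op (P n) S - poly_op (Q n) S - 0) < e"
        using e by (intro exI[of _ N]) (smt (verit) field_sum_of_halves diff_zero)
    qed
    from tendsto_diff[OF F this] show ?thesis by simp
  qed
  have "fun_op f S = F"
    unfolding fun_op_def
  proof (rule the_equality)
    show "\<forall>Q. uniform_limit (spectrum S - {0}) (\<lambda>k. poly (Q k)) f sequentially
        \<longrightarrow> (\<lambda>k. poly_op (Q k) S) \<longlonglongrightarrow> F"
      using other by blast
    fix F' assume "\<forall>Q. uniform_limit (spectrum S - {0}) (\<lambda>k. poly (Q k)) f sequentially
        \<longrightarrow> (\<lambda>k. poly_op (Q k) S) \<longlonglongrightarrow> F'"
    then show "F' = F" using P F LIMSEQ_unique by blast
  qed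
  then show ?thesis using F by simp
qed

lemma fun_op_limit':
  assumes "uniform_limit {0<..c} (\<lambda>k. poly (P k)) f sequentially"
  shows "(\<lambda>k. poly_op (P k) S) \<longlonglongrightarrow> fun_op f S"
  using fun_op_limit uniform_limit_on_subset[OF assms spectrum_subset] by blast

lemma fun_op_poly: "fun_op (poly P) S = poly_op P S"
  using fun_op_limit'[of "\<lambda>_. P" "poly P"] LIMSEQ_unique tendsto_const by (metis uniform_limit_const)

lemma fun_op_approx:
  assumes "extends_continuously c f"
  obtains P where "uniform_limit {0<..c} (\<lambda>k. poly (P k)) f sequentially"
    "(\<lambda>k. poly_op (P k) S) \<longlonglongrightarrow> fun_op f S"
  using extends_continuously_poly_approx[OF assms] fun_op_limit' by metis

lemma fun_op_cong:
  assumes f: "extends_continuously c f" and eq: "\<And>t. 0 < t \<Longrightarrow> t \<le> c \<Longrightarrow> f t = g t"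
  shows "fun_op f S = fun_op g S"
proof -
  obtain P where P: "uniform_limit {0<..c} (\<lambda>k. poly (P k)) f sequentially"
    "(\<lambda>k. poly_op (P k) S) \<longlonglongrightarrow> fun_op f S"
    using fun_op_approx[OF f] .
  have "uniform_limit {0<..c} (\<lambda>k. poly (P k)) g sequentially"
    using P(1) by (rule uniform_limit_cong'[THEN iffD1, rotated 2]) (use eq in auto)
  then show ?thesis using fun_op_limit' P(2) LIMSEQ_unique by blast
qed

lemma fun_op_const: "fun_op (\<lambda>t. r) S = r *\<^sub>R id_blinfun"
proof -
  have "poly [:r:] = (\<lambda>t. r)" by auto
  then show ?thesis using fun_op_poly[of "[:r:]"] by (simp add: poly_op_const)
qed

lemma fun_op_id: "fun_op (\<lambda>t. t) S = S"
proof -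
  have "poly [:0, 1:] = (\<lambda>t. t :: real)" by auto
  then show ?thesis using fun_op_poly[of "[:0, 1:]"] by (simp add: poly_op_X)
qed

section \<open>Algebraic rules of the calculus\<close>

lemma fun_op_add:
  assumes f: "extends_continuously c f" and g: "extends_continuously c g"
  shows "fun_op (\<lambda>t. f t + g t) S = fun_op f S + fun_op g S"
proof -
  obtain P where P: "uniform_limit {0<..c} (\<lambda>k. poly (P k)) f sequentially"
    "(\<lambda>k. poly_op (P k) S) \<longlonglongrightarrow> fun_op f S"
    using fun_op_approx[OF f] .
  obtain Q where Q: "uniform_limit {0<..c} (\<lambda>k. poly (Q k)) g sequentially"
    "(\<lambda>k. poly_op (Q k) S) \<longlonglongrightarrow> fun_op g S"
    using fun_op_approx[OF g] .
  have "uniform_limit {0<..c} (\<lambda>k. poly (P k + Q k)) (\<lambda>t. f t + g t) sequentially"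
    using uniform_limit_add[OF P(1) Q(1)] by (simp only: poly_add[abs_def])
  from fun_op_limit'[OF this] show ?thesis
    using tendsto_add[OF P(2) Q(2)] LIMSEQ_unique by (simp add: poly_op_add) blast
qed

lemma fun_op_mult:
  assumes f: "extends_continuously c f" and g: "extends_continuously c g"
  shows "fun_op (\<lambda>t. f t * g t) S = fun_op f S o\<^sub>L fun_op g S"
proof -
  obtain P where P: "uniform_limit {0<..c} (\<lambda>k. poly (P k)) f sequentially"
    "(\<lambda>k. poly_op (P k) S) \<longlonglongrightarrow> fun_op f S"
    using fun_op_approx[OF f] .
  obtain Q where Q: "uniform_limit {0<..c} (\<lambda>k. poly (Q k)) g sequentially"
    "(\<lambda>k. poly_op (Q k) S) \<longlonglongrightarrow> fun_op g S"
    using fun_op_approx[OF g] .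
  have bf: "bounded (f ` {0<..c})"
    using extends_continuously_bounded[OF f] unfolding bounded_iff by (metis (no_types, lifting) greaterThanAtMost_iff imageE real_norm_def)
  have bg: "bounded (g ` {0<..c})"
    using extends_continuously_bounded[OF g] unfolding bounded_iff by (metis (no_types, lifting) greaterThanAtMost_iff imageE real_norm_def)
  have "uniform_limit {0<..c} (\<lambda>k. poly (P k * Q k)) (\<lambda>t. f t * g t) sequentially"
    using uniform_lim_mult[OF P(1) Q(1) bf bg] by (simp only: poly_mult[abs_def])
  from fun_op_limit'[OF this]
  have "(\<lambda>k. poly_op (P k) S o\<^sub>L poly_op (Q k) S) \<longlonglongrightarrow> fun_op (\<lambda>t. f t * g t) S"
    by (simp add: poly_op_mult)
  moreover have "(\<lambda>k. poly_op (P k) S o\<^sub>L poly_op (Q k) S) \<longlonglongrightarrow> (fun_op f S o\<^sub>L fun_op g S)"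
    by (rule bounded_bilinear.tendsto[OF bounded_bilinear_blinfun_compose P(2) Q(2)])
  ultimately show ?thesis by (rule LIMSEQ_unique)
qed

lemma fun_op_cmult: "extends_continuously c f \<Longrightarrow> fun_op (\<lambda>t. r * f t) S = r *\<^sub>R fun_op f S"
  by (subst fun_op_mult)
     (auto simp: extends_continuously_const fun_op_const blinfun.scaleR_left intro!: blinfun_eqI)

lemma fun_op_diff:
  assumes "extends_continuously c f" "extends_continuously c g"
  shows "fun_op (\<lambda>t. f t - g t) S = fun_op f S - fun_op g S"
  using fun_op_add[OF assms(1) extends_continuously_cmult[OF assms(2)], of "- 1"]
    fun_op_cmult[OF assms(2), of "- 1"] by simp

section \<open>Self-adjointness, order and norm bounds in the calculus\<close>

lemma selfadjoint_fun_op: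
  assumes f: "extends_continuously c f"
  shows "selfadjoint_op (fun_op f S)"
proof -
  obtain P where "(\<lambda>k. poly_op (P k) S) \<longlonglongrightarrow> fun_op f S"
    using fun_op_approx[OF f] by metis
  then have lim: "(\<lambda>k. poly_op (P k) S x) \<longlonglongrightarrow> fun_op f S x" for x
    by (intro blinfun.tendsto tendsto_const)
  have "fun_op f S x \<bullet> y = x \<bullet> fun_op f S y" for x y
  proof (rule LIMSEQ_unique)
    show "(\<lambda>k. poly_op (P k) S x \<bullet> y) \<longlonglongrightarrow> fun_op f S x \<bullet> y" by (intro tendsto_intros lim)
    have "(\<lambda>k. x \<bullet> poly_op (P k) S y) \<longlonglongrightarrow> x \<bullet> fun_op f S y" by (intro tendsto_intros lim)
    then show "(\<lambda>k. poly_op (P k) S x \<bullet> y) \<longlonglongrightarrow> x \<bullet> fun_op f S y"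
      using selfadjoint_poly_op[OF selfadjoint] by (simp add: selfadjoint_op_def)
  qed
  then show ?thesis by (simp add: selfadjoint_op_def)
qed

text \<open>An approximating polynomial is nonnegative only after its error \<open>e\<close> is
  added, which leaves a defect \<open>e * (norm x)^2\<close> that tends to 0.\<close>

lemma fun_op_form_nonneg:
  assumes f: "extends_continuously c f" and nonneg: "\<And>t. 0 < t \<Longrightarrow> t \<le> c \<Longrightarrow> 0 \<le> f t"
  shows "0 \<le> fun_op f S x \<bullet> x"
proof -
  obtain P where U: "uniform_limit {0<..c} (\<lambda>k. poly (P k)) f sequentially"
    and "(\<lambda>k. poly_op (P k) S) \<longlonglongrightarrow> fun_op f S"
    using fun_op_approx[OF f] .
  then have lim: "(\<lambda>k. poly_op (P k) S x \<bullet> x) \<longlonglongrightarrow> fun_op f S x \<bullet> x"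
    by (intro tendsto_intros blinfun.tendsto)
  have "- (e * (norm x)\<^sup>2) \<le> fun_op f S x \<bullet> x" if e: "0 < e" for e
  proof (rule LIMSEQ_le_const[OF lim])
    obtain N where N: "\<And>n t. n \<ge> N \<Longrightarrow> t \<in> {0<..c} \<Longrightarrow> dist (poly (P n) t) (f t) < e"
      using U e unfolding uniform_limit_sequentially_iff by metis
    have "- (e * (norm x)\<^sup>2) \<le> poly_op (P n) S x \<bullet> x" if n: "n \<ge> N" for n
    proof -
      have "0 \<le> poly_op (P n + [:e:]) S x \<bullet> x"
      proof (rule poly_op_form_nonneg[OF selfadjoint inj])
        fix l assume "l \<in> spectrum S - {0}"
        then have l: "l \<in> {0<..c}" using spectrum_subset by blast
        then show "0 \<le> poly (P n + [:e:]) l"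
          using N[OF n l] nonneg[of l] by (auto simp: dist_real_def)
      qed
      then show ?thesis
        by (simp add: poly_op_add poly_op_const blinfun.add_left blinfun.scaleR_left inner_add_left
            power2_norm_eq_inner)
    qed
    then show "\<exists>N. \<forall>n\<ge>N. - (e * (norm x)\<^sup>2) \<le> poly_op (P n) S x \<bullet> x" by blast
  qed
  then have "0 \<le> fun_op f S x \<bullet> x + e * (norm x)\<^sup>2" if "0 < e" for e
    using that[THEN \<open>\<And>e. 0 < e \<Longrightarrow> - (e * (norm x)\<^sup>2) \<le> fun_op f S x \<bullet> x\<close>] by linarith
  then show ?thesis by (rule real_le_if_le_add_mult) simp_all
qed

lemma fun_op_form_mono:
  assumes f: "extends_continuously c f" and g: "extends_continuously c g"
    and le: "\<And>t. 0 < t \<Longrightarrow> t \<le> c \<Longrightarrow> f t \<le> g t"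
  shows "fun_op f S x \<bullet> x \<le> fun_op g S x \<bullet> x"
  using fun_op_form_nonneg[OF extends_continuously_diff[OF g f], of x] le
  by (simp add: fun_op_diff[OF g f] blinfun.diff_left inner_diff_left)

lemma fun_op_square_form:
  assumes f: "extends_continuously c f"
  shows "fun_op (\<lambda>t. (f t)\<^sup>2) S x \<bullet> x = (norm (fun_op f S x))\<^sup>2"
  using selfadjoint_fun_op[OF f]
  by (simp add: power2_eq_square fun_op_mult[OF f f] selfadjoint_op_def flip: power2_norm_eq_inner)

text \<open>Squared norms are forms of \<open>f^2\<close>, so norm estimates reduce to pointwise
  ones. In this way the scalar filter bounds become operator bounds.\<close>

lemma fun_op_norm_mono:
  assumes f: "extends_continuously c f" and g: "extends_continuously c g"
    and le: "\<And>t. 0 < t \<Longrightarrow> t \<le> c \<Longrightarrow> \<bar>f t\<bar> \<le> \<bar>g t\<bar>"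
  shows "norm (fun_op f S x) \<le> norm (fun_op g S x)"
proof (rule power2_le_imp_le)
  have "(f t)\<^sup>2 \<le> (g t)\<^sup>2" if "0 < t" "t \<le> c" for t
    using le[OF that] by (simp add: abs_le_square_iff)
  then show "(norm (fun_op f S x))\<^sup>2 \<le> (norm (fun_op g S x))\<^sup>2"
    unfolding fun_op_square_form[OF f, symmetric] fun_op_square_form[OF g, symmetric]
    by (intro fun_op_form_mono extends_continuously_power f g)
qed simp

lemma fun_op_norm_le:
  assumes f: "extends_continuously c f"
    and le: "\<And>t. 0 < t \<Longrightarrow> t \<le> c \<Longrightarrow> \<bar>f t\<bar> \<le> b" and b: "0 \<le> b"
  shows "norm (fun_op f S x) \<le> b * norm x"
  using fun_op_norm_mono[OF f extends_continuously_const[of c b], of x] le b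
  by (simp add: fun_op_const blinfun.scaleR_left)

lemma fun_op_dist_le:
  assumes f: "extends_continuously c f" and g: "extends_continuously c g"
    and le: "\<And>t. 0 < t \<Longrightarrow> t \<le> c \<Longrightarrow> \<bar>f t - g t\<bar> \<le> b" and b: "0 \<le> b"
  shows "norm (fun_op f S x - fun_op g S x) \<le> b * norm x"
  using fun_op_norm_le[OF extends_continuously_diff[OF f g] le b]
  by (simp add: fun_op_diff[OF f g] blinfun.diff_left)

text \<open>\<open>1 / f\<close> may blow up at 0, so the division is cut off: \<open>\<phi>\<close>
  is 0 below \<open>e\<close>, and \<open>\<phi> f\<close> still differs from the identity by at
  most \<open>e\<close>. If \<open>f(S) x = 0\<close>, this gives
  \<open>norm (S x) \<le> e * norm x\<close> for every \<open>e\<close>.\<close>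

lemma inj_fun_op:
  assumes f: "extends_continuously c f" and pos: "\<And>t. 0 < t \<Longrightarrow> t \<le> c \<Longrightarrow> 0 < f t"
  shows "inj (fun_op f S)"
proof -
  have "x = 0" if fx: "fun_op f S x = 0" for x
  proof -
    have Se: "norm (S x) \<le> e * norm x" if e: "0 < e" for e
    proof -
      from f obtain F where F: "continuous_on {0..c} F" "\<And>t. t \<in> {0<..c} \<Longrightarrow> f t = F t"
        by (auto simp: extends_continuously_def)
      define \<phi> where "\<phi> t = max (t - e) 0 / f t" for t
      have F0: "F t \<noteq> 0" if "t \<in> {e..c}" for t
        using pos[of t] F(2)[of t] that e by auto
      have cont: "continuous_on {e..c} (\<lambda>t. (t - e) / F t)"
        by (intro continuous_intros continuous_on_subset[OF F(1)]) (use F0 e in auto)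
      have "continuous_on {0..c} (\<lambda>t. if t \<le> e then 0 else (t - e) / F t)"
      proof (cases "e \<le> c")
        case True
        have "{0..c} = {0..e} \<union> {e..c}" using True e by auto
        moreover have "continuous_on ({0..e} \<union> {e..c}) (\<lambda>t. if t \<le> e then 0 else (t - e) / F t)"
          by (rule continuous_on_cases) (use cont in auto)
        ultimately show ?thesis by simp
      next
        case False
        then show ?thesis by (subst continuous_on_cong[of _ "{0..c}" _ "\<lambda>_. 0"]) auto
      qed
      then have \<phi>: "extends_continuously c \<phi>"
        by (rule extends_continuouslyI) (auto simp: \<phi>_def F(2))
      have "norm (fun_op (\<lambda>t. t) S x - fun_op (\<lambda>t. \<phi> t * f t) S x) \<le> e * norm x"
      proof (rule fun_op_dist_le)
        fix t assume "0 < t" "t \<le> c"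
        then have "f t \<noteq> 0" using pos by fastforce
        then show "\<bar>t - \<phi> t * f t\<bar> \<le> e" using \<open>0 < t\<close> e by (simp add: \<phi>_def)
      qed (use e \<phi> f in \<open>auto intro: extends_continuously_id extends_continuously_mult\<close>)
      then show ?thesis using fx by (simp add: fun_op_id fun_op_mult[OF \<phi> f])
    qed
    have "norm (S x) = 0"
    proof (rule ccontr)
      assume "norm (S x) \<noteq> 0"
      then have Sx: "0 < norm (S x)" by simp
      have x: "0 < 2 * (norm x + 1)" by (simp add: add_nonneg_pos)
      have "norm (S x) \<le> norm (S x) / (2 * (norm x + 1)) * norm x"
        by (rule Se) (use Sx x in simp)
      also have "\<dots> \<le> norm (S x) / (2 * (norm x + 1)) * (norm x + 1)"
        using Sx x by (intro mult_left_mono) auto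
      also have "\<dots> = norm (S x) / 2" using x by (simp add: field_simps)
      finally show False using Sx by simp
    qed
    then have "S x = S 0" by (simp add: blinfun.zero_right)
    then show ?thesis using inj by (meson injD)
  qed
  then show ?thesis
    by (intro injI) (metis blinfun.diff_right eq_iff_diff_eq_0)
qed

lemma positive_fun_op:
  assumes g: "extends_continuously c g" and d: "\<And>t. 0 < t \<Longrightarrow> t \<le> c \<Longrightarrow> 0 < g t \<and> g t \<le> d"
  shows "positive_op (fun_op g S) d"
proof
  show "0 < d" using d[of c] c_pos by force
  show "fun_op g S x \<bullet> x \<le> d * (norm x)\<^sup>2" for x
    using fun_op_form_mono[OF g extends_continuously_const[of c d], of x] d
    by (simp add: fun_op_const blinfun.scaleR_left power2_norm_eq_inner)
qed (use selfadjoint_fun_op[OF g] inj_fun_op[OF g] fun_op_form_nonneg[OF g] d less_imp_le in blast)+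

section \<open>Composition of functions\<close>

lemma extends_continuously_poly:
  assumes "extends_continuously c g"
  shows "extends_continuously c (\<lambda>t. poly P (g t))"
  by (induction P)
     (simp_all add: extends_continuously_const extends_continuously_add extends_continuously_mult assms)

lemma poly_op_fun_op:
  assumes g: "extends_continuously c g"
  shows "poly_op P (fun_op g S) = fun_op (\<lambda>t. poly P (g t)) S"
proof (induction P)
  case (pCons a P)
  then show ?case
    by (simp add: poly_op_pCons fun_op_add fun_op_mult fun_op_const extends_continuously_const
        extends_continuously_mult extends_continuously_poly g)
qed (simp add: fun_op_const)

text \<open>For polynomial \<open>f\<close> this is algebra in \<open>S\<close>; in general the
  composed polynomials converge uniformly. It is what evaluates \<open>k^2\<close> at the operator
  \<open>psi_s(G)^2\<close>.\<close>

lemma fun_op_fun_op: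
  assumes f: "extends_continuously d f" and g: "extends_continuously c g"
    and gd: "\<And>t. 0 < t \<Longrightarrow> t \<le> c \<Longrightarrow> 0 < g t \<and> g t \<le> d"
  shows "fun_op f (fun_op g S) = fun_op (\<lambda>t. f (g t)) S"
proof -
  interpret T: positive_op "fun_op g S" d by (rule positive_fun_op[OF g gd])
  have fg: "extends_continuously c (\<lambda>t. f (g t))"
    by (rule extends_continuously_compose[OF f g c_pos gd])
  obtain P where U: "uniform_limit {0<..d} (\<lambda>k. poly (P k)) f sequentially"
    and lim: "(\<lambda>k. poly_op (P k) (fun_op g S)) \<longlonglongrightarrow> fun_op f (fun_op g S)"
    using T.fun_op_approx[OF f] .
  have "(\<lambda>k. poly_op (P k) (fun_op g S)) \<longlonglongrightarrow> fun_op (\<lambda>t. f (g t)) S"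
  proof (rule LIMSEQ_I)
    fix e :: real assume e: "0 < e"
    obtain N where N: "\<And>n t. n \<ge> N \<Longrightarrow> t \<in> {0<..d} \<Longrightarrow> dist (poly (P n) t) (f t) < e / 2"
      using U e unfolding uniform_limit_sequentially_iff by (metis half_gt_zero)
    have "norm (poly_op (P n) (fun_op g S) - fun_op (\<lambda>t. f (g t)) S) < e" if n: "n \<ge> N" for n
    proof -
      have "norm (poly_op (P n) (fun_op g S) - fun_op (\<lambda>t. f (g t)) S) \<le> e / 2"
        unfolding poly_op_fun_op[OF g]
      proof (rule norm_blinfun_bound)
        fix x
        show "norm ((fun_op (\<lambda>t. poly (P n) (g t)) S - fun_op (\<lambda>t. f (g t)) S) x) \<le> e / 2 * norm x"
          unfolding blinfun.diff_left
        proof (rule fun_op_dist_le[OF extends_continuously_poly[OF g] fg])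
          fix t assume "0 < t" "t \<le> c"
          then have "g t \<in> {0<..d}" using gd by auto
          then show "\<bar>poly (P n) (g t) - f (g t)\<bar> \<le> e / 2"
            using N[OF n] by (force simp: dist_real_def)
        qed (use e in auto)
      qed (use e in auto)
      then show ?thesis using e by linarith
    qed
    then show "\<exists>N. \<forall>n\<ge>N. norm (poly_op (P n) (fun_op g S) - fun_op (\<lambda>t. f (g t)) S) < e" by blast
  qed
  then show ?thesis using lim LIMSEQ_unique by blast
qed

end

section \<open>Operator monotone functions\<close>

text \<open>The definition of operator monotonicity excludes operators with \<open>0\<close> in the spectrum. They are
  reached as limits of \<open>(1 - \<tau>) S + \<tau> c\<close>.\<close>

lemma operator_monotone_form_le:
  fixes S1 S2 :: "'x::{real_inner,banach} \<Rightarrow>\<^sub>L 'x"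
  assumes S1: "positive_op S1 c" and S2: "positive_op S2 c" and le: "\<And>x. S1 x \<bullet> x \<le> S2 x \<bullet> x"
    and mono: "operator_monotone TYPE('x) c f" and f: "extends_continuously c f"
  shows "fun_op f S1 x \<bullet> x \<le> fun_op f S2 x \<bullet> x"
proof -
  have c: "0 < c" using S1 by (simp add: positive_op_def)
  from f obtain F where F: "continuous_on {0..c} F" "\<And>t. t \<in> {0<..c} \<Longrightarrow> f t = F t"
    by (auto simp: extends_continuously_def)
  have uc: "uniformly_continuous_on {0..c} F" using F(1) compact_Icc by (rule compact_uniformly_continuous)
  have "fun_op f S1 x \<bullet> x \<le> fun_op f S2 x \<bullet> x + e * (2 * (norm x)\<^sup>2)" if e: "0 < e" for e
  proof -
    obtain d where d: "0 < d" "\<And>s t. s \<in> {0..c} \<Longrightarrow> t \<in> {0..c} \<Longrightarrow> \<bar>s - t\<bar> < d \<Longrightarrow> \<bar>F s - F t\<bar> < e"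
      using uc e unfolding uniformly_continuous_on_def dist_real_def by metis
    \<comment> \<open>\<open>\<tau> * c < d\<close> keeps the shifted argument within the modulus of
      uniform continuity of \<open>F\<close>; the bound 1/2 keeps \<open>1 - \<tau>\<close>
      positive.\<close>
    define \<tau> where "\<tau> = min (1 / 2) (d / (2 * c))"
    have \<tau>: "0 < \<tau>" "\<tau> < 1" "\<tau> * c < d"
    proof -
      show "0 < \<tau>" "\<tau> < 1" using d(1) c by (auto simp: \<tau>_def)
      have "\<tau> * c \<le> d / (2 * c) * c" using c by (intro mult_right_mono) (auto simp: \<tau>_def)
      then show "\<tau> * c < d" using c d(1) by simp
    qed
    define g where "g t = (1 - \<tau>) * t + \<tau> * c" for t
    have g: "extends_continuously c g"
      unfolding g_def by (intro extends_continuously_add extends_continuously_cmult extends_continuously_id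
          extends_continuously_const)
    have gc: "0 < g t \<and> g t \<le> c" if "0 < t" "t \<le> c" for t
    proof
      show "0 < g t" using that \<tau> c by (simp add: g_def add_pos_pos)
      have "(1 - \<tau>) * t \<le> (1 - \<tau>) * c" using that \<tau> by (intro mult_left_mono) auto
      then show "g t \<le> c" by (simp add: g_def algebra_simps)
    qed
    have near: "\<bar>f (g t) - f t\<bar> \<le> e" if t: "0 < t" "t \<le> c" for t
    proof -
      have "g t - t = \<tau> * (c - t)" by (simp add: g_def algebra_simps)
      moreover have "0 \<le> \<tau> * (c - t)" "\<tau> * (c - t) \<le> \<tau> * c"
        using t \<tau> by (auto intro: mult_left_mono)
      ultimately have "\<bar>g t - t\<bar> < d" using \<tau>(3) by linarith
      then show ?thesis using d(2)[of "g t" t] gc[OF t] t F(2)[of t] F(2)[of "g t"] by auto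
    qed
    have shift: "selfadjoint_op (fun_op g S) \<and> spectrum (fun_op g S) \<subseteq> {0<..c}
        \<and> (\<forall>x. fun_op g S x \<bullet> x = (1 - \<tau>) * (S x \<bullet> x) + \<tau> * c * (x \<bullet> x))
        \<and> \<bar>fun_op f (fun_op g S) x \<bullet> x - fun_op f S x \<bullet> x\<bar> \<le> e * (norm x)\<^sup>2"
      if "positive_op S c" for S :: "'x \<Rightarrow>\<^sub>L 'x"
    proof -
      interpret positive_op S c by fact
      interpret T: positive_op "fun_op g S" c by (rule positive_fun_op[OF g gc])
      have gS: "fun_op g S = (1 - \<tau>) *\<^sub>R S + (\<tau> * c) *\<^sub>R id_blinfun"
        unfolding g_def
        by (simp add: fun_op_add fun_op_cmult fun_op_id fun_op_const extends_continuously_cmult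
            extends_continuously_id extends_continuously_const)
      have fg: "fun_op f (fun_op g S) = fun_op (\<lambda>t. f (g t)) S"
        by (rule fun_op_fun_op[OF f g]) (rule gc)
      have form: "fun_op g S x \<bullet> x = (1 - \<tau>) * (S x \<bullet> x) + \<tau> * c * (x \<bullet> x)" for x
        by (simp add: gS blinfun.add_left blinfun.scaleR_left inner_add_left)
      have "spectrum (fun_op g S) \<subseteq> {\<tau> * c..c}"
      proof (rule spectrum_interval[OF T.selfadjoint _ T.form_le])
        show "\<tau> * c * (norm x)\<^sup>2 \<le> fun_op g S x \<bullet> x" for x
          using form_nonneg[of x] \<tau> by (simp add: form power2_norm_eq_inner)
      qed
      then have spec: "spectrum (fun_op g S) \<subseteq> {0<..c}" using mult_pos_pos[OF \<tau>(1) c] by force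
      have "\<bar>fun_op f (fun_op g S) x \<bullet> x - fun_op f S x \<bullet> x\<bar>
          \<le> norm (fun_op (\<lambda>t. f (g t)) S x - fun_op f S x) * norm x"
        unfolding fg inner_diff_left[symmetric] by (rule Cauchy_Schwarz_ineq2)
      also have "\<dots> \<le> (e * norm x) * norm x"
        using e by (intro mult_right_mono fun_op_dist_le f near extends_continuously_compose[OF f g c_pos gc]) auto
      finally show ?thesis using T.selfadjoint spec form by (simp add: power2_eq_square)
    qed
    have "le_op (fun_op g S1) (fun_op g S2)"
      unfolding le_op_def using shift[OF S1] shift[OF S2] le \<tau> by (simp add: mult_left_mono)
    then have "fun_op f (fun_op g S1) x \<bullet> x \<le> fun_op f (fun_op g S2) x \<bullet> x"
      using mono shift[OF S1] shift[OF S2] unfolding operator_monotone_def le_op_def by blast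
    then show ?thesis using shift[OF S1] shift[OF S2] by (auto simp: abs_le_iff)
  qed
  then show ?thesis by (rule real_le_if_le_add_mult) simp_all
qed

section \<open>Index functions and filters\<close>

definition extend0 :: "(real \<Rightarrow> real) \<Rightarrow> real \<Rightarrow> real" where
  "extend0 f t = (if t \<le> 0 then 0 else f t)"

lemma index_function_extend0:
  assumes f: "index_function a b f" and a: "0 < a"
  shows "continuous_on {0..a} (extend0 f)" "strict_mono_on {0..a} (extend0 f)"
proof -
  have cont: "continuous_on {0<..a} f" and mono: "strict_mono_on {0<..a} f"
    and lim: "(f \<longlongrightarrow> 0) (at_right 0)" and pos: "\<And>t. 0 < t \<Longrightarrow> t \<le> a \<Longrightarrow> 0 < f t"
    using f by (auto simp: index_function_def image_subset_iff)
  show "continuous_on {0..a} (extend0 f)"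
  proof (rule continuous_on_IccI[OF _ _ _ a])
    have "\<forall>\<^sub>F t in at_right 0. extend0 f t = f t"
      by (simp add: eventually_at_filter extend0_def)
    then show "(extend0 f \<longlongrightarrow> extend0 f 0) (at_right 0)"
      using lim by (simp add: tendsto_cong extend0_def)
    have "continuous_on {a/2..a} f" by (rule continuous_on_subset[OF cont]) (use a in auto)
    then have "(f \<longlongrightarrow> f a) (at_left a)" by (rule continuous_on_Icc_at_leftD) (use a in simp)
    moreover have "\<forall>\<^sub>F t in at_left a. extend0 f t = f t"
      using a by (auto simp: extend0_def eventually_at_left[OF a] intro!: exI[of _ 0])
    ultimately show "(extend0 f \<longlongrightarrow> extend0 f a) (at_left a)"
      using a by (simp add: tendsto_cong extend0_def)
    fix t assume t: "0 < t" "t < a"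
    have "isCont f t"
      by (rule continuous_on_interior[OF cont]) (use t in \<open>simp add: interior_open\<close>)
    moreover have "\<forall>\<^sub>F u in at t. extend0 f u = f u"
      using eventually_at_topological t
      by (auto simp: eventually_at_topological extend0_def intro!: exI[of _ "{0<..}"])
    ultimately show "extend0 f \<midarrow>t\<rightarrow> extend0 f t"
      using t by (simp add: tendsto_cong extend0_def isCont_def)
  qed
  show "strict_mono_on {0..a} (extend0 f)"
    using mono pos by (auto simp: strict_mono_on_def extend0_def)
qed

lemma index_function_extends_continuously:
  "index_function a b f \<Longrightarrow> 0 < a \<Longrightarrow> extends_continuously a f"
  by (rule extends_continuouslyI[OF index_function_extend0(1)]) (auto simp: extend0_def)

lemma index_function_image:
  assumes f: "index_function a b f" and a: "0 < a"
  shows "f ` {0<..a} = {0<..f a}"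
proof
  show "f ` {0<..a} \<subseteq> {0<..f a}"
    using f a by (auto simp: index_function_def image_subset_iff intro!: strict_mono_on_leD[of "{0<..a}" f])
  show "{0<..f a} \<subseteq> f ` {0<..a}"
  proof
    fix y assume y: "y \<in> {0<..f a}"
    have "\<exists>x. 0 \<le> x \<and> x \<le> a \<and> extend0 f x = y"
      by (rule IVT'[OF _ _ _ index_function_extend0(1)[OF f a]]) (use y a in \<open>auto simp: extend0_def\<close>)
    then show "y \<in> f ` {0<..a}" using y by (auto simp: extend0_def split: if_splits)
  qed
qed

lemma index_function_inj_on: "index_function a b f \<Longrightarrow> inj_on f {0<..a}"
  by (simp add: index_function_def strict_mono_on_imp_inj_on)

lemma index_function_inverse:
  assumes f: "index_function a b f" and a: "0 < a" and y: "0 < y" "y \<le> f a"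
  shows "0 < the_inv_into {0<..a} f y" "the_inv_into {0<..a} f y \<le> a"
    "f (the_inv_into {0<..a} f y) = y"
proof -
  have "y \<in> f ` {0<..a}" using y index_function_image[OF f a] by simp
  then show "f (the_inv_into {0<..a} f y) = y" "0 < the_inv_into {0<..a} f y"
    "the_inv_into {0<..a} f y \<le> a"
    using the_inv_into_into[OF index_function_inj_on[OF f], of y "{0<..a}"]
      f_the_inv_into_f[OF index_function_inj_on[OF f]] by auto
qed

text \<open>Including 0 makes the domain compact, and there the inverse of a continuous injection is
  continuous.\<close>

lemma index_function_inverse_extends:
  assumes f: "index_function a b f" and a: "0 < a"
  shows "extends_continuously (f a) (the_inv_into {0<..a} f)"
proof -
  let ?F = "extend0 f"
  have inj: "inj_on ?F {0..a}"
    by (rule strict_mono_on_imp_inj_on[OF index_function_extend0(2)[OF f a]])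
  have "?F ` {0..a} = insert 0 (f ` {0<..a})"
    using a by (force simp: extend0_def image_iff)
  also have "\<dots> = {0..f a}"
  proof -
    have "0 \<le> f a" using f a by (auto simp: index_function_def image_subset_iff less_imp_le)
    then show ?thesis unfolding index_function_image[OF f a] by auto
  qed
  finally have img: "?F ` {0..a} = {0..f a}" .
  have "continuous_on (?F ` {0..a}) (the_inv_into {0..a} ?F)"
    by (rule continuous_on_inv_into[OF index_function_extend0(1)[OF f a] compact_Icc inj])
  then have "continuous_on {0..f a} (the_inv_into {0..a} ?F)" by (simp only: img)
  then show ?thesis
  proof (rule extends_continuouslyI)
    fix t assume t: "0 < t" "t \<le> f a"
    note inv = index_function_inverse[OF f a t]
    show "the_inv_into {0<..a} f t = the_inv_into {0..a} ?F t"
      by (rule the_inv_into_f_eq[symmetric, OF inj]) (use inv in \<open>auto simp: extend0_def\<close>)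
  qed
qed

lemma index_function_less_iff:
  assumes "index_function a b f" "0 < x" "x \<le> a" "0 < y" "y \<le> a"
  shows "f x < f y \<longleftrightarrow> x < y" "f x \<le> f y \<longleftrightarrow> x \<le> y"
  using assms strict_mono_on_less[of "{0<..a}" f] strict_mono_on_less_eq[of "{0<..a}" f]
  by (auto simp: index_function_def)

text \<open>For a positive exponent both factors increase. For \<open>s\<close>, which may be
  negative, the same property is an assumption.\<close>

lemma index_function_psi:
  assumes \<rho>: "index_function a (\<rho> a) \<rho>" and a: "0 < a" and p: "0 < p"
  shows "index_function a (psi \<rho> p a) (psi \<rho> p)"
proof -
  have mono: "psi \<rho> p x < psi \<rho> p y" if "0 < x" "x < y" "y \<le> a" for x y
  proof -
    have "0 < \<rho> x" "\<rho> x < \<rho> y"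
      using \<rho> that by (auto simp: index_function_def image_subset_iff strict_mono_on_def)
    then show ?thesis
      unfolding psi_def using that p by (intro mult_strict_mono powr_less_mono2) auto
  qed
  have pos: "0 < psi \<rho> p x" if "0 < x" "x \<le> a" for x
    using \<rho> that by (auto simp: index_function_def image_subset_iff psi_def)
  have "((\<lambda>l. l powr p) \<longlongrightarrow> 0) (at_right 0)"
    using tendsto_powr'[of "\<lambda>l. l" 0 "at_right 0" "\<lambda>_. p" p] p
    by (auto intro: tendsto_ident_at simp: eventually_at_filter)
  then have "((\<lambda>l. l powr p * \<rho> l) \<longlongrightarrow> 0 * 0) (at_right 0)"
    using \<rho> by (intro tendsto_mult) (auto simp: index_function_def)
  moreover have "continuous_on {0<..a} (\<lambda>l. l powr p * \<rho> l)"
    using \<rho> by (intro continuous_intros) (auto simp: index_function_def)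
  moreover have "psi \<rho> p ` {0<..a} \<subseteq> {0<..psi \<rho> p a}"
    using pos mono a by (force simp: image_subset_iff le_less)
  ultimately show ?thesis
    using mono by (auto simp: index_function_def strict_mono_on_def psi_def[abs_def])
qed

section \<open>Residual and filter functions of nonstationary iterated Tikhonov
  regularization\<close>

definition filter_residual :: "(nat \<Rightarrow> real) \<Rightarrow> nat \<Rightarrow> real \<Rightarrow> real" where
  "filter_residual \<alpha> n l = (\<Prod>k=1..n. \<alpha> k / (l + \<alpha> k))"

lemma filter_residual_0 [simp]: "filter_residual \<alpha> 0 l = 1"
  by (simp add: filter_residual_def)

lemma filter_residual_Suc:
  "filter_residual \<alpha> (Suc n) l = filter_residual \<alpha> n l * (\<alpha> (Suc n) / (l + \<alpha> (Suc n)))"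
  by (simp add: filter_residual_def)

lemma g_filter_eq: "0 < l \<Longrightarrow> l * g_filter \<alpha> n l = 1 - filter_residual \<alpha> n l"
  by (simp add: g_filter_def filter_residual_def)

lemma filter_residual_bounds:
  assumes "\<forall>k\<in>{1..n}. 0 < \<alpha> k" "0 < l"
  shows "0 \<le> filter_residual \<alpha> n l" "filter_residual \<alpha> n l \<le> 1"
  unfolding filter_residual_def using assms
  by (auto intro!: prod_nonneg prod_le_1 simp: add_pos_pos less_imp_le)

text \<open>In terms of \<open>x_k = l / \<alpha> k\<close>, the product of the
  \<open>1 + x_k\<close> is at least 1 plus the sum of the \<open>x_k\<close>. This is the decay of
  the residual beyond the cut-off.\<close>

lemma filter_residual_le:
  assumes "\<forall>k\<in>{1..n}. 0 < \<alpha> k" "0 < l"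
  shows "filter_residual \<alpha> n l * (1 + l * (\<Sum>k=1..n. 1 / \<alpha> k)) \<le> 1"
  using assms(1)
proof (induction n)
  case (Suc n)
  let ?a = "\<alpha> (Suc n)" and ?\<sigma> = "\<Sum>k=1..n. 1 / \<alpha> k" and ?r = "filter_residual \<alpha> n l"
  have a: "0 < ?a" using Suc.prems by simp
  have r: "0 \<le> ?r" by (rule filter_residual_bounds) (use Suc.prems assms in auto)
  have \<sigma>: "0 \<le> ?\<sigma>" using Suc.prems by (intro sum_nonneg) (auto intro: less_imp_le)
  have "?a / (l + ?a) * (1 + l * (?\<sigma> + 1 / ?a)) = (?a + l + ?a * l * ?\<sigma>) / (l + ?a)"
  proof -
    have "?a * (1 + l * (?\<sigma> + 1 / ?a)) = ?a + l + ?a * l * ?\<sigma>"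
      using a by (simp add: distrib_left)
    then show ?thesis by (metis times_divide_eq_left)
  qed
  also have "\<dots> \<le> 1 + l * ?\<sigma>"
    using a assms(2) \<sigma> by (simp add: divide_le_eq algebra_simps)
  finally have "?r * (?a / (l + ?a) * (1 + l * (?\<sigma> + 1 / ?a))) \<le> ?r * (1 + l * ?\<sigma>)"
    using r by (rule mult_left_mono)
  also have "\<dots> \<le> 1" using Suc by simp
  finally show ?case by (simp add: filter_residual_Suc mult_ac)
qed simp

text \<open>Divided by \<open>l\<close>, this is \<open>g_n \<le> \<sigma>_n\<close>, the bound on
  the amplification of noise.\<close>

lemma one_minus_filter_residual_le:
  assumes "\<forall>k\<in>{1..n}. 0 < \<alpha> k" "0 < l"
  shows "1 - filter_residual \<alpha> n l \<le> l * (\<Sum>k=1..n. 1 / \<alpha> k)"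
  using assms(1)
proof (induction n)
  case (Suc n)
  let ?a = "\<alpha> (Suc n)" and ?r = "filter_residual \<alpha> n l"
  have a: "0 < ?a" using Suc.prems by simp
  have r: "0 \<le> ?r" "?r \<le> 1" by (rule filter_residual_bounds; use Suc.prems assms in auto)+
  have "1 - ?r * (?a / (l + ?a)) = 1 - ?r + ?r * (l / (l + ?a))"
    using a assms(2) by (simp add: field_simps)
  also have "?r * (l / (l + ?a)) \<le> 1 * (l / ?a)"
    using a assms(2) r by (intro mult_mono) (auto simp: field_simps)
  finally show ?case using Suc by (simp add: filter_residual_Suc distrib_left)
qed simp

lemma filter_residual_extends:
  assumes "\<forall>k\<in>{1..n}. 0 < \<alpha> k" "0 < b"
  shows "extends_continuously c (\<lambda>t. filter_residual \<alpha> n (b * t))"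
proof (rule extends_continuouslyI)
  show "continuous_on {0..c} (\<lambda>t. filter_residual \<alpha> n (b * t))"
    unfolding filter_residual_def
    using assms by (intro continuous_intros) (auto simp: add_nonneg_pos less_imp_neq[symmetric])
qed simp

text \<open>The division by \<open>l\<close> hides a removable singularity at 0; the recursion
  \<open>g_(n+1) = g_n + r_n / (l + \<alpha>_(n+1))\<close> avoids it. The factor \<open>b\<close>
  allows for the normalization of \<open>S\<close> by \<open>M^2\<close>.\<close>

lemma g_filter_extends:
  assumes "\<forall>k\<in>{1..n}. 0 < \<alpha> k" "0 < b"
  shows "extends_continuously c (\<lambda>t. g_filter \<alpha> n (b * t))"
  using assms(1)
proof (induction n)
  case 0
  then show ?case by (simp add: g_filter_def extends_continuously_const)
next
  case (Suc n)
  let ?a = "\<alpha> (Suc n)"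
  have a: "0 < ?a" using Suc.prems by simp
  have "continuous_on {0..c} (\<lambda>t. 1 / (b * t + ?a))"
    using a assms(2) by (intro continuous_intros) (auto simp: add_nonneg_pos less_imp_neq[symmetric])
  then have "extends_continuously c (\<lambda>t. 1 / (b * t + ?a))" by (rule extends_continuouslyI) simp
  then have ext: "extends_continuously c
      (\<lambda>t. g_filter \<alpha> n (b * t) + filter_residual \<alpha> n (b * t) * (1 / (b * t + ?a)))"
    using Suc assms(2)
    by (intro extends_continuously_add extends_continuously_mult filter_residual_extends) auto
  show ?case
  proof (rule extends_continuously_cong[OF ext])
    fix t :: real assume "0 < t"
    define l where "l = b * t"
    have l: "0 < l" using \<open>0 < t\<close> assms(2) by (simp add: l_def)
    have "l * g_filter \<alpha> (Suc n) l = l * (g_filter \<alpha> n l + filter_residual \<alpha> n l * (1 / (l + ?a)))"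
    proof -
      have "1 - ?a / (l + ?a) = l / (l + ?a)" using l a by (simp add: field_simps)
      then have "1 - r * (?a / (l + ?a)) = (1 - r) + r * (l / (l + ?a))" for r
        by (metis (no_types, opaque_lifting) add_diff_eq diff_add_cancel mult.right_neutral right_diff_distrib')
      then show ?thesis
        using l by (simp add: distrib_left g_filter_eq filter_residual_Suc mult.left_commute[of l])
    qed
    then show "g_filter \<alpha> (Suc n) (b * t)
        = g_filter \<alpha> n (b * t) + filter_residual \<alpha> n (b * t) * (1 / (b * t + ?a))"
      using l by (auto simp: l_def)
  qed
qed

text \<open>The filter with parameter \<open>\<sigma>\<close> cuts off at \<open>t = 1 / \<sigma>\<close>. By the two monotonicity assumptions
  \<open>sqrt t * h t * r\<close> and \<open>sqrt t * g / h t\<close>, with \<open>min 1 (1 / (\<sigma> t))\<close> for \<open>r\<close> and \<open>min (1 / t) \<sigma>\<close> for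
  \<open>g\<close>, are largest there; the minimum with \<open>c\<close> covers a cut-off beyond the spectrum.\<close>

lemma filter_scalar_bounds:
  fixes h :: "real \<Rightarrow> real"
  assumes pos: "\<And>t. 0 < t \<Longrightarrow> t \<le> c \<Longrightarrow> 0 < h t"
    and incr: "\<And>s t. 0 < s \<Longrightarrow> s \<le> t \<Longrightarrow> t \<le> c \<Longrightarrow> sqrt s * h s \<le> sqrt t * h t"
    and decr: "\<And>s t. 0 < s \<Longrightarrow> s \<le> t \<Longrightarrow> t \<le> c \<Longrightarrow> h t / sqrt t \<le> h s / sqrt s"
    and \<sigma>: "0 < \<sigma>" and \<mu>: "\<mu> = min (1 / \<sigma>) c" and t: "0 < t" "t \<le> c"
  shows "\<lbrakk>0 \<le> r; r \<le> 1; r * (\<sigma> * t) \<le> 1\<rbrakk> \<Longrightarrow> sqrt t * h t * r \<le> sqrt \<mu> * h \<mu>"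
    and "\<lbrakk>0 \<le> g; t * g \<le> 1; g \<le> \<sigma>\<rbrakk> \<Longrightarrow> sqrt t * g \<le> h t / (sqrt \<mu> * h \<mu>)"
proof -
  have \<mu>': "0 < \<mu>" "\<mu> \<le> c" "\<mu> * \<sigma> \<le> 1"
    using \<sigma> \<mu> t by (auto simp: min_def field_simps split: if_splits)
  have h\<mu>: "0 < h \<mu>" and ht: "0 < h t" using pos \<mu>' t by auto
  define N where "N = sqrt \<mu> * h \<mu>"
  have N: "0 < N" using \<mu>' h\<mu> by (simp add: N_def)
  show "sqrt t * h t * r \<le> sqrt \<mu> * h \<mu>" if r: "0 \<le> r" "r \<le> 1" "r * (\<sigma> * t) \<le> 1"
  proof (cases "t \<le> \<mu>")
    case True
    have "sqrt t * h t * r \<le> sqrt t * h t * 1" using r ht t by (intro mult_left_mono) auto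
    also have "\<dots> \<le> sqrt \<mu> * h \<mu>" using incr[OF t(1) True \<mu>'(2)] by simp
    finally show ?thesis .
  next
    case False
    \<comment> \<open>As \<open>t \<le> c\<close>, lying above the cut-off excludes
      \<open>\<mu> = c\<close>.\<close>
    then have \<mu>\<sigma>: "\<mu> = 1 / \<sigma>" using \<mu> t by (cases "1 / \<sigma> \<le> c") (auto simp: min_def)
    have "r * t \<le> \<mu>" using r(3) \<sigma> by (simp add: \<mu>\<sigma> field_simps)
    have "sqrt t * h t * r = (h t / sqrt t) * (r * t)"
      using t by (simp add: field_simps)
    also have "\<dots> \<le> (h \<mu> / sqrt \<mu>) * \<mu>"
      using decr[OF \<mu>'(1) _ t(2)] False \<open>r * t \<le> \<mu>\<close> r t h\<mu> \<mu>' by (intro mult_mono) auto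
    also have "\<dots> = sqrt \<mu> * h \<mu>" using \<mu>'(1) real_div_sqrt[of \<mu>] by (metis less_imp_le mult.commute times_divide_eq_left)
    finally show ?thesis .
  qed
  show "sqrt t * g \<le> h t / (sqrt \<mu> * h \<mu>)" if g: "0 \<le> g" "t * g \<le> 1" "g \<le> \<sigma>"
  proof (cases "\<mu> \<le> t")
    case True
    have "sqrt t * g * N \<le> sqrt t * g * (sqrt t * h t)"
      using incr[OF \<mu>'(1) True t(2)] g t unfolding N_def by (intro mult_left_mono) auto
    also have "\<dots> = (t * g) * h t" using t by (simp add: mult_ac)
    also have "\<dots> \<le> 1 * h t" using g ht by (intro mult_right_mono) auto
    finally have "sqrt t * g * N \<le> h t" by simp
    then show ?thesis using N by (simp add: N_def[symmetric] pos_le_divide_eq)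
  next
    case False
    then have le: "t \<le> \<mu>" by simp
    have g\<mu>: "g * \<mu> \<le> 1"
      using mult_left_mono[OF g(3), of \<mu>] \<mu>' by (metis less_imp_le mult.commute order_trans)
    have "sqrt t * g * N = sqrt t * (g * \<mu>) * (h \<mu> / sqrt \<mu>)"
      using real_div_sqrt[of \<mu>] \<mu>'(1) by (simp add: N_def field_simps)
    also have "\<dots> \<le> sqrt t * 1 * (h t / sqrt t)"
      using decr[OF t(1) le \<mu>'(2)] g\<mu> t g \<mu>' h\<mu> by (intro mult_mono) auto
    also have "\<dots> = h t" using t by simp
    finally have "sqrt t * g * N \<le> h t" .
    then show ?thesis using N by (simp add: N_def[symmetric] pos_le_divide_eq)
  qed
qed

section \<open>Bounds in the Hilbert scale\<close>

text \<open>Filter regularization of \<open>T u = y\<close>, expressed in the calculus of \<open>S = T\<^sup>*T / M\<^sup>2\<close>.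
  The operator \<open>R\<close> stands for \<open>G\<^bsup>|p - s|\<^esup>\<close>; it is comparable to \<open>k(S)\<close>.\<close>

locale filter_regularization = positive_op S c
  for S :: "'x::{real_inner,banach} \<Rightarrow>\<^sub>L 'x" and c :: real +
  fixes T :: "'x \<Rightarrow>\<^sub>L 'y::{real_inner,banach}" and M K :: real
    and R :: "'x \<Rightarrow>\<^sub>L 'x" and k g r :: "real \<Rightarrow> real"
  assumes M_pos: "0 < M" and K_ge: "1 \<le> K"
    and TT: "adj_op T o\<^sub>L T = M\<^sup>2 *\<^sub>R S"
    and R: "selfadjoint_op R" "inj R"
    and k: "extends_continuously c k" "\<And>t. 0 < t \<Longrightarrow> t \<le> c \<Longrightarrow> 0 < k t"
    and k_le_R: "\<And>x. norm (fun_op k S x) \<le> norm (R x)"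
    and R_le_k: "\<And>x. norm (R x) \<le> K * norm (fun_op k S x)"
    and g: "extends_continuously c g" "\<And>t. 0 < t \<Longrightarrow> t \<le> c \<Longrightarrow> 0 \<le> g t"
    and r: "extends_continuously c r" "\<And>t. 0 < t \<Longrightarrow> t \<le> c \<Longrightarrow> 0 \<le> r t \<and> r t \<le> 1"
    and rg: "\<And>t. 0 < t \<Longrightarrow> t \<le> c \<Longrightarrow> r t = 1 - M\<^sup>2 * t * g t"
begin

abbreviation \<Gamma> where "\<Gamma> \<equiv> fun_op g S"
abbreviation \<Delta> where "\<Delta> \<equiv> fun_op r S"
abbreviation Q where "Q \<equiv> fun_op sqrt S"

lemma adj_T: "adj_op T (T x) = M\<^sup>2 *\<^sub>R S x"
  using TT by (metis blinfun.scaleR_left blinfun_apply_blinfun_compose)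

lemma extends_sqrt: "extends_continuously c sqrt"
  by (rule extends_continuouslyI[of _ sqrt]) (auto intro: continuous_intros)

lemma norm_T: "norm (T x) = M * norm (Q x)"
proof -
  have "(norm (T x))\<^sup>2 = T x \<bullet> T x" by (simp add: power2_norm_eq_inner)
  also have "\<dots> = M\<^sup>2 * (S x \<bullet> x)" by (simp add: adj_op_works adj_T inner_commute)
  also have "S x \<bullet> x = fun_op (\<lambda>t. (sqrt t)\<^sup>2) S x \<bullet> x"
    using fun_op_cong[OF extends_continuously_id[of c], of "\<lambda>t. (sqrt t)\<^sup>2"] by (simp add: fun_op_id)
  also have "\<dots> = (norm (Q x))\<^sup>2" by (rule fun_op_square_form[OF extends_sqrt])
  finally show ?thesis using M_pos by (simp flip: power_mult_distrib)
qed

lemma filter_normal_op: "\<Gamma> (adj_op T (T x)) = x - \<Delta> x"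
proof -
  have "fun_op r S = fun_op (\<lambda>t. 1 - M\<^sup>2 * (g t * t)) S"
    by (rule fun_op_cong[OF r(1)]) (simp add: rg)
  also have "\<dots> = id_blinfun - M\<^sup>2 *\<^sub>R (\<Gamma> o\<^sub>L S)"
    using g(1) extends_continuously_id
    by (simp add: fun_op_diff fun_op_cmult fun_op_mult fun_op_id fun_op_const extends_continuously_const
        extends_continuously_mult extends_continuously_cmult)
  finally show ?thesis
    by (simp add: adj_T blinfun.diff_left blinfun.scaleR_left blinfun.scaleR_right)
qed

text \<open>The operator \<open>T \<Gamma> T^* - I\<close> acts on the data space, outside the
  calculus of \<open>S\<close>. Expanding the square, with \<open>z\<close> the adjoint of
  \<open>T\<close> at \<open>\<eta>\<close>, leaves the squared norm of \<open>T \<Gamma> z\<close>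
  minus twice the form of \<open>g\<close> at \<open>z\<close>; the former is the form of
  \<open>(1 - r) g\<close>.\<close>

lemma noise_residual_le: "norm (T (\<Gamma> (adj_op T \<eta>)) - \<eta>) \<le> norm \<eta>"
proof -
  define z where "z = adj_op T \<eta>"
  have Tz: "T u \<bullet> \<eta> = u \<bullet> z" for u by (simp add: adj_op_works z_def)
  have "(norm (T (\<Gamma> z)))\<^sup>2 = \<Gamma> z \<bullet> adj_op T (T (\<Gamma> z))"
    by (simp add: power2_norm_eq_inner adj_op_works)
  also have "\<dots> = \<Gamma> (adj_op T (T (\<Gamma> z))) \<bullet> z"
    using selfadjoint_fun_op[OF g(1)] by (metis selfadjoint_op_def inner_commute)
  also have "\<dots> = \<Gamma> z \<bullet> z - fun_op (\<lambda>t. r t * g t) S z \<bullet> z"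
    by (simp add: filter_normal_op fun_op_mult r(1) g(1) inner_diff_left)
  also have "\<dots> \<le> \<Gamma> z \<bullet> z"
    using fun_op_form_nonneg[OF extends_continuously_mult[OF r(1) g(1)], of z] r(2) g(2) by auto
  finally have le: "(norm (T (\<Gamma> z)))\<^sup>2 \<le> \<Gamma> z \<bullet> z" .
  have "0 \<le> \<Gamma> z \<bullet> z" using fun_op_form_nonneg[OF g] by blast
  moreover have "(norm (T (\<Gamma> z) - \<eta>))\<^sup>2 = (norm (T (\<Gamma> z)))\<^sup>2 - 2 * (\<Gamma> z \<bullet> z) + (norm \<eta>)\<^sup>2"
    by (simp add: power2_norm_eq_inner inner_diff_left inner_diff_right inner_commute[of \<eta> "T (\<Gamma> z)"] Tz)
  ultimately have "(norm (T (\<Gamma> z) - \<eta>))\<^sup>2 \<le> (norm \<eta>)\<^sup>2" using le by linarith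
  then show ?thesis unfolding z_def by (rule power2_le_imp_le) simp
qed

lemma k_contracts: "norm (fun_op k S (\<Delta> x)) \<le> norm (fun_op k S x)"
proof -
  have "norm (fun_op (\<lambda>t. k t * r t) S x) \<le> norm (fun_op k S x)"
  proof (rule fun_op_norm_mono)
    fix t assume t: "0 < t" "t \<le> c"
    show "\<bar>k t * r t\<bar> \<le> \<bar>k t\<bar>"
      using r(2)[OF t] k(2)[OF t] by (simp add: abs_mult mult_left_le)
  qed (intro k(1) r(1) extends_continuously_mult)+
  then show ?thesis by (simp add: fun_op_mult k(1) r(1))
qed

text \<open>\<open>R\<close> need not commute with the filter; the detour through
  \<open>k(S)\<close>, which does, costs the factor \<open>K\<close>.\<close>

lemma R_residual_le: "norm (R (\<Delta> x)) \<le> K * norm (R x)"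
proof -
  have "norm (R (\<Delta> x)) \<le> K * norm (fun_op k S (\<Delta> x))" by (rule R_le_k)
  also have "\<dots> \<le> K * norm (R x)"
    using K_ge k_contracts[of x] k_le_R[of x] by (intro mult_left_mono) auto
  finally show ?thesis .
qed

text \<open>The case s \<le> p. Tested against \<open>x\<close>, both the noise and the
  approximation error are bounded by a multiple of \<open>norm (R x)\<close>; the range inclusion
  turns this into a preimage \<open>w\<close> under \<open>R\<close>, which is the quantity that
  stays bounded.\<close>

lemma low_order_representation:
  assumes N: "0 < N"
    and approx: "\<And>t. 0 < t \<Longrightarrow> t \<le> c \<Longrightarrow> sqrt t * k t * r t \<le> N"
    and noise: "\<And>t. 0 < t \<Longrightarrow> t \<le> c \<Longrightarrow> M\<^sup>2 * (sqrt t * g t) \<le> k t / N"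
    and \<eta>: "norm \<eta> \<le> \<delta>" and v: "norm v \<le> E"
    and y: "y = \<eta> + T (R v)"
  obtains w where "\<Gamma> (adj_op T y) = R (v + w)" "norm w \<le> K * (\<delta> / (M * N) + E)"
    "norm (T (\<Gamma> (adj_op T y)) - y) \<le> \<delta> + M * K * E * N"
proof -
  let ?q = "\<Gamma> (adj_op T y)"
  have E: "0 \<le> E" using v norm_ge_zero by (rule order_trans[rotated])
  have q: "?q = \<Gamma> (adj_op T \<eta>) + R v - \<Delta> (R v)"
    unfolding y blinfun.add_right filter_normal_op by simp
  \<comment> \<open>For the residual, \<open>R v\<close> is rewritten as \<open>k(S) v'\<close>, so
    that the filter and the smoothness factor lie in one calculus and multiply pointwise.\<close>
  have "\<bar>R v \<bullet> x\<bar> \<le> (K * E) * norm (fun_op k S x)" for x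
  proof -
    have "\<bar>R v \<bullet> x\<bar> = \<bar>v \<bullet> R x\<bar>" using R(1) by (simp add: selfadjoint_op_def)
    also have "\<dots> \<le> norm v * norm (R x)" by (rule Cauchy_Schwarz_ineq2)
    also have "\<dots> \<le> E * (K * norm (fun_op k S x))" by (intro mult_mono v R_le_k E) auto
    finally show ?thesis by (simp add: mult_ac)
  qed
  then obtain v' where v': "R v = fun_op k S v'" "norm v' \<le> K * E"
    using in_range_selfadjoint[OF selfadjoint_fun_op[OF k(1)] inj_fun_op[OF k], of "K * E" "R v"] E K_ge
    by (metis mult_nonneg_nonneg order_trans zero_le_one)
  have ext: "extends_continuously c (\<lambda>t. sqrt t * r t * k t)" "extends_continuously c (\<lambda>t. sqrt t * r t)"
    by (intro extends_continuously_mult extends_sqrt k(1) r(1))+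
  have "norm (Q (\<Delta> (R v))) = norm (fun_op (\<lambda>t. sqrt t * r t * k t) S v')"
    by (simp add: v' fun_op_mult extends_sqrt r(1) k(1) ext)
  also have "\<dots> \<le> N * norm v'"
  proof (rule fun_op_norm_le[OF ext(1)])
    fix t assume t: "0 < t" "t \<le> c"
    then show "\<bar>sqrt t * r t * k t\<bar> \<le> N"
      using approx[OF t] r(2)[OF t] k(2)[OF t] by (simp add: abs_mult mult_ac)
  qed (use N in simp)
  also have "\<dots> \<le> N * (K * E)" using v'(2) N by simp
  finally have Tr: "norm (T (\<Delta> (R v))) \<le> M * K * E * N" using M_pos by (simp add: norm_T mult_ac)
  have Tqy: "T ?q - y = (T (\<Gamma> (adj_op T \<eta>)) - \<eta>) - T (\<Delta> (R v))"
  proof -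
    have "T ?q = T (\<Gamma> (adj_op T \<eta>)) + T (R v) - T (\<Delta> (R v))"
      by (simp only: q blinfun.diff_right blinfun.add_right)
    then show ?thesis using y by simp
  qed
  have res: "norm (T ?q - y) \<le> \<delta> + M * K * E * N"
    unfolding Tqy using norm_triangle_ineq4[of "T (\<Gamma> (adj_op T \<eta>)) - \<eta>" "T (\<Delta> (R v))"]
      noise_residual_le[of \<eta>] \<eta> Tr by linarith
  \<comment> \<open>Dual form of the noise bound. One factor \<open>M\<close> comes from
    \<open>norm_T\<close>, so the \<open>M^2\<close> of the hypothesis leaves
    \<open>1 / (M * N)\<close>.\<close>
  have "norm (T (\<Gamma> x)) \<le> 1 / (M * N) * norm (R x)" for x
  proof -
    have "norm (Q (\<Gamma> x)) \<le> norm (fun_op (\<lambda>t. 1 / (M\<^sup>2 * N) * k t) S x)"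
    proof -
      have "norm (fun_op (\<lambda>t. sqrt t * g t) S x) \<le> norm (fun_op (\<lambda>t. 1 / (M\<^sup>2 * N) * k t) S x)"
      proof (rule fun_op_norm_mono)
        fix t assume t: "0 < t" "t \<le> c"
        show "\<bar>sqrt t * g t\<bar> \<le> \<bar>1 / (M\<^sup>2 * N) * k t\<bar>"
          using noise[OF t] g(2)[OF t] k(2)[OF t] t M_pos N by (simp add: abs_mult field_simps)
      qed (intro extends_continuously_mult extends_continuously_const extends_sqrt g(1) k(1))+
      then show ?thesis by (simp add: fun_op_mult extends_sqrt g(1))
    qed
    also have "\<dots> = 1 / (M\<^sup>2 * N) * norm (fun_op k S x)"
      unfolding fun_op_cmult[OF k(1)] using N M_pos by (simp add: blinfun.scaleR_left)
    also have "\<dots> \<le> 1 / (M\<^sup>2 * N) * norm (R x)" using N by (intro mult_left_mono k_le_R) auto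
    finally have "M * norm (Q (\<Gamma> x)) \<le> M * (1 / (M\<^sup>2 * N) * norm (R x))"
      using M_pos by (intro mult_left_mono) auto
    also have "\<dots> = 1 / (M * N) * norm (R x)" using M_pos by (simp add: power2_eq_square)
    finally show ?thesis by (simp only: norm_T)
  qed
  note noise_R = this
  define W where "W = K * (\<delta> / (M * N) + E)"
  have \<delta>: "0 \<le> \<delta>" using \<eta> norm_ge_zero by (rule order_trans[rotated])
  have W: "0 \<le> W" using E K_ge \<delta> M_pos N by (simp add: W_def)
  \<comment> \<open>The noise term has no factor \<open>K\<close> of its own;
    \<open>K \<ge> 1\<close> lends it one, so that both orders end with the same constant.\<close>
  have W': "\<delta> * (1 / (M * N)) + K * E \<le> W"
    using mult_right_mono[OF K_ge, of "\<delta> / (M * N)"] \<delta> M_pos N by (simp add: W_def distrib_left)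
  have "\<bar>(?q - R v) \<bullet> x\<bar> \<le> W * norm (R x)" for x
  proof -
    have "\<bar>\<Gamma> (adj_op T \<eta>) \<bullet> x\<bar> = \<bar>\<eta> \<bullet> T (\<Gamma> x)\<bar>"
      using selfadjoint_fun_op[OF g(1)] by (metis selfadjoint_op_def adj_op_works inner_commute)
    also have "\<dots> \<le> norm \<eta> * norm (T (\<Gamma> x))" by (rule Cauchy_Schwarz_ineq2)
    also have "\<dots> \<le> \<delta> * (1 / (M * N) * norm (R x))" by (intro mult_mono \<eta> noise_R \<delta>) auto
    finally have 1: "\<bar>\<Gamma> (adj_op T \<eta>) \<bullet> x\<bar> \<le> \<delta> * (1 / (M * N)) * norm (R x)" by simp
    have "\<bar>\<Delta> (R v) \<bullet> x\<bar> = \<bar>v \<bullet> R (\<Delta> x)\<bar>"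
      using selfadjoint_fun_op[OF r(1)] R(1) by (simp add: selfadjoint_op_def)
    also have "\<dots> \<le> norm v * norm (R (\<Delta> x))" by (rule Cauchy_Schwarz_ineq2)
    also have "\<dots> \<le> E * (K * norm (R x))" by (intro mult_mono v R_residual_le E) auto
    finally have 2: "\<bar>\<Delta> (R v) \<bullet> x\<bar> \<le> K * E * norm (R x)" by (simp add: mult_ac)
    have "(?q - R v) \<bullet> x = \<Gamma> (adj_op T \<eta>) \<bullet> x - \<Delta> (R v) \<bullet> x"
      unfolding q by (simp add: inner_diff_left)
    then have "\<bar>(?q - R v) \<bullet> x\<bar> \<le> (\<delta> * (1 / (M * N)) + K * E) * norm (R x)"
      using 1 2 by (simp add: distrib_right)
    also have "\<dots> \<le> W * norm (R x)" using W' by (intro mult_right_mono) auto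
    finally show ?thesis .
  qed
  then obtain w where w: "?q - R v = R w" "norm w \<le> W"
    using in_range_selfadjoint[OF R W, of "?q - R v"] by blast
  then have "?q = R (v + w)" by (simp add: blinfun.add_right algebra_simps)
  then show ?thesis using that w(2) res by (simp add: W_def)
qed

text \<open>The case p \<le> s, where \<open>F\<close> will be \<open>A G^p\<close>. Since
  \<open>v\<close> need not lie in the range of \<open>R\<close>, it is replaced by
  \<open>R u_n\<close> tending to \<open>v\<close>. The estimates involve \<open>u_n\<close> only
  through \<open>R u_n\<close>, hence survive the limit.\<close>

lemma high_order_bound:
  fixes F :: "'x \<Rightarrow>\<^sub>L 'y"
  assumes N: "0 < N"
    and approx: "\<And>t. 0 < t \<Longrightarrow> t \<le> c \<Longrightarrow> sqrt t * r t \<le> N * k t"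
    and noise: "\<And>t. 0 < t \<Longrightarrow> t \<le> c \<Longrightarrow> M\<^sup>2 * (sqrt t * g t * k t) \<le> 1 / N"
    and \<eta>: "norm \<eta> \<le> \<delta>" and v: "norm v \<le> E"
    and TF: "\<And>u. T u = F (R u)"
    and y: "y = \<eta> + F v"
  shows "norm (R (\<Gamma> (adj_op T y)) - v) \<le> K * (\<delta> / (M * N) + E)"
    and "norm (T (\<Gamma> (adj_op T y)) - y) \<le> \<delta> + M * K * E * N"
proof -
  have E: "0 \<le> E" using v norm_ge_zero by (rule order_trans[rotated])
  have \<delta>: "0 \<le> \<delta>" using \<eta> norm_ge_zero by (rule order_trans[rotated])
  obtain u where Ru: "(\<lambda>n. R (u n)) \<longlonglongrightarrow> v"
  proof -
    obtain z where "\<forall>n. z n \<in> range R" "z \<longlonglongrightarrow> v"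
      using dense_range_selfadjoint[OF R] closure_sequential by (metis UNIV_I)
    then have "\<forall>n. \<exists>u. z n = R u" by blast
    then obtain u where "z = (\<lambda>n. R (u n))" by metis
    then show ?thesis using that \<open>z \<longlonglongrightarrow> v\<close> by blast
  qed
  have lim_y: "(\<lambda>n. \<eta> + T (u n)) \<longlonglongrightarrow> y"
    unfolding y TF by (intro tendsto_intros blinfun.tendsto Ru)
  have split: "\<Gamma> (adj_op T (\<eta> + T (u n))) = \<Gamma> (adj_op T \<eta>) + u n - \<Delta> (u n)" for n
    unfolding blinfun.add_right filter_normal_op by simp
  have Tr: "norm (T (\<Delta> x)) \<le> M * N * norm (R x)" for x
  proof -
    have "norm (fun_op (\<lambda>t. sqrt t * r t) S x) \<le> norm (fun_op (\<lambda>t. N * k t) S x)"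
    proof (rule fun_op_norm_mono)
      fix t assume t: "0 < t" "t \<le> c"
      show "\<bar>sqrt t * r t\<bar> \<le> \<bar>N * k t\<bar>"
        using approx[OF t] r(2)[OF t] k(2)[OF t] t N by (simp add: abs_mult)
    qed (intro extends_continuously_mult extends_continuously_const extends_sqrt r(1) k(1))+
    also have "\<dots> \<le> N * norm (R x)"
      unfolding fun_op_cmult[OF k(1)] using N k_le_R[of x] by (simp add: blinfun.scaleR_left)
    finally show ?thesis using M_pos by (simp add: norm_T fun_op_mult extends_sqrt r(1))
  qed
  show "norm (T (\<Gamma> (adj_op T y)) - y) \<le> \<delta> + M * K * E * N"
  proof -
    have "norm (T (\<Gamma> (adj_op T (\<eta> + T (u n)))) - (\<eta> + T (u n))) \<le> \<delta> + M * N * norm (R (u n))" for n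
    proof -
      have eq: "T (\<Gamma> (adj_op T (\<eta> + T (u n)))) - (\<eta> + T (u n)) = (T (\<Gamma> (adj_op T \<eta>)) - \<eta>) - T (\<Delta> (u n))"
        unfolding split by (simp add: blinfun.add_right blinfun.diff_right)
      show ?thesis
        unfolding eq
        using norm_triangle_ineq4[of "T (\<Gamma> (adj_op T \<eta>)) - \<eta>" "T (\<Delta> (u n))"]
          noise_residual_le[of \<eta>] \<eta> Tr[of "u n"] by linarith
    qed
    then have "norm (T (\<Gamma> (adj_op T y)) - y) \<le> \<delta> + M * N * norm v"
      by (intro LIMSEQ_le[where X = "\<lambda>n. norm (T (\<Gamma> (adj_op T (\<eta> + T (u n)))) - (\<eta> + T (u n)))"
            and Y = "\<lambda>n. \<delta> + M * N * norm (R (u n))"]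
          tendsto_intros blinfun.tendsto lim_y Ru) auto
    also have "\<dots> \<le> \<delta> + M * N * E" using v M_pos N by simp
    also have "\<dots> \<le> \<delta> + M * K * E * N"
      using K_ge M_pos N E mult_left_mono[of 1 K "M * E * N"] by (simp add: mult_ac)
    finally show ?thesis .
  qed
  \<comment> \<open>Testing \<open>z\<close> against itself moves \<open>k(S)\<close> and
    \<open>\<Gamma>\<close> to the other side, where they combine with \<open>T\<close> into the
    scalar function \<open>sqrt t * g t * k t\<close>.\<close>
  have k_noise: "norm (fun_op k S (\<Gamma> (adj_op T \<eta>))) \<le> 1 / (M * N) * \<delta>"
  proof -
    define z where "z = fun_op k S (\<Gamma> (adj_op T \<eta>))"
    have "norm z * norm z = z \<bullet> z" by (simp flip: power2_norm_eq_inner power2_eq_square)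
    also have "\<dots> = fun_op k S (\<Gamma> (adj_op T \<eta>)) \<bullet> z" by (simp add: z_def)
    also have "\<dots> = \<Gamma> (adj_op T \<eta>) \<bullet> fun_op k S z"
      using selfadjoint_fun_op[OF k(1)] by (simp add: selfadjoint_op_def)
    also have "\<dots> = adj_op T \<eta> \<bullet> \<Gamma> (fun_op k S z)"
      using selfadjoint_fun_op[OF g(1)] by (simp add: selfadjoint_op_def)
    also have "\<dots> = T (\<Gamma> (fun_op k S z)) \<bullet> \<eta>" by (metis adj_op_works inner_commute)
    also have "\<dots> \<le> norm (T (\<Gamma> (fun_op k S z))) * norm \<eta>" by (rule norm_cauchy_schwarz)
    also have "norm (T (\<Gamma> (fun_op k S z))) \<le> M * (1 / (M\<^sup>2 * N) * norm z)"
    proof -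
      have "norm (fun_op (\<lambda>t. sqrt t * g t * k t) S z) \<le> 1 / (M\<^sup>2 * N) * norm z"
      proof (rule fun_op_norm_le)
        fix t assume t: "0 < t" "t \<le> c"
        show "\<bar>sqrt t * g t * k t\<bar> \<le> 1 / (M\<^sup>2 * N)"
          using noise[OF t] g(2)[OF t] k(2)[OF t] t M_pos N by (simp add: abs_mult field_simps)
      next
        show "extends_continuously c (\<lambda>t. sqrt t * g t * k t)"
          by (intro extends_continuously_mult extends_sqrt g(1) k(1))
      qed (use N in simp)
      then have "norm (Q (\<Gamma> (fun_op k S z))) \<le> 1 / (M\<^sup>2 * N) * norm z"
        by (simp add: fun_op_mult extends_sqrt g(1) k(1) extends_continuously_mult)
      then show ?thesis unfolding norm_T using M_pos by (intro mult_left_mono) auto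
    qed
    also have "M * (1 / (M\<^sup>2 * N) * norm z) = 1 / (M * N) * norm z"
      using M_pos by (simp add: power2_eq_square)
    finally have "norm z * norm z \<le> 1 / (M * N) * norm z * norm \<eta>"
      by (simp add: mult_right_mono)
    also have "\<dots> \<le> 1 / (M * N) * norm z * \<delta>" using \<eta> M_pos N by (intro mult_left_mono) auto
    finally have "norm z * norm z \<le> norm z * (1 / (M * N) * \<delta>)" by (simp add: mult_ac)
    moreover have "0 \<le> 1 / (M * N) * \<delta>" using M_pos N \<delta> by simp
    ultimately have "norm z \<le> 1 / (M * N) * \<delta>"
      using mult_le_cancel_left_pos[of "norm z" "norm z" "1 / (M * N) * \<delta>"]
      by (cases "norm z = 0") auto
    then show ?thesis by (simp add: z_def)
  qed
  have "norm (R (\<Gamma> (adj_op T (\<eta> + T (u n)))) - R (u n)) \<le> K * (1 / (M * N) * \<delta>) + K * norm (R (u n))" for n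
  proof -
    have "R (\<Gamma> (adj_op T (\<eta> + T (u n)))) - R (u n) = R (\<Gamma> (adj_op T \<eta>)) - R (\<Delta> (u n))"
      unfolding split by (simp add: blinfun.add_right blinfun.diff_right)
    also have "norm \<dots> \<le> norm (R (\<Gamma> (adj_op T \<eta>))) + norm (R (\<Delta> (u n)))" by (rule norm_triangle_ineq4)
    also have "norm (R (\<Gamma> (adj_op T \<eta>))) \<le> K * (1 / (M * N) * \<delta>)"
      using R_le_k[of "\<Gamma> (adj_op T \<eta>)"] mult_left_mono[OF k_noise, of K] K_ge by linarith
    also have "norm (R (\<Delta> (u n))) \<le> K * norm (R (u n))" by (rule R_residual_le)
    finally show ?thesis by simp
  qed
  then have "norm (R (\<Gamma> (adj_op T y)) - v) \<le> K * (1 / (M * N) * \<delta>) + K * norm v"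
    by (intro LIMSEQ_le[where X = "\<lambda>n. norm (R (\<Gamma> (adj_op T (\<eta> + T (u n)))) - R (u n))"
          and Y = "\<lambda>n. K * (1 / (M * N) * \<delta>) + K * norm (R (u n))"]
        tendsto_intros blinfun.tendsto lim_y Ru) auto
  also have "\<dots> \<le> K * (1 / (M * N) * \<delta>) + K * E"
    using mult_left_mono[OF v, of K] K_ge by simp
  finally show "norm (R (\<Gamma> (adj_op T y)) - v) \<le> K * (\<delta> / (M * N) + E)"
    by (simp add: distrib_left)
qed

end

section \<open>The operator generating the scale and its link to \<open>A\<close>\<close>

lemma positive_op_inverse_generator:
  fixes G :: "'x::{real_inner,banach} \<Rightarrow>\<^sub>L 'x"
  assumes B: "densely_defined_selfadjoint D B" "strictly_positive_on D B"
    and G: "inverse_of_on G D B" and nontriv: "\<exists>x::'x. x \<noteq> 0"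
  shows "positive_op G (norm G)"
proof
  have GD: "G x \<in> D" and BG: "B (G x) = x" for x using G by (auto simp: inverse_of_on_def)
  have sym: "B x \<bullet> y = x \<bullet> B y" if "x \<in> D" "y \<in> D" for x y
    using B(1) that unfolding densely_defined_selfadjoint_def by blast
  show "selfadjoint_op G" unfolding selfadjoint_op_def using sym[OF GD GD] BG by metis
  show inj: "inj G" using BG by (metis injI)
  show "0 < norm G"
  proof -
    obtain x :: 'x where "x \<noteq> 0" using nontriv by blast
    then have "G \<noteq> 0" using inj by (metis blinfun.zero_left blinfun.zero_right injD)
    then show ?thesis by simp
  qed
  obtain e where e: "0 < e" "\<And>x. x \<in> D \<Longrightarrow> e * (norm x)\<^sup>2 \<le> B x \<bullet> x"
    using B(2) by (auto simp: strictly_positive_on_def)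
  show "0 \<le> G x \<bullet> x" for x
  proof -
    have "0 \<le> e * (norm (G x))\<^sup>2" using e(1) by simp
    also have "\<dots> \<le> x \<bullet> G x" using e(2)[OF GD, of x] by (simp add: BG)
    finally show ?thesis by (simp add: inner_commute)
  qed
  show "G x \<bullet> x \<le> norm G * (norm x)\<^sup>2" for x
  proof -
    have "G x \<bullet> x \<le> norm (G x) * norm x" by (rule norm_cauchy_schwarz)
    also have "\<dots> \<le> (norm G * norm x) * norm x" by (intro mult_right_mono norm_blinfun) auto
    finally show ?thesis by (simp add: power2_eq_square)
  qed
qed

lemma blinfun_eq_on_dense:
  fixes T T' :: "'x::real_normed_vector \<Rightarrow>\<^sub>L 'y::real_normed_vector"
  assumes V: "closure V = UNIV" and eq: "\<And>x. x \<in> V \<Longrightarrow> T x = T' x"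
  shows "T = T'"
proof (rule blinfun_eqI)
  fix z
  obtain x where x: "\<forall>n. x n \<in> V" "x \<longlonglongrightarrow> z"
    using V closure_sequential by (metis UNIV_I)
  have "(\<lambda>n. T (x n)) \<longlonglongrightarrow> T z" "(\<lambda>n. T' (x n)) \<longlonglongrightarrow> T' z"
    by (intro tendsto_intros blinfun.tendsto x(2))+
  then show "T z = T' z" using eq x(1) LIMSEQ_unique by simp
qed

lemma le_on_dense:
  fixes f g :: "'x::real_normed_vector \<Rightarrow> real"
  assumes V: "closure V = UNIV" and le: "\<And>x. x \<in> V \<Longrightarrow> f x \<le> g x"
    and cont: "continuous_on UNIV f" "continuous_on UNIV g"
  shows "f z \<le> g z"
proof -
  have "closed {x. f x \<le> g x}" using cont by (rule closed_Collect_le)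
  moreover have "V \<subseteq> {x. f x \<le> g x}" using le by blast
  ultimately have "closure V \<subseteq> {x. f x \<le> g x}" by (rule closure_minimal[rotated])
  then show ?thesis using V by blast
qed

locale linked_scale = positive_op G a
  for G :: "'x::{real_inner,banach} \<Rightarrow>\<^sub>L 'x" and a :: real +
  fixes A :: "'x \<Rightarrow>\<^sub>L 'y::{real_inner,banach}" and \<rho> :: "real \<Rightarrow> real" and s m M :: real
  assumes \<rho>: "index_function a (\<rho> a) \<rho>"
    and \<psi>: "index_function a (psi \<rho> s a) (psi \<rho> s)"
    and m_pos: "0 < m" and m_le_M: "m \<le> M"
    and link: "\<And>x. m * norm (fun_op \<rho> G x) \<le> norm (A x)"
              "\<And>x. norm (A x) \<le> M * norm (fun_op \<rho> G x)"
begin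

abbreviation Gpow where "Gpow r \<equiv> fun_op (\<lambda>l. l powr r) G"
abbreviation \<Psi> where "\<Psi> \<equiv> fun_op (psi \<rho> s) G"
abbreviation T where "T \<equiv> scale_T A G s"
text \<open>Division by \<open>M^2\<close> gives \<open>S \<le> psi_s(G)^2 \<le> c\<close>, so that
  functions on \<open>(0,c]\<close>, such as \<open>h\<close>, apply to \<open>S\<close>.\<close>

abbreviation S where "S \<equiv> (1 / M\<^sup>2) *\<^sub>R (adj_op T o\<^sub>L T)"
abbreviation c where "c \<equiv> (psi \<rho> s a)\<^sup>2"

lemma M_pos: "0 < M"
  using m_pos m_le_M by simp

section \<open>Powers of \<open>G\<close> and the functions of the scale\<close>

lemma extends_powr: "0 \<le> r \<Longrightarrow> extends_continuously a (\<lambda>l. l powr r)"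
  by (rule extends_continuously_powr[OF extends_continuously_id c_pos]) auto

lemma extends_\<rho>: "extends_continuously a \<rho>"
  using index_function_extends_continuously[OF \<rho> c_pos] .

lemma extends_\<psi>: "extends_continuously a (psi \<rho> s)"
  using index_function_extends_continuously[OF \<psi> c_pos] .

lemma \<psi>_bounds: "0 < l \<Longrightarrow> l \<le> a \<Longrightarrow> 0 < psi \<rho> s l \<and> psi \<rho> s l \<le> psi \<rho> s a"
  using index_function_image[OF \<psi> c_pos] by auto

lemma \<psi>_a_pos: "0 < psi \<rho> s a"
  using \<psi>_bounds[of a] c_pos by simp

lemma inj_Gpow: "0 \<le> r \<Longrightarrow> inj (Gpow r)"
  by (rule inj_fun_op[OF extends_powr]) auto

lemma selfadjoint_Gpow: "0 \<le> r \<Longrightarrow> selfadjoint_op (Gpow r)"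
  by (rule selfadjoint_fun_op[OF extends_powr])

lemma Gpow_add:
  assumes "0 \<le> r" "0 \<le> q"
  shows "Gpow r (Gpow q x) = Gpow (r + q) x"
proof -
  have "fun_op (\<lambda>l. l powr r * l powr q) G = Gpow (r + q)"
  proof (rule fun_op_cong)
    show "extends_continuously a (\<lambda>l. l powr r * l powr q)"
      by (intro extends_continuously_mult extends_powr assms)
  qed (simp add: powr_add)
  then have "Gpow r o\<^sub>L Gpow q = Gpow (r + q)" using assms by (simp add: fun_op_mult extends_powr)
  then show ?thesis by (metis blinfun_apply_blinfun_compose)
qed

lemma power_op_nonneg: "0 \<le> r \<Longrightarrow> power_op G r x = Gpow r x"
  by (simp add: power_op_def)

lemma power_op_Gpow_neg: "r < 0 \<Longrightarrow> power_op G r (Gpow (- r) x) = x"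
  by (simp add: power_op_def the_inv_f_f[OF inj_Gpow])

section \<open>The operator \<open>T\<close> for \<open>s\<close> of either sign\<close>

lemma scale_T_nonneg:
  assumes "0 \<le> s"
  shows "T = A o\<^sub>L Gpow s"
  unfolding scale_T_def
  by (rule the_equality) (auto simp: power_dom_def power_op_def assms intro!: blinfun_eqI)

lemma \<rho>_Gpow_nonneg: "0 \<le> s \<Longrightarrow> fun_op \<rho> G (Gpow s x) = \<Psi> x"
  using fun_op_mult[OF extends_\<rho> extends_powr, of s]
    fun_op_cong[OF extends_\<psi>, of "\<lambda>l. \<rho> l * l powr s"]
  by (simp add: psi_def mult.commute)

lemma \<Psi>_Gpow_neg:
  assumes "s < 0"
  shows "\<Psi> (Gpow (- s) x) = fun_op \<rho> G x"
proof -
  have "fun_op \<rho> G = fun_op (\<lambda>l. psi \<rho> s l * l powr (- s)) G"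
    by (rule fun_op_cong[OF extends_\<rho>]) (simp add: psi_def powr_minus)
  also have "\<dots> = \<Psi> o\<^sub>L Gpow (- s)" using assms by (intro fun_op_mult extends_\<psi> extends_powr) simp
  finally show ?thesis by simp
qed

lemma dense_Gpow: "0 \<le> r \<Longrightarrow> closure (range (Gpow r)) = UNIV"
  by (intro dense_range_selfadjoint selfadjoint_Gpow inj_Gpow)

text \<open>The upper link condition reads
  \<open>norm (A x) \<le> M * norm (\<Psi> (G^(-s) x))\<close>, so \<open>A G^s\<close> is bounded
  on its dense domain, the range of \<open>G^(-s)\<close>. This gives existence of the extension,
  and density gives uniqueness.\<close>

lemma scale_T_neg:
  assumes s: "s < 0"
  shows "T (Gpow (- s) x) = A x"
proof -
  have dense: "closure (range (Gpow (- s))) = UNIV" using s by (intro dense_Gpow) simp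
  have bd: "norm (A x) \<le> (M * norm \<Psi>) * norm (Gpow (- s) x)" for x
  proof -
    have "norm (A x) \<le> M * norm (\<Psi> (Gpow (- s) x))" using link(2)[of x] by (simp add: \<Psi>_Gpow_neg[OF s])
    also have "\<dots> \<le> M * (norm \<Psi> * norm (Gpow (- s) x))"
      using M_pos by (intro mult_left_mono norm_blinfun) auto
    finally show ?thesis by (simp add: mult.assoc)
  qed
  obtain T' where T': "\<And>x. blinfun_apply T' (Gpow (- s) x) = A x"
    using extend_along_dense[OF dense bd] by blast
  have "T = T'"
    unfolding scale_T_def
  proof (rule the_equality)
    show "\<forall>u\<in>power_dom G s. T' u = A (power_op G s u)"
      using s by (auto simp: power_dom_def T' power_op_Gpow_neg)
    fix T'' :: "'x \<Rightarrow>\<^sub>L 'y" assume "\<forall>u\<in>power_dom G s. T'' u = A (power_op G s u)"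
    then have "T'' (Gpow (- s) x) = A x" for x
      using s by (auto simp: power_dom_def power_op_Gpow_neg)
    then show "T'' = T'" by (intro blinfun_eq_on_dense[OF dense]) (auto simp: T')
  qed
  then show ?thesis by (simp add: T')
qed

lemma T_bounds: "m * norm (\<Psi> u) \<le> norm (T u)" "norm (T u) \<le> M * norm (\<Psi> u)"
proof -
  have "m * norm (\<Psi> u) \<le> norm (T u) \<and> norm (T u) \<le> M * norm (\<Psi> u)"
  proof (cases "0 \<le> s")
    case True
    then show ?thesis using link[of "Gpow s u"] by (simp add: scale_T_nonneg \<rho>_Gpow_nonneg)
  next
    case False
    then have dense: "closure (range (Gpow (- s))) = UNIV" by (intro dense_Gpow) simp
    have on_range: "m * norm (\<Psi> u) \<le> norm (T u) \<and> norm (T u) \<le> M * norm (\<Psi> u)"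
      if "u \<in> range (Gpow (- s))" for u
      using that link False by (auto simp: scale_T_neg \<Psi>_Gpow_neg)
    have "m * norm (\<Psi> u) \<le> norm (T u)"
      using on_range by (rule le_on_dense[OF dense, OF conjunct1]) (assumption | intro continuous_intros)+
    moreover have "norm (T u) \<le> M * norm (\<Psi> u)"
      using on_range by (rule le_on_dense[OF dense, OF conjunct2]) (assumption | intro continuous_intros)+
    ultimately show ?thesis ..
  qed
  then show "m * norm (\<Psi> u) \<le> norm (T u)" "norm (T u) \<le> M * norm (\<Psi> u)" by auto
qed

text \<open>For negative \<open>s\<close> the point is that
  \<open>G^(p - s) v = G^(-s) (G^p v)\<close> lies in the domain of \<open>G^s\<close>.\<close>

lemma T_Gpow:
  assumes p: "0 \<le> p"
  shows "s \<le> p \<Longrightarrow> T (Gpow (p - s) v) = A (Gpow p v)"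
    and "p \<le> s \<Longrightarrow> T u = A (Gpow p (Gpow (s - p) u))"
    and "s \<le> p \<Longrightarrow> power_op G s (Gpow (p - s) v) = Gpow p v"
    and "p \<le> s \<Longrightarrow> power_op G s u = Gpow p (Gpow (s - p) u)"
proof -
  assume sp: "s \<le> p"
  show "T (Gpow (p - s) v) = A (Gpow p v)"
  proof (cases "0 \<le> s")
    case True
    then show ?thesis using sp by (simp add: scale_T_nonneg Gpow_add)
  next
    case False
    then have "Gpow (p - s) v = Gpow (- s) (Gpow p v)" using p by (simp add: Gpow_add)
    then show ?thesis using False by (simp only: scale_T_neg not_le)
  qed
  show "power_op G s (Gpow (p - s) v) = Gpow p v"
  proof (cases "0 \<le> s")
    case True
    then show ?thesis using sp by (simp add: power_op_nonneg Gpow_add)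
  next
    case False
    then have "Gpow (p - s) v = Gpow (- s) (Gpow p v)" using p by (simp add: Gpow_add)
    then show ?thesis using False by (simp only: power_op_Gpow_neg not_le)
  qed
next
  assume "p \<le> s"
  then show "T u = A (Gpow p (Gpow (s - p) u))" "power_op G s u = Gpow p (Gpow (s - p) u)"
    using p by (simp_all add: scale_T_nonneg power_op_nonneg Gpow_add)
qed

section \<open>Comparison of \<open>S\<close> with functions of \<open>G\<close>\<close>

lemma S_form: "S x \<bullet> x = (norm (T x))\<^sup>2 / M\<^sup>2"
proof -
  have "adj_op T (T x) \<bullet> x = (norm (T x))\<^sup>2"
    by (metis adj_op_works inner_commute power2_norm_eq_inner)
  then show ?thesis by (simp add: blinfun.scaleR_left)
qed

lemma \<Psi>_form: "fun_op (\<lambda>l. (psi \<rho> s l)\<^sup>2) G x \<bullet> x = (norm (\<Psi> x))\<^sup>2"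
  by (rule fun_op_square_form[OF extends_\<psi>])

lemma S_form_bounds:
  "(m / M)\<^sup>2 * (norm (\<Psi> x))\<^sup>2 \<le> S x \<bullet> x" "S x \<bullet> x \<le> (norm (\<Psi> x))\<^sup>2"
proof -
  have "(m * norm (\<Psi> x))\<^sup>2 \<le> (norm (T x))\<^sup>2" "(norm (T x))\<^sup>2 \<le> (M * norm (\<Psi> x))\<^sup>2"
    using T_bounds[of x] m_pos by (intro power_mono; simp)+
  then show "(m / M)\<^sup>2 * (norm (\<Psi> x))\<^sup>2 \<le> S x \<bullet> x" "S x \<bullet> x \<le> (norm (\<Psi> x))\<^sup>2"
    unfolding S_form using M_pos by (simp_all add: field_simps)
qed

lemma \<Psi>_square_bounds: "0 < l \<Longrightarrow> l \<le> a \<Longrightarrow> 0 < (psi \<rho> s l)\<^sup>2 \<and> (psi \<rho> s l)\<^sup>2 \<le> c"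
  using \<psi>_bounds[of l] by (auto intro: power_mono)

lemma positive_S: "positive_op S c"
proof
  show "selfadjoint_op S"
    unfolding selfadjoint_op_def
    by (simp add: blinfun.scaleR_left) (metis adj_op_works inner_commute)
  show "inj S"
  proof (rule injI)
    fix x y assume "S x = S y"
    then have "S (x - y) = 0" by (simp add: blinfun.diff_right)
    then have "(m / M)\<^sup>2 * (norm (\<Psi> (x - y)))\<^sup>2 \<le> 0" using S_form_bounds(1)[of "x - y"] by simp
    then have "\<Psi> (x - y) = \<Psi> 0"
      using m_pos M_pos by (simp add: mult_le_0_iff blinfun.zero_right)
    then have "x - y = 0" using inj_fun_op[OF extends_\<psi>] \<psi>_bounds by (meson injD)
    then show "x = y" by simp
  qed
  show "0 < c" using \<psi>_a_pos by simp
  show "0 \<le> S x \<bullet> x" for x unfolding S_form by simp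
  show "S x \<bullet> x \<le> c * (norm x)\<^sup>2" for x
  proof -
    have "norm (\<Psi> x) \<le> psi \<rho> s a * norm x"
      by (rule fun_op_norm_le[OF extends_\<psi>]) (use \<psi>_bounds \<psi>_a_pos in \<open>auto simp: abs_of_pos\<close>)
    then have "(norm (\<Psi> x))\<^sup>2 \<le> (psi \<rho> s a * norm x)\<^sup>2" by (intro power_mono) auto
    then show ?thesis using S_form_bounds(2)[of x] by (simp add: power_mult_distrib)
  qed
qed

text \<open>One family for both orders: \<open>h\<close> is \<open>kfun (p - s)\<close> and
  \<open>w\<close> is \<open>kfun (s - p)\<close>. The exponent \<open>\<bar>p - s\<bar>\<close>
  selects the one that stays bounded near 0.\<close>

definition kfun :: "real \<Rightarrow> real \<Rightarrow> real" where
  "kfun r t = psi_inv a \<rho> s (sqrt t) powr r"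

lemma psi_inv_sqrt:
  assumes "0 < t" "t \<le> c"
  shows "0 < psi_inv a \<rho> s (sqrt t)" "psi_inv a \<rho> s (sqrt t) \<le> a"
    "psi \<rho> s (psi_inv a \<rho> s (sqrt t)) = sqrt t"
proof -
  have "sqrt t \<le> psi \<rho> s a" using assms \<psi>_a_pos by (simp add: real_le_lsqrt)
  then show "0 < psi_inv a \<rho> s (sqrt t)" "psi_inv a \<rho> s (sqrt t) \<le> a"
    "psi \<rho> s (psi_inv a \<rho> s (sqrt t)) = sqrt t"
    unfolding psi_inv_def using index_function_inverse[OF \<psi> c_pos, of "sqrt t"] assms by auto
qed

lemma kfun_pos: "0 < t \<Longrightarrow> t \<le> c \<Longrightarrow> 0 < kfun r t"
  using psi_inv_sqrt[of t] by (simp add: kfun_def)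

lemma extends_kfun:
  assumes r: "0 \<le> r"
  shows "extends_continuously c (kfun r)"
proof -
  have c: "0 < c" using \<psi>_a_pos by simp
  have sq: "extends_continuously c sqrt"
    by (rule extends_continuouslyI[of _ sqrt]) (auto intro: continuous_intros)
  have "extends_continuously c (\<lambda>t. the_inv_into {0<..a} (psi \<rho> s) (sqrt t))"
    by (rule extends_continuously_compose[OF index_function_inverse_extends[OF \<psi> c_pos] sq c])
       (use \<psi>_a_pos in \<open>auto simp: real_le_lsqrt\<close>)
  then have "extends_continuously c (\<lambda>t. psi_inv a \<rho> s (sqrt t) powr r)"
    unfolding psi_inv_def[symmetric]
    by (rule extends_continuously_powr[OF _ c r]) (use psi_inv_sqrt in auto)
  then show ?thesis by (simp add: kfun_def[abs_def])
qed

lemma kfun_psi: "0 < l \<Longrightarrow> l \<le> a \<Longrightarrow> kfun r ((psi \<rho> s l)\<^sup>2) = l powr r"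
  using \<psi>_bounds[of l] the_inv_into_f_f[OF index_function_inj_on[OF \<psi>], of l]
  by (simp add: kfun_def psi_inv_def)

text \<open>The square in the monotonicity assumption is what produces norms: the form of
  \<open>k^2(S)\<close> at \<open>x\<close> is \<open>(norm (k(S) x))^2\<close>. The number
  \<open>\<kappa>\<close> measures what \<open>k\<close> loses when its argument is multiplied by
  \<open>(m / M)^2\<close>.\<close>

lemma kfun_comparison:
  assumes r: "0 \<le> r" and mono: "operator_monotone TYPE('x) c (\<lambda>t. (kfun r t)\<^sup>2)"
    and \<kappa>: "0 < \<kappa>" "\<And>t. 0 < t \<Longrightarrow> t \<le> c \<Longrightarrow> \<kappa> * kfun r t \<le> kfun r ((m / M)\<^sup>2 * t)"
  shows "norm (fun_op (kfun r) S x) \<le> norm (Gpow r x)"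
    and "norm (Gpow r x) \<le> 1 / \<kappa> * norm (fun_op (kfun r) S x)"
proof -
  interpret S: positive_op S c by (rule positive_S)
  have k2: "extends_continuously c (\<lambda>t. (kfun r t)\<^sup>2)"
    by (intro extends_continuously_power extends_kfun r)
  have \<psi>2: "extends_continuously a (\<lambda>l. (psi \<rho> s l)\<^sup>2)"
    by (intro extends_continuously_power extends_\<psi>)
  have kk: "fun_op (\<lambda>t. (kfun r t)\<^sup>2) S x \<bullet> x = (norm (fun_op (kfun r) S x))\<^sup>2"
    by (rule S.fun_op_square_form[OF extends_kfun[OF r]])
  have RR: "fun_op (\<lambda>l. (l powr r)\<^sup>2) G x \<bullet> x = (norm (Gpow r x))\<^sup>2"
    by (rule fun_op_square_form[OF extends_powr[OF r]])
  let ?H = "fun_op (\<lambda>l. (psi \<rho> s l)\<^sup>2) G"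
  let ?H' = "fun_op (\<lambda>l. (m / M)\<^sup>2 * (psi \<rho> s l)\<^sup>2) G"
  have mM: "0 < (m / M)\<^sup>2" "(m / M)\<^sup>2 \<le> 1"
    using m_pos m_le_M M_pos by (auto simp: power_le_one)
  have H'_bounds: "0 < (m / M)\<^sup>2 * (psi \<rho> s l)\<^sup>2 \<and> (m / M)\<^sup>2 * (psi \<rho> s l)\<^sup>2 \<le> c"
    if l: "0 < l" "l \<le> a" for l
    using \<Psi>_square_bounds[OF l] mM mult_mono[of "(m / M)\<^sup>2" 1 "(psi \<rho> s l)\<^sup>2" c] by auto
  have H: "positive_op ?H c" by (rule positive_fun_op[OF \<psi>2 \<Psi>_square_bounds])
  have H': "positive_op ?H' c" by (rule positive_fun_op[OF extends_continuously_cmult[OF \<psi>2] H'_bounds])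
  have "fun_op (\<lambda>t. (kfun r t)\<^sup>2) S x \<bullet> x \<le> fun_op (\<lambda>t. (kfun r t)\<^sup>2) ?H x \<bullet> x"
    by (rule operator_monotone_form_le[OF positive_S H _ mono k2]) (simp only: \<Psi>_form S_form_bounds)
  also have "fun_op (\<lambda>t. (kfun r t)\<^sup>2) ?H = fun_op (\<lambda>l. (kfun r ((psi \<rho> s l)\<^sup>2))\<^sup>2) G"
    by (rule fun_op_fun_op[OF k2 \<psi>2 \<Psi>_square_bounds])
  also have "\<dots> = fun_op (\<lambda>l. (l powr r)\<^sup>2) G"
    by (rule fun_op_cong[symmetric]) (simp_all add: kfun_psi extends_continuously_power extends_powr r)
  finally have "(norm (fun_op (kfun r) S x))\<^sup>2 \<le> (norm (Gpow r x))\<^sup>2" by (simp only: kk RR)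
  then show "norm (fun_op (kfun r) S x) \<le> norm (Gpow r x)" by (rule power2_le_imp_le) simp
  have r2: "extends_continuously a (\<lambda>l. (l powr r)\<^sup>2)"
    by (intro extends_continuously_power extends_powr r)
  have "fun_op (\<lambda>l. \<kappa>\<^sup>2 * (l powr r)\<^sup>2) G x \<bullet> x
      \<le> fun_op (\<lambda>l. (kfun r ((m / M)\<^sup>2 * (psi \<rho> s l)\<^sup>2))\<^sup>2) G x \<bullet> x"
  proof (rule fun_op_form_mono)
    show "extends_continuously a (\<lambda>l. (kfun r ((m / M)\<^sup>2 * (psi \<rho> s l)\<^sup>2))\<^sup>2)"
      by (rule extends_continuously_compose[OF k2 extends_continuously_cmult[OF \<psi>2] c_pos H'_bounds])
    fix l assume l: "0 < l" "l \<le> a"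
    have "\<kappa> * l powr r \<le> kfun r ((m / M)\<^sup>2 * (psi \<rho> s l)\<^sup>2)"
      using \<kappa>(2)[of "(psi \<rho> s l)\<^sup>2"] \<Psi>_square_bounds[OF l] by (simp add: kfun_psi l)
    then have "(\<kappa> * l powr r)\<^sup>2 \<le> (kfun r ((m / M)\<^sup>2 * (psi \<rho> s l)\<^sup>2))\<^sup>2"
      using \<kappa>(1) by (intro power_mono) auto
    then show "\<kappa>\<^sup>2 * (l powr r)\<^sup>2 \<le> (kfun r ((m / M)\<^sup>2 * (psi \<rho> s l)\<^sup>2))\<^sup>2"
      by (simp add: power_mult_distrib)
  qed (intro extends_continuously_cmult r2)
  also have "\<dots> = fun_op (\<lambda>t. (kfun r t)\<^sup>2) ?H' x \<bullet> x"
    using fun_op_fun_op[OF k2 extends_continuously_cmult[OF \<psi>2] H'_bounds] by simp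
  also have "\<dots> \<le> fun_op (\<lambda>t. (kfun r t)\<^sup>2) S x \<bullet> x"
  proof (rule operator_monotone_form_le[OF H' positive_S _ mono k2])
    fix z
    have "?H' z \<bullet> z = (m / M)\<^sup>2 * (norm (\<Psi> z))\<^sup>2"
      by (simp only: fun_op_cmult[OF \<psi>2] blinfun.scaleR_left inner_scaleR_left \<Psi>_form)
    then show "?H' z \<bullet> z \<le> S z \<bullet> z" using S_form_bounds(1)[of z] by (simp only:)
  qed
  finally have "(\<kappa> * norm (Gpow r x))\<^sup>2 \<le> (norm (fun_op (kfun r) S x))\<^sup>2"
    by (simp only: fun_op_cmult[OF r2] blinfun.scaleR_left inner_scaleR_left RR kk power_mult_distrib)
  then have "\<kappa> * norm (Gpow r x) \<le> norm (fun_op (kfun r) S x)" by (rule power2_le_imp_le) simp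
  then show "norm (Gpow r x) \<le> 1 / \<kappa> * norm (fun_op (kfun r) S x)"
    using \<kappa>(1) by (simp add: field_simps)
qed

end

section \<open>The discrepancy principle\<close>

context linked_scale
begin

section \<open>Monotonicity and scaling of \<open>h\<close> and \<open>w\<close>\<close>

lemma index_psi: "0 < p \<Longrightarrow> index_function a (psi \<rho> p a) (psi \<rho> p)"
  by (rule index_function_psi[OF \<rho> c_pos])

text \<open>At the preimage \<open>l\<close> of \<open>sqrt t\<close>, the factors
  \<open>l^s \<rho>(l)\<close> and \<open>l^(p - s)\<close> multiply to
  \<open>l^p \<rho>(l)\<close>. This is where \<open>psi_p\<close> enters: it makes
  \<open>sqrt t * h t\<close> increasing and bounds its value \<open>N\<close> at the
  cut-off.\<close>

lemma sqrt_kfun: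
  assumes "0 < t" "t \<le> c"
  shows "sqrt t * kfun (p - s) t = psi \<rho> p (psi_inv a \<rho> s (sqrt t))"
proof -
  let ?l = "psi_inv a \<rho> s (sqrt t)"
  have "sqrt t * kfun (p - s) t = (?l powr s * ?l powr (p - s)) * \<rho> ?l"
    using psi_inv_sqrt(3)[OF assms] by (simp add: kfun_def psi_def mult_ac)
  then show ?thesis by (simp add: psi_def flip: powr_add)
qed

lemma psi_inv_sqrt_mono:
  assumes "0 < t" "t \<le> u" "u \<le> c"
  shows "psi_inv a \<rho> s (sqrt t) \<le> psi_inv a \<rho> s (sqrt u)"
  using assms psi_inv_sqrt[of t] psi_inv_sqrt[of u]
    index_function_less_iff(2)[OF \<psi>, of "psi_inv a \<rho> s (sqrt t)" "psi_inv a \<rho> s (sqrt u)"] by simp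

lemma sqrt_kfun_mono:
  assumes p: "0 < p" and t: "0 < t" "t \<le> u" "u \<le> c"
  shows "sqrt t * kfun (p - s) t \<le> sqrt u * kfun (p - s) u"
  using t psi_inv_sqrt_mono[OF t] psi_inv_sqrt[of t] psi_inv_sqrt[of u]
    index_function_less_iff(2)[OF index_psi[OF p], of "psi_inv a \<rho> s (sqrt t)" "psi_inv a \<rho> s (sqrt u)"]
  by (simp add: sqrt_kfun)

text \<open>The quotient is compared at \<open>\<kappa>^2 * t\<close> and \<open>t\<close>; the
  square root turns \<open>\<kappa>^2\<close> into \<open>\<kappa>\<close>.\<close>

lemma kfun_scaled_low:
  assumes decr: "antimono_on {0<..c} (\<lambda>t. kfun r t / sqrt t)" and t: "0 < t" "t \<le> c"
    and \<kappa>: "0 < \<kappa>" "\<kappa> \<le> 1"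
  shows "\<kappa> * kfun r t \<le> kfun r (\<kappa>\<^sup>2 * t)"
proof -
  have "\<kappa>\<^sup>2 * t \<le> t" using t \<kappa> by (simp add: power_le_one mult_left_le_one_le)
  then have "kfun r t / sqrt t \<le> kfun r (\<kappa>\<^sup>2 * t) / sqrt (\<kappa>\<^sup>2 * t)"
    using t \<kappa> order_trans[OF \<open>\<kappa>\<^sup>2 * t \<le> t\<close> t(2)] by (intro monotone_onD[OF decr]) auto
  then show ?thesis using t \<kappa> by (simp add: real_sqrt_mult field_simps)
qed

text \<open>As \<open>\<rho>\<close> increases,
  \<open>psi_s(\<kappa>^(1/s) l) \<le> \<kappa> psi_s(l)\<close>, so multiplying its argument by
  \<open>\<kappa>\<close> shrinks the inverse of \<open>psi_s\<close> by at most
  \<open>\<kappa>^(1/s)\<close>.\<close>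

lemma kfun_scaled_high:
  assumes s: "0 < s" and r: "0 \<le> r" and t: "0 < t" "t \<le> c" and \<kappa>: "0 < \<kappa>" "\<kappa> \<le> 1"
  shows "\<kappa> powr (r / s) * kfun r t \<le> kfun r (\<kappa>\<^sup>2 * t)"
proof -
  define l where "l = psi_inv a \<rho> s (sqrt t)"
  define l' where "l' = psi_inv a \<rho> s (sqrt (\<kappa>\<^sup>2 * t))"
  have "\<kappa>\<^sup>2 * t \<le> t" using t \<kappa> by (simp add: power_le_one mult_left_le_one_le)
  then have t': "0 < \<kappa>\<^sup>2 * t" "\<kappa>\<^sup>2 * t \<le> c" using t \<kappa> order_trans[OF _ t(2)] by auto
  have l: "0 < l" "l \<le> a" "psi \<rho> s l = sqrt t"
    unfolding l_def using psi_inv_sqrt[OF t] by auto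
  have l': "0 < l'" "l' \<le> a" "psi \<rho> s l' = \<kappa> * sqrt t"
    unfolding l'_def using psi_inv_sqrt[OF t'] \<kappa> by (auto simp: real_sqrt_mult)
  define b where "b = \<kappa> powr (1 / s) * l"
  have "\<kappa> powr (1 / s) \<le> 1" using \<kappa> s by (simp add: powr_le1)
  then have b: "0 < b" "b \<le> l" using l \<kappa> by (auto simp: b_def mult_left_le_one_le)
  have "psi \<rho> s b = \<kappa> * l powr s * \<rho> b"
    using \<kappa> l s by (simp add: psi_def b_def powr_mult powr_powr)
  also have "\<dots> \<le> \<kappa> * l powr s * \<rho> l"
    using b l \<kappa> index_function_less_iff(2)[OF \<rho>, of b l] by (intro mult_left_mono) auto
  also have "\<dots> = psi \<rho> s l'" using l l' by (simp add: psi_def)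
  finally have "b \<le> l'" using b l l' index_function_less_iff(2)[OF \<psi>, of b l'] by simp
  then have "b powr r \<le> l' powr r" using b r by (intro powr_mono2) auto
  then show ?thesis
    using l \<kappa> by (simp add: b_def powr_mult powr_powr kfun_def l_def l'_def)
qed

text \<open>\<open>N\<close> is the value of \<open>sqrt t * h t\<close> at the cut-off. That it is
  at most \<open>psi_p(a)\<close> will place \<open>c2 * \<delta>\<close> in the range of
  \<open>psi_p\<close>.\<close>

lemma scale_filter_bounds:
  assumes p: "0 < p"
    and decr: "antimono_on {0<..c} (\<lambda>t. kfun (p - s) t / sqrt t)"
    and \<alpha>: "\<forall>k\<in>{1..n}. 0 < \<alpha> k" and n: "1 \<le> n"
  obtains N where "0 < N" "N \<le> psi \<rho> p a"
    "\<And>t. 0 < t \<Longrightarrow> t \<le> c \<Longrightarrow> sqrt t * kfun (p - s) t * filter_residual \<alpha> n (M\<^sup>2 * t) \<le> N"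
    "\<And>t. 0 < t \<Longrightarrow> t \<le> c \<Longrightarrow> M\<^sup>2 * (sqrt t * g_filter \<alpha> n (M\<^sup>2 * t)) \<le> kfun (p - s) t / N"
proof -
  define \<sigma>1 where "\<sigma>1 = (\<Sum>k=1..n. 1 / \<alpha> k)"
  have \<sigma>1: "0 < \<sigma>1" unfolding \<sigma>1_def using \<alpha> n by (intro sum_pos) auto
  \<comment> \<open>\<open>\<sigma>1\<close> is the regularization parameter of the method;
    \<open>M^2\<close> appears because the calculus is that of \<open>S\<close> and not of
    \<open>M^2 S\<close>.\<close>
  define \<sigma> where "\<sigma> = M\<^sup>2 * \<sigma>1"
  have \<sigma>: "0 < \<sigma>" using M_pos \<sigma>1 by (simp add: \<sigma>_def)
  define \<mu> where "\<mu> = min (1 / \<sigma>) c"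
  have \<mu>: "0 < \<mu>" "\<mu> \<le> c" using \<sigma> \<psi>_a_pos by (auto simp: \<mu>_def)
  define N where "N = sqrt \<mu> * kfun (p - s) \<mu>"
  have decr': "kfun (p - s) u / sqrt u \<le> kfun (p - s) t / sqrt t" if "0 < t" "t \<le> u" "u \<le> c" for t u
    using monotone_onD[OF decr, of t u] that by simp
  show ?thesis
  proof (rule that[of N])
    show "0 < N" using \<mu> kfun_pos by (simp add: N_def)
    have "N = psi \<rho> p (psi_inv a \<rho> s (sqrt \<mu>))" unfolding N_def by (rule sqrt_kfun[OF \<mu>])
    also have "\<dots> \<le> psi \<rho> p a"
      using psi_inv_sqrt[OF \<mu>] c_pos index_function_less_iff(2)[OF index_psi[OF p]] by simp
    finally show "N \<le> psi \<rho> p a" .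
  next
    fix t assume t: "0 < t" "t \<le> c"
    have Mt: "0 < M\<^sup>2 * t" using M_pos t by simp
    let ?r = "filter_residual \<alpha> n (M\<^sup>2 * t)" and ?g = "g_filter \<alpha> n (M\<^sup>2 * t)"
    have r: "0 \<le> ?r" "?r \<le> 1" by (rule filter_residual_bounds[OF \<alpha> Mt]; assumption)+
    have "?r * (\<sigma> * t) \<le> 1"
    proof -
      have "?r * (\<sigma> * t) \<le> ?r * (1 + M\<^sup>2 * t * \<sigma>1)"
        using r by (intro mult_left_mono) (auto simp: \<sigma>_def mult_ac)
      also have "\<dots> \<le> 1" unfolding \<sigma>1_def by (rule filter_residual_le[OF \<alpha> Mt])
      finally show ?thesis .
    qed
    with r show "sqrt t * kfun (p - s) t * ?r \<le> N"
      unfolding N_def using kfun_pos sqrt_kfun_mono[OF p] decr'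
      by (intro filter_scalar_bounds(1)[OF _ _ _ \<sigma> \<mu>_def t])
    have lg: "M\<^sup>2 * t * ?g = 1 - ?r" by (rule g_filter_eq[OF Mt])
    have g0: "0 \<le> ?g" using lg r Mt by (metis diff_ge_0_iff_ge zero_le_mult_iff not_less)
    have "M\<^sup>2 * t * ?g \<le> M\<^sup>2 * t * \<sigma>1"
      using one_minus_filter_residual_le[OF \<alpha> Mt] lg by (simp add: \<sigma>1_def)
    then have "?g \<le> \<sigma>1" using Mt by (simp only: mult_le_cancel_left_pos)
    then have "M\<^sup>2 * ?g \<le> \<sigma>" using M_pos by (simp add: \<sigma>_def)
    moreover have "t * (M\<^sup>2 * ?g) \<le> 1" using lg r by (simp add: mult_ac)
    ultimately have "sqrt t * (M\<^sup>2 * ?g) \<le> kfun (p - s) t / N"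
      unfolding N_def using kfun_pos sqrt_kfun_mono[OF p] decr' mult_nonneg_nonneg[OF zero_le_power2 g0]
      by (intro filter_scalar_bounds(2)[OF _ _ _ \<sigma> \<mu>_def t])
    then show "M\<^sup>2 * (sqrt t * ?g) \<le> kfun (p - s) t / N" by (simp add: mult_ac)
  qed
qed

lemma error_le_from_residual:
  assumes p: "0 < p" and l0: "0 < l0" "l0 \<le> a" and w: "norm w \<le> W"
    and res: "norm (A (Gpow p w)) \<le> D * \<delta>" and c2: "0 < c2" "c2 * \<delta> = psi \<rho> p l0"
    and D: "0 \<le> D"
  shows "norm (Gpow p w) \<le> (W + D / (m * c2)) * l0 powr p"
proof -
  have p': "0 \<le> p" using p by simp
  have W: "0 \<le> W" using w norm_ge_zero by (rule order_trans[rotated])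
  have \<psi>p: "extends_continuously a (psi \<rho> p)"
    by (rule index_function_extends_continuously[OF index_psi[OF p] c_pos])
  have \<rho>0: "0 < \<rho> l0" using \<rho> l0 by (auto simp: index_function_def image_subset_iff)
  have "fun_op \<rho> G (Gpow p w) = fun_op (psi \<rho> p) G w"
    using fun_op_mult[OF extends_\<rho> extends_powr[OF p']] fun_op_cong[OF \<psi>p, of "\<lambda>l. \<rho> l * l powr p"]
    by (simp add: psi_def mult.commute)
  then have "m * norm (fun_op (psi \<rho> p) G w) \<le> D * \<delta>" using link(1)[of "Gpow p w"] res by simp
  then have \<psi>w: "norm (fun_op (psi \<rho> p) G w) \<le> D * \<delta> / m" using m_pos by (simp add: field_simps)
  let ?b = "(1 / \<rho> l0)\<^sup>2"
  \<comment> \<open>Below \<open>l0\<close> the powers compare directly; above it the factor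
    \<open>\<rho> l / \<rho> l0 \<ge> 1\<close> may be inserted.\<close>
  have le: "(l powr p)\<^sup>2 \<le> (l0 powr p)\<^sup>2 + ?b * (psi \<rho> p l)\<^sup>2" if l: "0 < l" "l \<le> a" for l
  proof (cases "l \<le> l0")
    case True
    then have "(l powr p)\<^sup>2 \<le> (l0 powr p)\<^sup>2" using l p by (intro power_mono powr_mono2) auto
    then show ?thesis by (simp add: add_increasing2)
  next
    case False
    then have "1 \<le> \<rho> l / \<rho> l0"
      using index_function_less_iff(2)[OF \<rho>, of l0 l] l l0 \<rho>0 by simp
    then have "(l powr p)\<^sup>2 * 1 \<le> (l powr p)\<^sup>2 * (\<rho> l / \<rho> l0)\<^sup>2"
      by (intro mult_left_mono) (auto simp: one_le_power)
    also have "\<dots> = ?b * (psi \<rho> p l)\<^sup>2" by (simp add: psi_def power_mult_distrib power_divide)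
    finally show ?thesis by (simp add: add_increasing)
  qed
  have ext: "extends_continuously a (\<lambda>l. (l powr p)\<^sup>2)" "extends_continuously a (\<lambda>l. (psi \<rho> p l)\<^sup>2)"
    by (intro extends_continuously_power extends_powr p' \<psi>p)+
  have "(norm (Gpow p w))\<^sup>2 = fun_op (\<lambda>l. (l powr p)\<^sup>2) G w \<bullet> w"
    by (rule fun_op_square_form[symmetric, OF extends_powr[OF p']])
  also have "\<dots> \<le> fun_op (\<lambda>l. (l0 powr p)\<^sup>2 + ?b * (psi \<rho> p l)\<^sup>2) G w \<bullet> w"
    by (intro fun_op_form_mono le ext extends_continuously_add extends_continuously_cmult extends_continuously_const)
  also have "\<dots> = (l0 powr p)\<^sup>2 * (norm w)\<^sup>2 + ?b * (norm (fun_op (psi \<rho> p) G w))\<^sup>2"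
    by (simp add: fun_op_add fun_op_cmult fun_op_const extends_continuously_const extends_continuously_cmult ext
        blinfun.add_left blinfun.scaleR_left inner_add_left fun_op_square_form[OF \<psi>p] flip: power2_norm_eq_inner)
  also have "\<dots> \<le> (l0 powr p)\<^sup>2 * W\<^sup>2 + ?b * (D * \<delta> / m)\<^sup>2"
    using w \<psi>w by (intro add_mono mult_left_mono power_mono) auto
  also have "?b * (D * \<delta> / m)\<^sup>2 = (D / (m * c2) * l0 powr p)\<^sup>2"
  proof -
    \<comment> \<open>The choice of \<open>l0\<close> balances the two terms:
      \<open>c2 * \<delta> = l0^p \<rho>(l0)\<close> makes \<open>\<delta> / \<rho>(l0)\<close> a
      multiple of \<open>l0^p\<close>.\<close>
    have "\<delta> / \<rho> l0 = l0 powr p / c2" using c2 \<rho>0 by (simp add: psi_def field_simps)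
    then have "1 / \<rho> l0 * (D * \<delta> / m) = D / (m * c2) * l0 powr p"
      by (metis (no_types, lifting) mult.assoc mult.commute mult.left_neutral times_divide_times_eq times_divide_eq_right)
    then show ?thesis by (simp only: flip: power_mult_distrib)
  qed
  also have "(l0 powr p)\<^sup>2 * W\<^sup>2 + \<dots> \<le> ((W + D / (m * c2)) * l0 powr p)\<^sup>2"
  proof -
    note W
    moreover define d where "d = D / (m * c2)"
    moreover have "0 \<le> d" using D m_pos c2 by (simp add: d_def)
    ultimately have "W\<^sup>2 + d\<^sup>2 \<le> (W + d)\<^sup>2"
      using mult_nonneg_nonneg[of W d] unfolding power2_sum by linarith
    then have "(l0 powr p)\<^sup>2 * (W\<^sup>2 + d\<^sup>2) \<le> (l0 powr p)\<^sup>2 * (W + d)\<^sup>2" by (rule mult_left_mono) simp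
    then show ?thesis unfolding d_def[symmetric] power_mult_distrib by (simp add: distrib_left mult_ac)
  qed
  finally show ?thesis
    by (rule power2_le_imp_le) (use W D m_pos c2 in simp)
qed

section \<open>From the filter bounds to the iterates\<close>

lemma fun_op_normal_operator:
  assumes \<alpha>: "\<forall>k\<in>{1..n}. 0 < \<alpha> k"
  shows "fun_op (g_filter \<alpha> n) (adj_op T o\<^sub>L T) = fun_op (\<lambda>t. g_filter \<alpha> n (M\<^sup>2 * t)) S"
proof -
  interpret S: positive_op S c by (rule positive_S)
  have "adj_op T o\<^sub>L T = M\<^sup>2 *\<^sub>R S" using M_pos by simp
  also have "\<dots> = fun_op (\<lambda>t. M\<^sup>2 * t) S"
    using S.fun_op_cmult[OF extends_continuously_id, of "M\<^sup>2"] by (simp only: S.fun_op_id)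
  also have "fun_op (g_filter \<alpha> n) (fun_op (\<lambda>t. M\<^sup>2 * t) S) = fun_op (\<lambda>t. g_filter \<alpha> n (M\<^sup>2 * t)) S"
  proof (rule S.fun_op_fun_op[where d = "M\<^sup>2 * c"])
    show "extends_continuously (M\<^sup>2 * c) (g_filter \<alpha> n)"
      using g_filter_extends[OF \<alpha>, where b = 1 and c = "M\<^sup>2 * c"] by simp
  qed (use M_pos in \<open>auto intro: extends_continuously_cmult extends_continuously_id\<close>)
  finally show ?thesis .
qed

lemma filter_regularization_scale:
  assumes \<alpha>: "\<forall>k\<in>{1..n}. 0 < \<alpha> k" and K: "1 \<le> K" and r: "0 \<le> r"
    and le: "\<And>x. norm (fun_op (kfun r) S x) \<le> norm (Gpow r x)"
      "\<And>x. norm (Gpow r x) \<le> K * norm (fun_op (kfun r) S x)"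
  shows "filter_regularization S c T M K (Gpow r) (kfun r)
    (\<lambda>t. g_filter \<alpha> n (M\<^sup>2 * t)) (\<lambda>t. filter_residual \<alpha> n (M\<^sup>2 * t))"
proof (intro filter_regularization.intro filter_regularization_axioms.intro positive_S M_pos K
    selfadjoint_Gpow inj_Gpow r extends_kfun kfun_pos le)
  show "adj_op T o\<^sub>L T = M\<^sup>2 *\<^sub>R S" using M_pos by simp
  have M2: "0 < M\<^sup>2" using M_pos by simp
  show "extends_continuously c (\<lambda>t. g_filter \<alpha> n (M\<^sup>2 * t))"
    "extends_continuously c (\<lambda>t. filter_residual \<alpha> n (M\<^sup>2 * t))"
    using g_filter_extends[OF \<alpha> M2] filter_residual_extends[OF \<alpha> M2] by auto
  fix t :: real assume "0 < t"
  then have Mt: "0 < M\<^sup>2 * t" using M2 by simp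
  show r: "0 \<le> filter_residual \<alpha> n (M\<^sup>2 * t) \<and> filter_residual \<alpha> n (M\<^sup>2 * t) \<le> 1"
    using filter_residual_bounds[OF \<alpha> Mt] by blast
  show eq: "filter_residual \<alpha> n (M\<^sup>2 * t) = 1 - M\<^sup>2 * t * g_filter \<alpha> n (M\<^sup>2 * t)"
    using g_filter_eq[OF Mt, of \<alpha> n] by simp
  then have "0 \<le> M\<^sup>2 * t * g_filter \<alpha> n (M\<^sup>2 * t)" using r by linarith
  then show "0 \<le> g_filter \<alpha> n (M\<^sup>2 * t)" using Mt by (simp only: zero_le_mult_iff) auto
qed

text \<open>Both orders are brought to a common form. For s \<le> p the filtered data are
  \<open>G^(p - s) (v + w)\<close>, and \<open>G^s\<close> completes the power to \<open>p\<close>;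
  otherwise \<open>G^s = G^p G^(s - p)\<close> and \<open>w = G^(s - p) q - v\<close>.\<close>

lemma iterate_error_representation:
  assumes p: "0 < p" and \<alpha>: "\<forall>k\<in>{1..n}. 0 < \<alpha> k" and n: "1 \<le> n" and K: "1 \<le> K"
    and decr: "antimono_on {0<..c} (\<lambda>t. kfun (p - s) t / sqrt t)"
    and le: "\<And>x. norm (fun_op (kfun \<bar>p - s\<bar>) S x) \<le> norm (Gpow \<bar>p - s\<bar> x)"
      "\<And>x. norm (Gpow \<bar>p - s\<bar> x) \<le> K * norm (fun_op (kfun \<bar>p - s\<bar>) S x)"
    and noise: "norm (A xd - yd) \<le> \<delta>" and source: "xd - x0 = Gpow p v" and v: "norm v \<le> E"
  obtains w N where "x_iter A G s \<alpha> n x0 yd - xd = Gpow p w" "0 < N" "N \<le> psi \<rho> p a"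
    "norm w \<le> K * (\<delta> / (M * N) + E)"
    "norm (A (x_iter A G s \<alpha> n x0 yd) - yd) \<le> \<delta> + M * K * E * N"
proof -
  obtain N where N: "0 < N" "N \<le> psi \<rho> p a"
    and approx: "\<And>t. 0 < t \<Longrightarrow> t \<le> c \<Longrightarrow> sqrt t * kfun (p - s) t * filter_residual \<alpha> n (M\<^sup>2 * t) \<le> N"
    and propagated: "\<And>t. 0 < t \<Longrightarrow> t \<le> c \<Longrightarrow> M\<^sup>2 * (sqrt t * g_filter \<alpha> n (M\<^sup>2 * t)) \<le> kfun (p - s) t / N"
    using scale_filter_bounds[OF p decr \<alpha> n] by blast
  interpret F: filter_regularization S c T M K "Gpow \<bar>p - s\<bar>" "kfun \<bar>p - s\<bar>"
    "\<lambda>t. g_filter \<alpha> n (M\<^sup>2 * t)" "\<lambda>t. filter_residual \<alpha> n (M\<^sup>2 * t)"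
    by (rule filter_regularization_scale[OF \<alpha> K _ le]) auto
  define y where "y = yd - A x0"
  define \<eta> where "\<eta> = yd - A xd"
  define q where "q = fun_op (\<lambda>t. g_filter \<alpha> n (M\<^sup>2 * t)) S (adj_op T y)"
  have \<eta>: "norm \<eta> \<le> \<delta>" using noise by (simp add: \<eta>_def norm_minus_commute)
  have y: "y = \<eta> + A (Gpow p v)"
    unfolding source[symmetric] by (simp add: y_def \<eta>_def blinfun.diff_right)
  have iter: "x_iter A G s \<alpha> n x0 yd = x0 + power_op G s q"
    by (simp add: x_iter_def Let_def fun_op_normal_operator[OF \<alpha>] q_def y_def)
  have err: "x_iter A G s \<alpha> n x0 yd - xd = power_op G s q - Gpow p v"
    unfolding iter source[symmetric] by simp
  have res: "A (x_iter A G s \<alpha> n x0 yd) - yd = A (power_op G s q) - y"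
    unfolding iter y_def by (simp add: blinfun.add_right)
  have p': "0 \<le> p" using p by simp
  show ?thesis
  proof (cases "s \<le> p")
    case True
    then have abs: "\<bar>p - s\<bar> = p - s" by simp
    obtain w where w: "q = Gpow (p - s) (v + w)" "norm w \<le> K * (\<delta> / (M * N) + E)"
      and resid: "norm (T q - y) \<le> \<delta> + M * K * E * N"
    proof (rule F.low_order_representation[OF N(1) _ _ \<eta> v, of y])
      show "y = \<eta> + T (Gpow \<bar>p - s\<bar> v)" unfolding abs T_Gpow(1)[OF p' True] by (rule y)
    qed (use approx propagated in \<open>auto simp: abs q_def\<close>)
    have "power_op G s q = Gpow p (v + w)" unfolding w(1) by (rule T_Gpow(3)[OF p' True])
    moreover have "T q = A (Gpow p (v + w))" unfolding w(1) by (rule T_Gpow(1)[OF p' True])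
    ultimately show ?thesis
      using that[of w N] N w(2) resid err res by (simp add: blinfun.add_right)
  next
    case False
    then have ps: "p \<le> s" and abs: "\<bar>p - s\<bar> = s - p" by auto
    \<comment> \<open>The scalar bounds are stated with \<open>h\<close>. In this order
      \<open>k = w = 1 / h\<close>, and multiplying both by \<open>k\<close> gives the hypotheses of
      \<open>high_order_bound\<close>.\<close>
    have inv: "kfun (p - s) t = 1 / kfun (s - p) t" for t
      using powr_minus_divide[of "psi_inv a \<rho> s (sqrt t)" "s - p"] by (simp add: kfun_def)
    have TF: "T u = (A o\<^sub>L Gpow p) (Gpow \<bar>p - s\<bar> u)" for u
      unfolding abs by (simp add: T_Gpow(2)[OF p' ps])
    have approx': "sqrt t * filter_residual \<alpha> n (M\<^sup>2 * t) \<le> N * kfun \<bar>p - s\<bar> t" if "0 < t" "t \<le> c" for t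
      using approx[OF that] kfun_pos[OF that, of "s - p"] by (simp add: inv abs field_simps)
    have propagated': "M\<^sup>2 * (sqrt t * g_filter \<alpha> n (M\<^sup>2 * t) * kfun \<bar>p - s\<bar> t) \<le> 1 / N"
      if "0 < t" "t \<le> c" for t
      using propagated[OF that] kfun_pos[OF that, of "s - p"] N(1) by (simp add: inv abs field_simps)
    have y': "y = \<eta> + (A o\<^sub>L Gpow p) v" using y by simp
    note bounds = F.high_order_bound[OF N(1) approx' propagated' \<eta> v TF y', folded q_def, unfolded abs]
    define w where "w = Gpow (s - p) q - v"
    have "power_op G s q = Gpow p (Gpow (s - p) q)" by (rule T_Gpow(4)[OF p' ps])
    moreover have "T q = A (Gpow p (Gpow (s - p) q))" by (rule T_Gpow(2)[OF p' ps])
    ultimately show ?thesis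
      using that[of w N] N bounds err res by (simp add: w_def blinfun.diff_right)
  qed
qed

lemma discrepancy_convergence_rate:
  assumes const: "0 < p" "0 < E" "1 < C1" "C1 \<le> C2" and \<kappa>: "0 < \<kappa>" "\<kappa> \<le> 1"
    and scaled: "\<And>t. 0 < t \<Longrightarrow> t \<le> c \<Longrightarrow> \<kappa> * kfun \<bar>p - s\<bar> t \<le> kfun \<bar>p - s\<bar> ((m / M)\<^sup>2 * t)"
    and mono: "operator_monotone TYPE('x) c (\<lambda>t. (kfun \<bar>p - s\<bar> t)\<^sup>2)"
    and decr: "antimono_on {0<..c} (\<lambda>t. kfun (p - s) t / sqrt t)"
  shows "\<exists>c1>0. \<exists>c2>0. \<forall>xd x0 v y yd \<delta> n (\<alpha>::nat \<Rightarrow> real).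
    A xd = y \<longrightarrow> 0 < \<delta> \<longrightarrow> norm (y - yd) \<le> \<delta> \<longrightarrow>
    xd - x0 = power_op G p v \<longrightarrow> norm v \<le> E \<longrightarrow>
    1 \<le> n \<longrightarrow> (\<forall>k\<in>{1..n}. 0 < \<alpha> k) \<longrightarrow>
    C1 * \<delta> \<le> norm (A (x_iter A G s \<alpha> n x0 yd) - yd) \<longrightarrow>
    norm (A (x_iter A G s \<alpha> n x0 yd) - yd) \<le> C2 * \<delta> \<longrightarrow>
    c2 * \<delta> \<in> psi \<rho> p ` {0<..a} \<and>
    norm (x_iter A G s \<alpha> n x0 yd - xd) \<le> c1 * (psi_inv a \<rho> p (c2 * \<delta>)) powr p"
proof -
  define K where "K = 1 / \<kappa>"
  have K: "1 \<le> K" using \<kappa> by (simp add: K_def)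
  have le: "norm (fun_op (kfun \<bar>p - s\<bar>) S x) \<le> norm (Gpow \<bar>p - s\<bar> x)"
    "norm (Gpow \<bar>p - s\<bar> x) \<le> K * norm (fun_op (kfun \<bar>p - s\<bar>) S x)" for x
    unfolding K_def by (rule kfun_comparison[OF _ mono \<kappa>(1) scaled]; simp)+
  \<comment> \<open>Bounds \<open>norm w\<close>: inserting \<open>N \<ge> c2 * \<delta>\<close>
    into \<open>\<delta> / (M * N)\<close> gives
    \<open>1 / (M * c2) = K * E / (C1 - 1)\<close>.\<close>
  define W where "W = K * (K * E / (C1 - 1) + E)"
  \<comment> \<open>The lower discrepancy bound and the residual estimate give
    \<open>C1 * \<delta> \<le> \<delta> + M * K * E * N\<close>; this constant makes it read
    \<open>c2 * \<delta> \<le> N\<close>.\<close>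
  define c2 where "c2 = (C1 - 1) / (M * K * E)"
  \<comment> \<open>The constant of \<open>error_le_from_residual\<close> with
    \<open>D = C2 + 1\<close>: the discrepancy plus the noise.\<close>
  define c1 where "c1 = W + (C2 + 1) / (m * c2)"
  have c2: "0 < c2" using const M_pos K by (simp add: c2_def)
  have W: "0 \<le> W" using const K by (simp add: W_def)
  have c1: "0 < c1" unfolding c1_def using W const c2 m_pos by (intro add_nonneg_pos) auto
  have "c2 * \<delta> \<in> psi \<rho> p ` {0<..a} \<and>
    norm (x_iter A G s \<alpha> n x0 yd - xd) \<le> c1 * (psi_inv a \<rho> p (c2 * \<delta>)) powr p"
    if \<delta>: "0 < \<delta>" and noise: "norm (A xd - yd) \<le> \<delta>" and source: "xd - x0 = power_op G p v"
      and v: "norm v \<le> E" and n: "1 \<le> n" and \<alpha>: "\<forall>k\<in>{1..n}. 0 < \<alpha> k"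
      and lower: "C1 * \<delta> \<le> norm (A (x_iter A G s \<alpha> n x0 yd) - yd)"
      and upper: "norm (A (x_iter A G s \<alpha> n x0 yd) - yd) \<le> C2 * \<delta>"
    for xd x0 v yd \<delta> n and \<alpha> :: "nat \<Rightarrow> real"
  proof -
    have source': "xd - x0 = Gpow p v" using source const by (simp add: power_op_nonneg)
    obtain w N where w: "x_iter A G s \<alpha> n x0 yd - xd = Gpow p w" and N: "0 < N" "N \<le> psi \<rho> p a"
      and norm_w: "norm w \<le> K * (\<delta> / (M * N) + E)"
      and res: "norm (A (x_iter A G s \<alpha> n x0 yd) - yd) \<le> \<delta> + M * K * E * N"
      using iterate_error_representation[OF const(1) \<alpha> n K decr le noise source' v] by blast
    have MKE: "0 < M * K * E" using M_pos K const by simp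
    have "(C1 - 1) * \<delta> \<le> M * K * E * N" using lower res by (simp add: algebra_simps)
    then have \<delta>N: "c2 * \<delta> \<le> N" using MKE by (simp add: c2_def pos_divide_le_eq mult_ac)
    have "\<delta> \<le> N / c2" using \<delta>N c2 by (simp add: field_simps)
    then have "\<delta> / (M * N) \<le> N / c2 / (M * N)" using M_pos N by (intro divide_right_mono) auto
    also have "\<dots> = K * E / (C1 - 1)" using M_pos N const K by (simp add: c2_def)
    finally have "K * (\<delta> / (M * N) + E) \<le> W" unfolding W_def using K by (intro mult_left_mono) auto
    with norm_w have wW: "norm w \<le> W" by simp
    have in_range: "0 < c2 * \<delta>" "c2 * \<delta> \<le> psi \<rho> p a" using c2 \<delta> \<delta>N N by auto
    note l0 = index_function_inverse[OF index_psi[OF const(1)] c_pos in_range, folded psi_inv_def]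
    have "A (Gpow p w) = (A (x_iter A G s \<alpha> n x0 yd) - yd) - (A xd - yd)"
      unfolding w[symmetric] by (simp add: blinfun.diff_right)
    then have "norm (A (Gpow p w)) \<le> norm (A (x_iter A G s \<alpha> n x0 yd) - yd) + norm (A xd - yd)"
      using norm_triangle_ineq4 by metis
    then have "norm (A (Gpow p w)) \<le> (C2 + 1) * \<delta>" using upper noise by (simp add: distrib_right)
    then have "norm (Gpow p w) \<le> c1 * (psi_inv a \<rho> p (c2 * \<delta>)) powr p"
      unfolding c1_def using const l0(3)[symmetric]
      by (intro error_le_from_residual[OF const(1) l0(1,2) wW _ c2]) auto
    then show ?thesis using w in_range index_function_image[OF index_psi[OF const(1)] c_pos] by simp
  qed
  then show ?thesis using c1 c2 by blast
qed

end

theorem theorem4p5: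
  fixes A :: "'x::{real_inner,banach} \<Rightarrow>\<^sub>L 'y::{real_inner,banach}"
    and B :: "'x \<Rightarrow> 'x" and D :: "'x set" and G :: "'x \<Rightarrow>\<^sub>L 'x"
    and \<rho> :: "real \<Rightarrow> real" and s p m M E C1 C2 :: real
  assumes A: "inj (blinfun_apply A)" "\<not> closed (range (blinfun_apply A))"
    and B: "densely_defined_selfadjoint D B" "strictly_positive_on D B" "unbounded_on D B"
    and G: "inverse_of_on G D B"
    and \<rho>: "index_function (norm G) (\<rho> (norm G)) \<rho>"
    and \<psi>: "index_function (norm G) (psi \<rho> s (norm G)) (psi \<rho> s)"
    and const: "0 < m" "m \<le> M" "0 < p" "0 < E" "1 < C1" "C1 \<le> C2"
    and link: "\<And>x. m * norm (fun_op \<rho> G x) \<le> norm (A x)"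
              "\<And>x. norm (A x) \<le> M * norm (fun_op \<rho> G x)"
    and high: "p \<le> s \<Longrightarrow>
      operator_monotone TYPE('x) ((psi \<rho> s (norm G))\<^sup>2) (\<lambda>t. (w_fun (norm G) \<rho> p s t)\<^sup>2)"
    and low: "s \<le> p \<Longrightarrow>
      operator_monotone TYPE('x) ((psi \<rho> s (norm G))\<^sup>2) (\<lambda>t. (h_fun (norm G) \<rho> p s t)\<^sup>2)"
      "s \<le> p \<Longrightarrow>
      antimono_on {0<..(psi \<rho> s (norm G))\<^sup>2} (\<lambda>t. h_fun (norm G) \<rho> p s t / sqrt t)"
    and \<xi>: "convex_on {0<..norm G powr (2 * p)} (xi_fun \<rho> p)"
  shows "\<exists>c1>0. \<exists>c2>0. \<forall>(x\<^sub>d::'x) x0 v (y::'y) y\<^sub>\<delta> \<delta> n (\<alpha>::nat \<Rightarrow> real).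
    A x\<^sub>d = y \<longrightarrow> 0 < \<delta> \<longrightarrow> norm (y - y\<^sub>\<delta>) \<le> \<delta> \<longrightarrow>
    x\<^sub>d - x0 = power_op G p v \<longrightarrow> norm v \<le> E \<longrightarrow>
    1 \<le> n \<longrightarrow> (\<forall>k\<in>{1..n}. 0 < \<alpha> k) \<longrightarrow>
    C1 * \<delta> \<le> norm (A (x_iter A G s \<alpha> n x0 y\<^sub>\<delta>) - y\<^sub>\<delta>) \<longrightarrow>
    norm (A (x_iter A G s \<alpha> n x0 y\<^sub>\<delta>) - y\<^sub>\<delta>) \<le> C2 * \<delta> \<longrightarrow>
    c2 * \<delta> \<in> psi \<rho> p ` {0<..norm G} \<and>
    norm (x_iter A G s \<alpha> n x0 y\<^sub>\<delta> - x\<^sub>d) \<le> c1 * (psi_inv (norm G) \<rho> p (c2 * \<delta>)) powr p"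
proof -
  \<comment> \<open>On the trivial space the range of \<open>A\<close> would be \<open>{0}\<close>,
    which is closed. Nontriviality makes \<open>norm G\<close> positive.\<close>
  have "\<exists>x::'x. x \<noteq> 0"
  proof (rule ccontr)
    assume "\<not> ?thesis"
    then have "blinfun_apply A x = 0" for x by (metis blinfun.zero_right)
    then have "range (blinfun_apply A) = {0}" by auto
    then show False using A(2) by simp
  qed
  then interpret G: positive_op G "norm G" by (rule positive_op_inverse_generator[OF B(1,2) G])
  interpret linked_scale G "norm G" A \<rho> s m M
    by unfold_locales (use \<rho> \<psi> const link in auto)
  have mM: "0 < m / M" "m / M \<le> 1" using const by auto
  have h: "h_fun (norm G) \<rho> p s = kfun (p - s)"
    by (simp add: fun_eq_iff h_fun_def kfun_def)
  show ?thesis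
  proof (cases "s \<le> p")
    case True
    then have abs: "\<bar>p - s\<bar> = p - s" by simp
    have decr: "antimono_on {0<..c} (\<lambda>t. kfun (p - s) t / sqrt t)" using low(2)[OF True] by (simp only: h)
    show ?thesis
    proof (rule discrepancy_convergence_rate[OF const(3-6) mM])
      show "operator_monotone TYPE('x) c (\<lambda>t. (kfun \<bar>p - s\<bar> t)\<^sup>2)"
        using low(1)[OF True] by (simp only: h abs)
      show "antimono_on {0<..c} (\<lambda>t. kfun (p - s) t / sqrt t)" by (rule decr)
      show "m / M * kfun \<bar>p - s\<bar> t \<le> kfun \<bar>p - s\<bar> ((m / M)\<^sup>2 * t)" if "0 < t" "t \<le> c" for t
        unfolding abs by (rule kfun_scaled_low[OF decr that mM])
    qed
  next
    case False
    then have ps: "p \<le> s" and abs: "\<bar>p - s\<bar> = s - p" and s: "0 < s" using const by auto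
    have w: "w_fun (norm G) \<rho> p s = kfun (s - p)"
      using powr_minus_divide[of _ "p - s"] by (simp add: fun_eq_iff w_fun_def h kfun_def)
    show ?thesis
    proof (rule discrepancy_convergence_rate[OF const(3-6)])
      \<comment> \<open>The scaling loss \<open>\<kappa>\<close> depends on the order: for s \<le> p
        it is \<open>m / M\<close>, from the decrease of \<open>h / sqrt\<close>; here it is a power
        of that, from the growth of \<open>psi_s\<close>.\<close>
      show "0 < (m / M) powr ((s - p) / s)" "(m / M) powr ((s - p) / s) \<le> 1"
        using mM ps s by (auto intro: powr_le1)
      show "operator_monotone TYPE('x) c (\<lambda>t. (kfun \<bar>p - s\<bar> t)\<^sup>2)"
        using high[OF ps] by (simp only: w abs)
      \<comment> \<open>In this order the decrease is automatic: the exponent \<open>p - s\<close>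
        is negative, so \<open>h\<close> itself decreases.\<close>
      show "antimono_on {0<..c} (\<lambda>t. kfun (p - s) t / sqrt t)"
      proof (rule monotone_onI, rule frac_le)
        fix t u assume "t \<in> {0<..c}" "u \<in> {0<..c}" "t \<le> u"
        then have t: "0 < t" "t \<le> u" "u \<le> c" by auto
        show "kfun (p - s) u \<le> kfun (p - s) t"
          unfolding kfun_def using psi_inv_sqrt_mono[OF t] psi_inv_sqrt[of t] t ps by (intro powr_mono2') auto
        show "0 \<le> kfun (p - s) t" by (simp add: kfun_def)
        show "0 < sqrt t" "sqrt t \<le> sqrt u" using t by auto
      qed
      show "(m / M) powr ((s - p) / s) * kfun \<bar>p - s\<bar> t \<le> kfun \<bar>p - s\<bar> ((m / M)\<^sup>2 * t)"
        if "0 < t" "t \<le> c" for t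
        unfolding abs by (rule kfun_scaled_high[OF s _ that mM]) (use ps in simp)
    qed
  qed
qed

end
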